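(* There exists $\epsilon_0>0$ such that for any $0<\epsilon\le\epsilon_0$ there is some $\rho>1$ such that $$J_\epsilon(t)\ge \rho^{\rho^t}$$ for all sufficiently large integers $t$; that is, $J_\epsilon(t)$ is bounded below by a double-exponential function of $t$ as $t\to\infty$.
   Context: Let $M=\langle a,b\mid a^2=b^3=1\rangle$ (isomorphic to $PSL(2,\mathbb Z)$) and $A=\{a,b,b^{-1}\}$. A word $w\in A^\ast$ is reduced if it contains no subword of the form $aa$, $bb$, $b^{-1}b^{-1}$, $bb^{-1}$, $b^{-1}b$. It is cyclically reduced if $w$ and all its cyclic permutations are reduced. (Every nonempty cyclically reduced word is either a single letter or has even length.) For $\epsilon>0$ and an integer $t\ge 1$, $J_\epsilon(t)$ is the number of isomorphism types of groups of the form $G=M/\langle\langle r_1,\dots,r_m\rangle\rangle$, where $m=2^{t\epsilon}$ (rounded down to an integer), each $r_i$ is a cyclically reduced word of length $2t$ in $A^\ast$, and $\langle\langle\cdot\rangle\rangle$ denotes normal closure in $M$. *)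

theory Defs
  imports Complex_Main "HOL-Library.Sublist" "HOL-Algebra.Algebra"
begin

section \<open>Free groups, normal closures and group presentations\<close>

text \<open>
  A letter \<^term>\<open>(x, True)\<close> stands for the generator \<^term>\<open>x\<close>, and \<^term>\<open>(x, False)\<close> for its
  formal inverse.
\<close>

type_synonym 'g sword = "('g \<times> bool) list"

inductive cancels :: "'g sword \<Rightarrow> 'g sword \<Rightarrow> bool" where
  "cancels (u @ [(x, s), (x, \<not> s)] @ v) (u @ v)"

definition free_eq :: "('g sword \<times> 'g sword) set" where
  "free_eq = {(u, v). equivclp cancels u v}"

definition free_class :: "'g sword \<Rightarrow> 'g sword set" where
  "free_class w = free_eq `` {w}"

definition free_group :: "'g sword set monoid" where
  "free_group =
     \<lparr>carrier = UNIV // free_eq,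
      monoid.mult = (\<lambda>U V. \<Union>u\<in>U. \<Union>v\<in>V. free_class (u @ v)),
      one = free_class []\<rparr>"

definition normal_closure :: "('a, 'b) monoid_scheme \<Rightarrow> 'a set \<Rightarrow> 'a set" where
  "normal_closure G S = \<Inter>{N. N \<lhd> G \<and> S \<subseteq> N}"

definition presented_group :: "'g sword set \<Rightarrow> 'g sword set set monoid" where
  "presented_group R = free_group Mod normal_closure free_group (free_class ` R)"

definition presented_elem :: "'g sword set \<Rightarrow> 'g sword \<Rightarrow> 'g sword set set" where
  "presented_elem R w =
     normal_closure free_group (free_class ` R) #>\<^bsub>free_group\<^esub> free_class w"


section \<open>The modular group and cyclically reduced words\<close>

datatype gen = Gen_a | Gen_b

type_synonym letter = "gen \<times> bool"

definition la :: letter where "la = (Gen_a, True)"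
definition lb :: letter where "lb = (Gen_b, True)"
definition lbi :: letter where "lbi = (Gen_b, False)"

definition modular_rels :: "gen sword set" where
  "modular_rels = {[la, la], [lb, lb, lb]}"

definition M :: "gen sword set set monoid" where
  "M = presented_group modular_rels"

definition M_elem :: "gen sword \<Rightarrow> gen sword set set" where
  "M_elem = presented_elem modular_rels"

definition A :: "letter set" where
  "A = {la, lb, lbi}"

definition reduced :: "letter list \<Rightarrow> bool" where
  "reduced w \<longleftrightarrow>
     (\<forall>f \<in> {[la, la], [lb, lb], [lbi, lbi], [lb, lbi], [lbi, lb]}. \<not> sublist f w)"

definition cyclically_reduced :: "letter list \<Rightarrow> bool" where
  "cyclically_reduced w \<longleftrightarrow> reduced w \<and> (\<forall>n. reduced (rotate n w))"


section \<open>Counting isomorphism types of quotients\<close>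

definition M_quotient :: "letter list list \<Rightarrow> gen sword set set set monoid" where
  "M_quotient rs = M Mod normal_closure M (M_elem ` set rs)"

text \<open>
  The relators form a tuple, so repetitions among them are allowed.
\<close>

definition M_quotients :: "real \<Rightarrow> nat \<Rightarrow> gen sword set set set monoid set" where
  "M_quotients \<epsilon> t =
     {M_quotient rs | rs. length rs = nat \<lfloor>2 powr (real t * \<epsilon>)\<rfloor> \<and>
        (\<forall>r \<in> set rs. r \<in> lists A \<and> cyclically_reduced r \<and> length r = 2 * t)}"

definition iso_types :: "('a, 'b) monoid_scheme set \<Rightarrow> ('a, 'b) monoid_scheme set set" where
  "iso_types \<G> = \<G> // {(G, H). G \<in> \<G> \<and> H \<in> \<G> \<and> G \<cong> H}"

definition J :: "real \<Rightarrow> nat \<Rightarrow> nat" where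
  "J \<epsilon> t = card (iso_types (M_quotients \<epsilon> t))"


section \<open>The constructions are well defined\<close>

lemma equiv_free_eq: "equiv UNIV free_eq"
  unfolding free_eq_def using equivp_evquivclp[of cancels]
  by (simp add: equivp_equiv)

lemma free_class_eq_iff: "free_class u = free_class v \<longleftrightarrow> (u, v) \<in> free_eq"
  unfolding free_class_def by (rule eq_equiv_class_iff[OF equiv_free_eq UNIV_I UNIV_I])

lemma cancels_append: "cancels u v \<Longrightarrow> cancels (p @ u @ q) (p @ v @ q)"
proof (induction rule: cancels.induct)
  case (1 u x s v)
  show ?case using cancels.intros[of "p @ u" x s "v @ q"] by simp
qed

lemma free_eq_append_ctx: "(u, v) \<in> free_eq \<Longrightarrow> (p @ u @ q, p @ v @ q) \<in> free_eq"
proof -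
  have "equivclp cancels (p @ u @ q) (p @ v @ q)" if "equivclp cancels u v"
    using that
  proof (induction rule: equivclp_induct)
    case base
    show ?case by simp
  next
    case (step y z)
    then have "equivclp cancels (p @ y @ q) (p @ z @ q)"
      by (metis cancels_append equivclp_sym r_into_equivclp)
    with step.IH show ?case by (meson equivclp_trans)
  qed
  then show "(u, v) \<in> free_eq \<Longrightarrow> ?thesis" by (simp add: free_eq_def)
qed

lemma free_eq_append:
  assumes "(u, u') \<in> free_eq" "(v, v') \<in> free_eq"
  shows "(u @ v, u' @ v') \<in> free_eq"
  using free_eq_append_ctx[OF assms(1), of "[]" v] free_eq_append_ctx[OF assms(2), of u' "[]"]
    equiv_free_eq unfolding equiv_def trans_def by (simp, blast)

lemma free_mult [simp]: "free_class u \<otimes>\<^bsub>free_group\<^esub> free_class v = free_class (u @ v)"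
proof -
  have "free_class (u' @ v') = free_class (u @ v)"
    if "u' \<in> free_class u" "v' \<in> free_class v" for u' v'
    using that free_eq_append[of u u' v v'] by (simp add: free_class_def flip: free_class_eq_iff)
  moreover have "u \<in> free_class u" "v \<in> free_class v"
    using equiv_free_eq by (auto simp: free_class_def equiv_def refl_on_def)
  ultimately have "(\<Union>u'\<in>free_class u. \<Union>v'\<in>free_class v. free_class (u' @ v')) = free_class (u @ v)"
    by blast
  then show ?thesis by (simp add: free_group_def)
qed

lemma free_one: "\<one>\<^bsub>free_group\<^esub> = free_class []"
  by (simp add: free_group_def)

lemma carrier_free_group: "carrier free_group = range free_class"
  by (auto simp: free_group_def quotient_def free_class_def)

lemma free_inverse: "free_class (map (\<lambda>(x, s). (x, \<not> s)) (rev w) @ w) = free_class []"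
proof (induction w)
  case (Cons l w)
  obtain x s where l: "l = (x, s)" by (cases l)
  let ?i = "map (\<lambda>(x, s). (x, \<not> s)) (rev w)"
  have "cancels (?i @ [(x, \<not> s), (x, \<not> \<not> s)] @ w) (?i @ w)" by (rule cancels.intros)
  then have "free_class (?i @ [(x, \<not> s), (x, s)] @ w) = free_class (?i @ w)"
    unfolding free_class_eq_iff free_eq_def by auto
  with Cons show ?case by (simp add: l)
qed simp

lemma group_free_group: "group free_group"
proof (rule groupI)
  fix x assume "x \<in> carrier free_group"
  then obtain w where "x = free_class w" by (auto simp: carrier_free_group)
  then show "\<exists>y\<in>carrier free_group. y \<otimes>\<^bsub>free_group\<^esub> x = \<one>\<^bsub>free_group\<^esub>"
    using free_inverse[of w] by (auto simp: carrier_free_group free_one)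
qed (auto simp: carrier_free_group free_one)

lemma normal_normal_closure:
  assumes "group G" "S \<subseteq> carrier G"
  shows "normal_closure G S \<lhd> G"
proof -
  interpret group G by fact
  have top: "carrier G \<lhd> G"
    by (auto simp: normal_inv_iff subgroup_self)
  show ?thesis
    unfolding normal_inv_iff
  proof (intro conjI ballI)
    show "subgroup (normal_closure G S) G"
      unfolding normal_closure_def using top assms(2)
      by (intro subgroups_Inter) (auto simp: normal_imp_subgroup)
  next
    fix x h assume "x \<in> carrier G" "h \<in> normal_closure G S"
    then show "x \<otimes>\<^bsub>G\<^esub> h \<otimes>\<^bsub>G\<^esub> inv\<^bsub>G\<^esub> x \<in> normal_closure G S"
      unfolding normal_closure_def by (auto simp: normal_inv_iff)
  qed
qed

lemma group_presented_group: "group (presented_group R)"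
  unfolding presented_group_def
  by (intro normal.factorgroup_is_group normal_normal_closure group_free_group)
    (auto simp: carrier_free_group)

lemma group_M: "group M"
  unfolding M_def by (rule group_presented_group)

lemma M_elem_in_carrier: "M_elem w \<in> carrier M"
  by (auto simp: M_elem_def M_def presented_elem_def presented_group_def FactGroup_def
      RCOSETS_def carrier_free_group)

lemma M_elem_append: "M_elem u \<otimes>\<^bsub>M\<^esub> M_elem v = M_elem (u @ v)"
proof -
  have "normal_closure free_group (free_class ` modular_rels) \<lhd> free_group"
    by (intro normal_normal_closure group_free_group) (auto simp: carrier_free_group)
  then show ?thesis
    by (simp add: M_elem_def M_def presented_elem_def presented_group_def FactGroup_def
        normal.rcos_sum carrier_free_group)
qed

lemma group_M_quotient: "group (M_quotient rs)"
  unfolding M_quotient_def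
  by (intro normal.factorgroup_is_group normal_normal_closure group_M)
    (auto simp: M_elem_in_carrier)

lemma finite_M_quotients: "finite (M_quotients \<epsilon> t)"
proof -
  let ?m = "nat \<lfloor>2 powr (real t * \<epsilon>)\<rfloor>"
  let ?W = "{w. set w \<subseteq> A \<and> length w = 2 * t}"
  have "finite ?W" by (rule finite_lists_length_eq) (simp add: A_def)
  then have "finite {rs. set rs \<subseteq> ?W \<and> length rs = ?m}" by (rule finite_lists_length_eq)
  moreover have "M_quotients \<epsilon> t \<subseteq> M_quotient ` {rs. set rs \<subseteq> ?W \<and> length rs = ?m}"
    by (auto simp: M_quotients_def)
  ultimately show ?thesis by (meson finite_imageI finite_subset)
qed

lemma equiv_iso_on:
  assumes "\<And>G. G \<in> \<G> \<Longrightarrow> group G"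
  shows "equiv \<G> {(G, H). G \<in> \<G> \<and> H \<in> \<G> \<and> G \<cong> H}"
proof (rule equivI)
  show "refl_on \<G> {(G, H). G \<in> \<G> \<and> H \<in> \<G> \<and> G \<cong> H}"
    by (rule refl_onI) (simp add: iso_refl)
  show "sym {(G, H). G \<in> \<G> \<and> H \<in> \<G> \<and> G \<cong> H}"
    by (rule symI) (use assms in \<open>blast intro: group.iso_sym\<close>)
  show "trans {(G, H). G \<in> \<G> \<and> H \<in> \<G> \<and> G \<cong> H}"
    by (rule transI) (blast intro: iso_trans)
qed auto

end

theory Submission
  imports Defs
begin

text \<open>
  Fix a finite quotient \<open>P = M/K\<close> with \<open>n\<close> elements. Its Schreier generators \<open>k\<close> and the relators
  \<open>k\<^sup>5\<close>, \<open>[[k, k'], a]\<close>, \<open>[[k, k'], b]\<close> define a quotient of \<open>M\<close> in which \<open>K\<close> becomes abelian of exponent 5 modulo a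
  central subgroup \<open>Z\<close> of exponent 5. If \<open>G\<close> is a further quotient by a part of \<open>Z\<close>, then a
  homomorphism \<open>M \<rightarrow> G\<close> is determined modulo \<open>Z\<close>, because 5 is coprime to 2 and 3, and the index of \<open>Z\<close>
  is at most \<open>n 5\<^sup>O\<^sup>(\<^sup>n\<^sup>)\<close>. So at most \<open>e\<^sup>O\<^sup>(\<^sup>n\<^sup>)\<close> kernels of homomorphisms from \<open>M\<close> give groups isomorphic to \<open>G\<close>.
  On the other hand, \<open>Z\<close> contains about \<open>n\<close> independent commutators \<open>x\<^sub>i = [w, h\<^sub>i w h\<^sub>i\<^sup>-\<^sup>1]\<close>, which is seen in suitable
  Heisenberg groups over \<open>F\<^sub>5[P]\<close>, and the relators \<open>x\<^sub>i = x\<^bsub>q + f(i)\<^esub>\<close> for \<open>f : {0, ..., q-1} \<rightarrow> {0, ..., q-1}\<close>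
  define \<open>q\<^sup>q\<close> different kernels. Since \<open>q\<^sup>q\<close> outgrows \<open>e\<^sup>O\<^sup>(\<^sup>n\<^sup>)\<close>, at least \<open>e\<^sup>n\<close> isomorphism types arise.

  For this \<open>n\<close> must be exponential in \<open>t\<close>, while all relators have length at most \<open>2 t\<close>. A group with a normal elementary
  abelian 2-subgroup of index \<open>s\<close> has diameter at most \<open>4 s\<close>, so lamplighter groups over groups with about \<open>t\<close> elements
  will do. Finally, the relators are brought to length \<open>2 t\<close> by inserting conjugates of a
  power of \<open>ab\<close> that is itself trivial.
\<close>


section \<open>Words and normal subgroups of the modular group\<close>

text \<open>Two obstacles shape the construction. The first is parity. For t \<ge> 1 a cyclically
  reduced word of length 2t has exactly t letters a. For even t every relator therefore dies in the
  quotient Z/2 of \<open>M\<close> that counts the letters a, so K has to lie in its kernel (the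
  flag \<open>ev\<close>). For odd t the power of ab used for padding needs an odd number of letters
  a. Lamps in Z/2 would give ab even order; lamps in F_4, on which ab acts as a cube root of unity,
  make (ab)^39 trivial. The second obstacle is that the commutators must be independent inside a
  group whose order is adjusted to t. Here P permutes 13 points, ab being a 13-cycle, and carries
  labels modulo k. The labels make the order of the base group tunable up to a bounded factor. The
  permutations alone decide the independence: some \<open>y0\<close> has the property that a signed
  function supported around it sees exactly one of the 13 * 13 elements (ab)^-i y0 (ab)^j and none
  of the elements formed with the inverse of \<open>y0\<close>.\<close>

type_synonym word = "gen sword"

definition linv :: "letter \<Rightarrow> letter" where
  "linv l = (fst l, \<not> snd l)"

definition winv :: "word \<Rightarrow> word" where
  "winv w = map linv (rev w)"

lemma winv_simps [simp]:
  "winv [] = []" "winv (l # w) = winv w @ [linv l]" "winv (u @ v) = winv v @ winv u"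
  by (simp_all add: winv_def)

lemma linv_linv [simp]: "linv (linv l) = l"
  by (simp add: linv_def)

lemma linv_simps [simp]: "linv lb = lbi" "linv lbi = lb" "fst (linv l) = fst l"
  by (simp_all add: linv_def lb_def lbi_def)

lemma winv_winv [simp]: "winv (winv w) = w"
  by (induction w) auto

lemma length_winv [simp]: "length (winv w) = length w"
  by (simp add: winv_def)

lemma fst_la_lb [simp]: "fst la = Gen_a" "fst lb = Gen_b" "fst lbi = Gen_b"
  by (simp_all add: la_def lb_def lbi_def)

lemma letter_cases: "l = la \<or> l = linv la \<or> l = lb \<or> l = lbi"
  by (cases l; cases "fst l") (auto simp: la_def lb_def lbi_def linv_def)

text \<open>A normal subgroup of \<^term>\<open>M\<close> is encoded as the predicate of words representing its elements.\<close>

locale normal_words =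
  fixes K :: "word \<Rightarrow> bool"
  assumes K_Nil [simp]: "K []"
    and K_insert: "K v \<Longrightarrow> K (p @ v @ q) = K (p @ q)"
    and K_pair [simp]: "K [l, linv l]"
    and K_aa: "K [la, la]"
    and K_bbb: "K [lb, lb, lb]"
begin

lemma K_insert_left: "K v \<Longrightarrow> K (v @ q) = K q"
  using K_insert[of v "[]" q] by simp

lemma K_insert_right: "K v \<Longrightarrow> K (p @ v) = K p"
  using K_insert[of v p "[]"] by simp

lemma K_winv_right [simp]: "K (u @ winv u)"
proof (induction u)
  case (Cons l u)
  have "K ([l] @ (u @ winv u) @ [linv l]) = K ([l] @ [linv l])"
    by (rule K_insert) (rule Cons)
  then show ?case by simp
qed simp

lemma K_winv_left [simp]: "K (winv u @ u)"
  using K_winv_right[of "winv u"] by simp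

lemma K_cancel [simp]: "K (p @ u @ winv u @ q) = K (p @ q)" "K (p @ winv u @ u @ q) = K (p @ q)"
  using K_insert[of "u @ winv u" p q] K_insert[of "winv u @ u" p q] by auto

lemma K_append: "K u \<Longrightarrow> K v \<Longrightarrow> K (u @ v)"
  by (simp add: K_insert_left)

lemma K_winv: "K (winv u) = K u"
  using K_insert_left[of u "winv u"] K_insert_left[of "winv u" u] by auto

lemma K_conj: "K (p @ u @ winv p) = K u"
proof -
  have "K (p @ u @ winv p) \<Longrightarrow> K (winv p @ (p @ u @ winv p) @ p)"
    using K_insert[of "p @ u @ winv p" "winv p" p] by simp
  moreover have "K (winv p @ (p @ u @ winv p) @ p) = K u"
    using K_cancel(2)[of "[]" p "u @ winv p @ p"] K_insert_right[of "winv p @ p" u] by simp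
  moreover have "K u \<Longrightarrow> K (p @ u @ winv p)"
    using K_insert[of u p "winv p"] by simp
  ultimately show ?thesis by blast
qed

lemma K_commute: "K (u @ v) = K (v @ u)"
  using K_conj[of "winv u" "u @ v"] K_cancel(2)[of "[]" u "v @ u"] by simp

definition cong :: "word \<Rightarrow> word \<Rightarrow> bool" where
  "cong u v \<longleftrightarrow> K (u @ winv v)"

lemma cong_refl [simp]: "cong u u"
  by (simp add: cong_def)

lemma cong_sym: "cong u v \<Longrightarrow> cong v u"
  unfolding cong_def using K_winv[of "u @ winv v"] by simp

lemma cong_trans [trans]: "cong u v \<Longrightarrow> cong v w \<Longrightarrow> cong u w"
  unfolding cong_def using K_append[of "u @ winv v" "v @ winv w"] by simp

lemma cong_K: "cong u v \<Longrightarrow> K (p @ u @ q) = K (p @ v @ q)"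
proof -
  assume "cong u v"
  then have "K (p @ (u @ winv v) @ v @ q) = K (p @ v @ q)"
    unfolding cong_def by (rule K_insert)
  then show ?thesis using K_cancel(2)[of "p @ u" v q] by simp
qed

lemma cong_K': "cong u v \<Longrightarrow> K u = K v"
  using cong_K[of u v "[]" "[]"] by simp

lemma cong_ctxt: "cong u v \<Longrightarrow> cong (p @ u @ q) (p @ v @ q)"
  unfolding cong_def[of "p @ _"] using cong_K[of u v p "q @ winv (p @ v @ q)"]
  K_winv_right[of "p @ v @ q"] by simp

lemma cong_append: "cong u u' \<Longrightarrow> cong v v' \<Longrightarrow> cong (u @ v) (u' @ v')"
  using cong_ctxt[of u u' "[]" v] cong_ctxt[of v v' u' "[]"] cong_trans by simp

lemma cong_Nil: "cong u [] = K u"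
  by (simp add: cong_def)

lemma cong_winv: "cong u v \<Longrightarrow> cong (winv u) (winv v)"
  unfolding cong_def using K_commute[of "winv u" v] K_winv[of "u @ winv v"] by simp

lemma cong_del: "K v \<Longrightarrow> cong (p @ v @ q) (p @ q)"
  using cong_ctxt[of v "[]" p q] by (simp add: cong_Nil)

lemma cong_cancel: "cong (p @ u @ winv u @ q) (p @ q)" "cong (p @ winv u @ u @ q) (p @ q)"
  using cong_del[of "u @ winv u" p q] cong_del[of "winv u @ u" p q] by auto

lemma cong_iff_left: "cong u v \<longleftrightarrow> K (winv u @ v)"
  unfolding cong_def using K_commute[of u "winv v"] K_winv[of "winv u @ v"] by simp

lemma cong_cancel_left: "cong (p @ u) (p @ v) = cong u v"
proof -
  have "K ((winv u @ winv p) @ p @ v) = K (winv u @ v)"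
    using K_cancel(2)[of "winv u" p v] by simp
  then show ?thesis by (simp add: cong_iff_left)
qed

lemma cong_cancel_right: "cong (u @ p) (v @ p) = cong u v"
  unfolding cong_def using K_cancel(1)[of u p "winv v"] by simp

lemma cong_la: "cong [linv la] [la]"
  using K_aa K_winv[of "[la,la]"] by (simp add: cong_def)

lemma cong_lbb: "cong [lb, lb] [lbi]" "cong [lbi, lbi] [lb]"
proof -
  show "cong [lb, lb] [lbi]" using K_bbb by (simp add: cong_def)
  have "K [lbi, lbi, lbi]" using K_bbb K_winv[of "[lb,lb,lb]"] by simp
  then show "cong [lbi, lbi] [lb]" by (simp add: cong_def)
qed

lemma free_eq_K: "(u, v) \<in> free_eq \<Longrightarrow> K u = K v"
proof -
  have step: "K u = K v" if "cancels u v" for u v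
    using that
  proof cases
    case (1 p x s q)
    have "[(x, s), (x, \<not> s)] = [(x, s), linv (x, s)]" by (simp add: linv_def)
    then have "K [(x, s), (x, \<not> s)]" by (metis K_pair)
    from K_insert[OF this] 1 show ?thesis by simp
  qed
  have "equivclp cancels u v \<Longrightarrow> K u = K v"
    by (induction rule: equivclp_induct) (auto dest: step)
  then show "(u, v) \<in> free_eq \<Longrightarrow> ?thesis" by (simp add: free_eq_def)
qed

end

section \<open>Word predicates as normal subgroups of the free group and of \<open>M\<close>\<close>

lemma free_inverse': "free_class (w @ winv w) = free_class []"
proof -
  have "winv u = map (\<lambda>(x, s). (x, \<not> s)) (rev u)" for u
    by (simp add: winv_def linv_def case_prod_unfold)
  with free_inverse[of "winv w"] show ?thesis
    by (metis winv_winv)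
qed

lemma inv_free_class: "inv\<^bsub>free_group\<^esub> (free_class w) = free_class (winv w)"
proof -
  interpret group free_group by (rule group_free_group)
  show ?thesis
    by (rule inv_equality)
      (use free_inverse'[of "winv w"] in \<open>auto simp: free_one carrier_free_group\<close>)
qed

context normal_words
begin

text \<open>Abstract in the map \<open>h\<close> because it is applied twice, to the free group and
  to \<open>M\<close>.\<close>

lemma normal_image:
  assumes G: "group G" "carrier G = range h"
    and h: "\<And>u v. h u \<otimes>\<^bsub>G\<^esub> h v = h (u @ v)" "\<And>w. inv\<^bsub>G\<^esub> (h w) = h (winv w)"
  shows "{h w |w. K w} \<lhd> G" (is "?N \<lhd> _")
proof -
  interpret group G by fact
  have "subgroup ?N G"
  proof (rule subgroupI)
    show "?N \<subseteq> carrier G" using G(2) by auto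
    show "?N \<noteq> {}" using K_Nil by blast
    show "inv\<^bsub>G\<^esub> x \<in> ?N" if "x \<in> ?N" for x using that K_winv by (auto simp: h)
    show "x \<otimes>\<^bsub>G\<^esub> y \<in> ?N" if xy: "x \<in> ?N" "y \<in> ?N" for x y
    proof -
      obtain u v where "x = h u" "K u" "y = h v" "K v" using xy by blast
      then show ?thesis using K_append[of u v] by (auto simp: h)
    qed
  qed
  moreover have "x \<otimes>\<^bsub>G\<^esub> y \<otimes>\<^bsub>G\<^esub> inv\<^bsub>G\<^esub> x \<in> ?N" if x: "x \<in> carrier G" and y: "y \<in> ?N" for x y
  proof -
    obtain p u where "x = h p" "y = h u" "K u" using x y G(2) by auto
    then show ?thesis using K_conj[of p u] by (auto simp: h)
  qed
  ultimately show ?thesis by (simp add: normal_inv_iff)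
qed

lemma normal_free: "{free_class w |w. K w} \<lhd> free_group"
  by (rule normal_image[OF group_free_group carrier_free_group free_mult inv_free_class])

end

lemma normal_closure_subset: "N \<lhd> G \<Longrightarrow> S \<subseteq> N \<Longrightarrow> normal_closure G S \<subseteq> N"
  by (auto simp: normal_closure_def)

lemma subset_normal_closure: "S \<subseteq> normal_closure G S"
  by (auto simp: normal_closure_def)

abbreviation rel_closure :: "gen sword set set" where
  "rel_closure \<equiv> normal_closure free_group (free_class ` modular_rels)"

lemma normal_rel_closure: "rel_closure \<lhd> free_group"
  by (intro normal_normal_closure group_free_group) (auto simp: carrier_free_group)

lemma M_one: "\<one>\<^bsub>M\<^esub> = M_elem []"
proof -
  interpret F: group free_group by (rule group_free_group)
  interpret N: normal rel_closure free_group by (rule normal_rel_closure)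
  show ?thesis
    using F.coset_mult_one[OF N.subset]
    by (simp add: M_def M_elem_def presented_group_def presented_elem_def FactGroup_def flip: free_one)
qed

lemma M_elem_eq_iff: "M_elem u = M_elem v \<longleftrightarrow> free_class (u @ winv v) \<in> rel_closure"
proof -
  interpret F: group free_group by (rule group_free_group)
  interpret N: normal rel_closure free_group by (rule normal_rel_closure)
  have c: "free_class w \<in> carrier free_group" for w by (auto simp: carrier_free_group)
  have "M_elem u = M_elem v \<longleftrightarrow> free_class u \<in> rel_closure #>\<^bsub>free_group\<^esub> free_class v"
    unfolding M_elem_def presented_elem_def
    by (metis F.repr_independence F.rcos_self N.subgroup_axioms c)
  also have "\<dots> \<longleftrightarrow> free_class u \<otimes>\<^bsub>free_group\<^esub> inv\<^bsub>free_group\<^esub> free_class v \<in> rel_closure"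
    using N.rcos_module[OF F.is_group c c] by blast
  finally show ?thesis by (simp add: inv_free_class)
qed

lemma carrier_M: "carrier M = range M_elem"
  by (auto simp: M_elem_def M_def presented_elem_def presented_group_def FactGroup_def
      RCOSETS_def carrier_free_group)

lemma M_elem_relators: "M_elem [la, la] = M_elem []" "M_elem [lb, lb, lb] = M_elem []"
  using subset_normal_closure[of "free_class ` modular_rels" free_group]
  by (auto simp: M_elem_eq_iff modular_rels_def)

lemma M_elem_cancel: "M_elem (w @ winv w) = M_elem []"
proof -
  interpret N: normal rel_closure free_group by (rule normal_rel_closure)
  show ?thesis
    using N.one_closed unfolding M_elem_eq_iff by (simp add: free_inverse' flip: free_one)
qed

lemma inv_M_elem: "inv\<^bsub>M\<^esub> (M_elem w) = M_elem (winv w)"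
proof -
  interpret group M by (rule group_M)
  show ?thesis
    by (rule inv_equality)
      (use M_elem_cancel[of "winv w"] in \<open>auto simp: M_one M_elem_append M_elem_in_carrier\<close>)
qed

lemma normal_words_of_normal:
  assumes "N \<lhd> M"
  shows "normal_words (\<lambda>w. M_elem w \<in> N)"
proof
  interpret group M by (rule group_M)
  interpret N: normal N M by fact
  show "M_elem [] \<in> N" using N.one_closed by (simp add: M_one)
  show "M_elem [l, linv l] \<in> N" for l
    using M_elem_cancel[of "[l]"] \<open>M_elem [] \<in> N\<close> by simp
  show "M_elem [la, la] \<in> N" "M_elem [lb, lb, lb] \<in> N"
    using \<open>M_elem [] \<in> N\<close> by (simp_all add: M_elem_relators)
  fix p v q assume v: "M_elem v \<in> N"
  let ?p = "M_elem p" and ?v = "M_elem v" and ?q = "M_elem q"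
  have c: "?p \<in> carrier M" "?v \<in> carrier M" "?q \<in> carrier M" by (simp_all add: M_elem_in_carrier)
  have "?p \<otimes>\<^bsub>M\<^esub> ?v \<otimes>\<^bsub>M\<^esub> inv\<^bsub>M\<^esub> ?p \<in> N" using N.inv_op_closed2[OF c(1) v] .
  moreover have "?p \<otimes>\<^bsub>M\<^esub> ?v \<otimes>\<^bsub>M\<^esub> ?q = (?p \<otimes>\<^bsub>M\<^esub> ?v \<otimes>\<^bsub>M\<^esub> inv\<^bsub>M\<^esub> ?p) \<otimes>\<^bsub>M\<^esub> (?p \<otimes>\<^bsub>M\<^esub> ?q)"
    using c by (simp add: m_assoc flip: m_assoc[of "inv\<^bsub>M\<^esub> ?p" ?p ?q])
  ultimately have "?p \<otimes>\<^bsub>M\<^esub> ?v \<otimes>\<^bsub>M\<^esub> ?q \<in> N \<longleftrightarrow> ?p \<otimes>\<^bsub>M\<^esub> ?q \<in> N"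
    by (metis N.m_closed N.m_inv_closed N.mem_carrier c(1) c(3) inv_solve_left m_closed)
  then show "M_elem (p @ v @ q) \<in> N = (M_elem (p @ q) \<in> N)"
    using c by (simp add: M_elem_append m_assoc)
qed

context normal_words
begin

text \<open>By \<open>K_aa\<close> and \<open>K_bbb\<close> the normal subgroup of the free group
  given by \<open>K\<close> contains the relators of \<open>M\<close>, hence also
  \<open>rel_closure\<close>, so \<open>K\<close> descends to \<open>M\<close>.\<close>

lemma M_elem_K: "M_elem u = M_elem v \<Longrightarrow> K u = K v"
proof -
  assume "M_elem u = M_elem v"
  then have "free_class (u @ winv v) \<in> rel_closure" by (simp add: M_elem_eq_iff)
  moreover have "rel_closure \<subseteq> {free_class w |w. K w}"
    by (rule normal_closure_subset[OF normal_free]) (auto simp: modular_rels_def K_aa K_bbb)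
  ultimately obtain w where "free_class (u @ winv v) = free_class w" "K w" by blast
  then have "K (u @ winv v)" using free_eq_K by (simp add: free_class_eq_iff)
  then show ?thesis using cong_K' by (simp add: cong_def)
qed

lemma normal_of_normal_words: "{M_elem w |w. K w} \<lhd> M"
  by (rule normal_image[OF group_M carrier_M M_elem_append inv_M_elem])

end

text \<open>This is the least word predicate containing the relators, see
  \<open>trivial_in_least\<close>. In particular \<open>trivial_in []\<close> is the word problem of
  \<open>M\<close> itself.\<close>

definition trivial_in :: "word list \<Rightarrow> word \<Rightarrow> bool" where
  "trivial_in rs w \<longleftrightarrow> M_elem w \<in> normal_closure M (M_elem ` set rs)"

lemma normal_closure_M: "normal_closure M (M_elem ` set rs) \<lhd> M"
  by (intro normal_normal_closure group_M) (auto simp: M_elem_in_carrier)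

lemma normal_words_trivial_in: "normal_words (trivial_in rs)"
  unfolding trivial_in_def by (rule normal_words_of_normal[OF normal_closure_M])

lemma trivial_in_relator: "r \<in> set rs \<Longrightarrow> trivial_in rs r"
  unfolding trivial_in_def using subset_normal_closure[of "M_elem ` set rs" M] by blast

lemma trivial_in_least:
  assumes "normal_words K" "\<And>r. r \<in> set rs \<Longrightarrow> K r" "trivial_in rs w"
  shows "K w"
proof -
  interpret normal_words K by fact
  have "normal_closure M (M_elem ` set rs) \<subseteq> {M_elem w |w. K w}"
    by (rule normal_closure_subset[OF normal_of_normal_words]) (use assms(2) in auto)
  with assms(3) obtain u where "M_elem w = M_elem u" "K u" by (auto simp: trivial_in_def)
  then show ?thesis using M_elem_K by blast
qed

definition quot_elem :: "word list \<Rightarrow> word \<Rightarrow> gen sword set set set" where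
  "quot_elem rs w = normal_closure M (M_elem ` set rs) #>\<^bsub>M\<^esub> M_elem w"

lemma carrier_M_quotient: "carrier (M_quotient rs) = range (quot_elem rs)"
  by (auto simp: quot_elem_def M_quotient_def FactGroup_def RCOSETS_def carrier_M)

lemma quot_elem_append: "quot_elem rs (u @ v) = quot_elem rs u \<otimes>\<^bsub>M_quotient rs\<^esub> quot_elem rs v"
  using normal.rcos_sum[OF normal_closure_M, of "M_elem u" "M_elem v" rs]
  by (simp add: quot_elem_def M_quotient_def M_elem_in_carrier FactGroup_def M_elem_append)

lemma quot_elem_eq_one: "quot_elem rs w = \<one>\<^bsub>M_quotient rs\<^esub> \<longleftrightarrow> trivial_in rs w"
proof -
  interpret group M by (rule group_M)
  interpret N: normal "normal_closure M (M_elem ` set rs)" M by (rule normal_closure_M)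
  show ?thesis
    unfolding quot_elem_def trivial_in_def M_quotient_def FactGroup_def
    using coset_join1[OF _ M_elem_in_carrier N.subgroup_axioms]
      coset_join2[OF M_elem_in_carrier N.subgroup_axioms] by auto
qed

section \<open>Padding relators to a prescribed length\<close>

definition bl :: "bool \<Rightarrow> letter" where
  "bl e = (if e then lb else lbi)"

lemma fst_bl [simp]: "fst (bl e) = Gen_b"
  by (simp add: bl_def)

lemma ex_bl [simp]: "\<exists>e'. bl e = bl e'"
  by blast

lemma linv_bl [simp]: "linv (bl e) = bl (\<not> e)"
  by (simp add: bl_def)

lemma letter_cases_bl: "l = la \<or> l = linv la \<or> (\<exists>e. l = bl e)"
  unfolding bl_def using letter_cases[of l] by (metis (full_types))

definition alt :: "bool list \<Rightarrow> word" where
  "alt es = concat (map (\<lambda>e. [la, bl e]) es)"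

lemma alt_simps [simp]:
  "alt [] = []" "alt (e # es) = la # bl e # alt es" "alt (es @ fs) = alt es @ alt fs"
  by (simp_all add: alt_def)

lemma length_alt [simp]: "length (alt es) = 2 * length es"
  by (induction es) auto

lemma fst_alt_nth: "i < 2 * length es \<Longrightarrow> fst (alt es ! i) = (if even i then Gen_a else Gen_b)"
proof (induction es arbitrary: i)
  case (Cons e es)
  consider "i = 0" | "i = 1" | j where "i = Suc (Suc j)"
    by (metis One_nat_def not0_implies_Suc)
  then show ?case using Cons by cases auto
qed simp

lemma reducedI:
  assumes "\<And>i. Suc i < length w \<Longrightarrow> fst (w ! i) \<noteq> fst (w ! Suc i)"
  shows "reduced w"
  unfolding reduced_def
proof (rule ballI, rule notI)
  fix f assume f: "f \<in> {[la, la], [lb, lb], [lbi, lbi], [lb, lbi], [lbi, lb]}" and "sublist f w"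
  from this(2) obtain p q where w: "w = p @ f @ q" by (auto simp: sublist_def)
  from f have "\<exists>x y. f = [x, y] \<and> fst x = fst y" by (auto simp: la_def lb_def lbi_def)
  then obtain x y where xy: "f = [x, y]" "fst x = fst y" by blast
  show False
    using assms[of "length p"] w xy by (auto simp: nth_append)
qed

lemma cyclically_reduced_alt: "cyclically_reduced (alt es)"
proof -
  have "reduced (rotate n (alt es))" for n
  proof (rule reducedI)
    fix i assume i: "Suc i < length (rotate n (alt es))"
    let ?m = "2 * length es"
    have "?m > 0" using i by (cases es) auto
    then have m: "(n + j) mod ?m < ?m" "even ((n + j) mod ?m) = even (n + j)" for j
      by (simp_all only: mod_less_divisor dvd_mod_iff dvd_triv_left)
    then show "fst (rotate n (alt es) ! i) \<noteq> fst (rotate n (alt es) ! Suc i)"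
      using i m[of i] m[of "Suc i"] by (simp add: nth_rotate fst_alt_nth)
  qed
  from this[of 0] this show ?thesis by (simp add: cyclically_reduced_def)
qed

lemma alt_in_lists: "alt es \<in> lists A"
  by (induction es) (auto simp: A_def bl_def)

section \<open>Normal forms and cyclic normal forms in Z/2 * Z/3\<close>

context normal_words
begin

lemma cong_bl: "cong [bl e, bl e] [bl (\<not> e)]"
  using cong_lbb by (auto simp: bl_def)

lemma cong_bl_cancel: "cong [bl e, bl (\<not> e)] []"
  using K_pair[of "bl e"] by (simp add: cong_Nil)

text \<open>One letter at a time is multiplied from the left onto a normal form. The bound on the
  length is carried along because the room left for padding is computed from it.\<close>

lemma normal_form:
  "\<exists>x es y. cong v (x @ alt es @ y) \<and> (x = [] \<or> (\<exists>e. x = [bl e])) \<and> (y = [] \<or> y = [la]) \<and>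
     length (x @ alt es @ y) \<le> length v"
proof (induction v)
  case Nil
  show ?case by (rule exI[of _ "[]"], rule exI[of _ "[]"], rule exI[of _ "[]"]) simp
next
  case (Cons l v)
  then obtain x es y where v: "cong v (x @ alt es @ y)" and x: "x = [] \<or> (\<exists>e. x = [bl e])"
    and y: "y = [] \<or> y = [la]" and len: "length (x @ alt es @ y) \<le> length v" by blast
  have lv: "cong (l # v) (l' # x @ alt es @ y)" if "cong [l] [l']" for l'
    using cong_append[OF that v] by simp
  have result: ?case
    if "cong (l # v) (x' @ alt es' @ y')" "x' = [] \<or> (\<exists>e. x' = [bl e])" "y' = [] \<or> y' = [la]"
      "length (x' @ alt es' @ y') \<le> Suc (length v)" for x' es' y'
    using that by (intro exI[of _ x'] exI[of _ es'] exI[of _ y']) simp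
  consider "l = la \<or> l = linv la" | e where "l = bl e"
    using letter_cases_bl[of l] by blast
  then show ?case
  proof cases
    case 1
    then have "cong [l] [la]" using cong_la by auto
    then have lv': "cong (l # v) (la # x @ alt es @ y)" by (rule lv)
    consider e where "x = [bl e]" | e es' where "x = []" "es = e # es'" | "x = []" "es = []"
      using x by (cases es) auto
    then show ?thesis
    proof cases
      case (1 e)
      then show ?thesis using result[of "[]" "e # es" y] lv' y len by simp
    next
      case (2 e es')
      have "cong (la # la # bl e # alt es' @ y) (bl e # alt es' @ y)"
        using cong_del[OF K_aa, of "[]" "bl e # alt es' @ y"] by simp
      then have "cong (l # v) ([bl e] @ alt es' @ y)" using cong_trans[OF lv'] 2 by simp
      then show ?thesis using result[of "[bl e]" es' y] y len 2 by simp
    next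
      case 3
      from y show ?thesis
      proof
        assume "y = []"
        then show ?thesis using result[of "[]" "[]" "[la]"] lv' 3 by simp
      next
        assume y': "y = [la]"
        have "cong [la, la] []" using K_aa by (simp add: cong_Nil)
        then have "cong (l # v) []" using cong_trans[OF lv'] 3 y' by simp
        then show ?thesis using result[of "[]" "[]" "[]"] by simp
      qed
    qed
  next
    case (2 e)
    have lv': "cong (l # v) (bl e # x @ alt es @ y)" by (rule lv) (simp add: 2)
    have "x = [] \<or> x = [bl e] \<or> x = [bl (\<not> e)]" using x
    proof
      assume "\<exists>e'. x = [bl e']"
      then obtain e' where "x = [bl e']" by blast
      then show ?thesis by (cases "e' = e") auto
    qed simp
    then consider "x = []" | "x = [bl e]" | "x = [bl (\<not> e)]" by blast
    then show ?thesis
    proof cases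
      case 1
      then show ?thesis using result[of "[bl e]" es y] lv' y len by simp
    next
      case 2
      then have "cong (l # v) ([bl (\<not> e)] @ alt es @ y)"
        using cong_trans[OF lv'] cong_ctxt[OF cong_bl, of "[]" e "alt es @ y"] by simp
      then show ?thesis using result[of "[bl (\<not> e)]" es y] y len 2 by auto
    next
      case 3
      then have "cong (l # v) ([] @ alt es @ y)"
        using cong_trans[OF lv'] cong_ctxt[OF cong_bl_cancel, of "[]" e "alt es @ y"] by simp
      then show ?thesis using result[of "[]" es y] y len 3 by simp
    qed
  qed
qed

definition conj_to :: "word \<Rightarrow> word \<Rightarrow> bool" where
  "conj_to v u \<longleftrightarrow> (\<exists>p. cong (p @ v @ winv p) u)"

lemma conj_to_refl: "conj_to v v"
  unfolding conj_to_def by (rule exI[of _ "[]"]) simp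

lemma conj_to_cong: "conj_to v u \<Longrightarrow> cong u u' \<Longrightarrow> conj_to v u'"
  unfolding conj_to_def using cong_trans by blast

lemma cong_conj_to: "cong v v' \<Longrightarrow> conj_to v' u \<Longrightarrow> conj_to v u"
  unfolding conj_to_def using cong_trans cong_ctxt by blast

lemma conj_to_trans: "conj_to v u \<Longrightarrow> conj_to u w \<Longrightarrow> conj_to v w"
proof -
  assume "conj_to v u" "conj_to u w"
  then obtain p q where p: "cong (p @ v @ winv p) u" and q: "cong (q @ u @ winv q) w"
    by (auto simp: conj_to_def)
  have "cong ((q @ p) @ v @ winv (q @ p)) w"
    using cong_trans[OF cong_ctxt[OF p, of q "winv q"] q] by simp
  then show ?thesis unfolding conj_to_def by blast
qed

lemma conj_to_rotate: "conj_to (u @ v) (v @ u)"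
  unfolding conj_to_def
  by (rule exI[of _ "winv u"]) (use cong_cancel(2)[of "[]" u "v @ u"] in simp)

text \<open>If both end letters are present, a rotation makes the word alternating. If only one is
  present, a rotation brings it next to a letter of the same kind; the two merge or cancel, and
  after a cancellation the alternating part is shorter.\<close>

lemma cyclic_normal_form_aux:
  assumes "x = [] \<or> (\<exists>e. x = [bl e])" "y = [] \<or> y = [la]"
  shows "\<exists>u. conj_to (x @ alt es @ y) u \<and> length u \<le> length (x @ alt es @ y) \<and>
     (u = [] \<or> u = [la] \<or> (\<exists>e. u = [bl e]) \<or> (\<exists>es'. es' \<noteq> [] \<and> u = alt es'))"
  using assms
proof (induction "length es" arbitrary: es x y rule: less_induct)
  case less
  have result: ?case
    if "conj_to (x @ alt es @ y) (x' @ alt es' @ y')" "x' = [] \<or> (\<exists>e. x' = [bl e])"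
      "y' = [] \<or> y' = [la]" "length es' < length es"
      "length (x' @ alt es' @ y') \<le> length (x @ alt es @ y)" for x' y' es'
    using less.hyps[OF that(4,2,3)] conj_to_trans[OF that(1)] that(5) order_trans by blast
  have direct: ?case
    if "conj_to (x @ alt es @ y) u" "length u \<le> length (x @ alt es @ y)"
      "u = [] \<or> u = [la] \<or> (\<exists>e. u = [bl e]) \<or> (\<exists>es'. es' \<noteq> [] \<and> u = alt es')" for u
    using that by blast
  have direct_alt: ?case
    if "conj_to (x @ alt es @ y) (alt es')" "length (alt es') \<le> length (x @ alt es @ y)" "es' \<noteq> []" for es'
    using direct[OF that(1,2)] that(3) by blast
  consider "x = []" "y = []" | e where "x = [bl e]" "y = [la]" | e where "x = [bl e]" "y = []"
    | "x = []" "y = [la]" using less.prems by blast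
  then show ?case
  proof cases
    case 1
    show ?thesis
    proof (cases "es = []")
      case True
      then show ?thesis using direct[of "[]"] conj_to_refl 1 by simp
    next
      case False
      then show ?thesis using direct_alt[of es] conj_to_refl 1 by simp
    qed
  next
    case (2 e)
    then show ?thesis using direct_alt[of "es @ [e]"] conj_to_rotate[of x "alt es @ y"] by simp
  next
    case (3 e)
    show ?thesis
    proof (cases es rule: rev_cases)
      case Nil
      then show ?thesis using direct[of "[bl e]"] conj_to_refl 3 by simp
    next
      case (snoc es' d)
      have c: "conj_to (x @ alt es @ y) (alt es' @ [la, bl d, bl e])"
        using conj_to_rotate[of x "alt es"] 3 snoc by simp
      consider "d = e" | "d = (\<not> e)" by blast
      then show ?thesis
      proof cases
        case 1
        have "conj_to (x @ alt es @ y) (alt (es' @ [\<not> e]))"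
          using conj_to_cong[OF c] cong_ctxt[OF cong_bl, of "alt es' @ [la]" e "[]"] 1 by simp
        then show ?thesis using direct_alt[of "es' @ [\<not> e]"] snoc by simp
      next
        case 2
        have "cong (alt es' @ [la, bl d, bl e]) ([] @ alt es' @ [la])"
          using cong_ctxt[OF cong_bl_cancel, of "alt es' @ [la]" d "[]"] 2 by simp
        then show ?thesis using result[of "[]" es' "[la]"] conj_to_cong[OF c] snoc by simp
      qed
    qed
  next
    case 4
    show ?thesis
    proof (cases es)
      case Nil
      then show ?thesis using direct[of "[la]"] conj_to_refl 4 by simp
    next
      case (Cons d es')
      have "conj_to (x @ alt es @ y) (la # la # bl d # alt es')"
        using conj_to_rotate[of "alt es" "[la]"] 4 Cons by simp
      moreover have "cong (la # la # bl d # alt es') ([bl d] @ alt es' @ [])"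
        using cong_del[OF K_aa, of "[]" "bl d # alt es'"] by simp
      ultimately have "conj_to (x @ alt es @ y) ([bl d] @ alt es' @ [])" by (rule conj_to_cong)
      then show ?thesis using result[of "[bl d]" es' "[]"] Cons by simp
    qed
  qed
qed

lemma cyclic_normal_form:
  "\<exists>u. conj_to v u \<and> length u \<le> length v \<and>
     (u = [] \<or> u = [la] \<or> (\<exists>e. u = [bl e]) \<or> (\<exists>es. es \<noteq> [] \<and> u = alt es))"
proof -
  obtain x es y where v: "cong v (x @ alt es @ y)" "x = [] \<or> (\<exists>e. x = [bl e])" "y = [] \<or> y = [la]"
    "length (x @ alt es @ y) \<le> length v" using normal_form by blast
  from cyclic_normal_form_aux[OF v(2,3), of es] show ?thesis
    using cong_conj_to[OF v(1)] v(4) order_trans by blast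
qed

end

section \<open>Insertion of conjugates of powers of ab\<close>

definition apow :: "bool \<Rightarrow> nat \<Rightarrow> word" where
  "apow e k = alt (replicate k e)"

abbreviation xpow :: "nat \<Rightarrow> word" where
  "xpow \<equiv> apow True"

lemma apow_add: "apow e (i + j) = apow e i @ apow e j"
  by (simp add: apow_def replicate_add)

lemma apow_simps: "apow e 0 = []" "apow e (Suc k) = la # bl e # apow e k"
  by (simp_all add: apow_def)

lemma bl_simps [simp]: "bl True = lb" "bl False = lbi"
  by (simp_all add: bl_def)

lemma length_apow [simp]: "length (apow e k) = 2 * k"
  by (simp add: apow_def)

text \<open>Modulo \<open>(ab)\<^sup>k = 1\<close> the word \<open>alt (pad es d k e)\<close> equals \<open>alt (es @ [d])\<close>: it is obtained by inserting
  a conjugate of \<open>(ab)\<^sup>k\<close> by a word of adjustable length, after splitting the last letter \<open>b\<^sup>d\<close> as \<open>b\<^sup>-\<^sup>d b\<^sup>-\<^sup>d\<close>.\<close>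

definition pad :: "bool list \<Rightarrow> bool \<Rightarrow> nat \<Rightarrow> nat \<Rightarrow> bool list" where
  "pad es d k e = es @ [\<not> d] @ replicate e True @ [False] @ replicate (k - 1) True @ [False] @
     replicate e False @ [\<not> d]"

lemma length_pad: "k \<ge> 1 \<Longrightarrow> length (pad es d k e) = Suc (length es) + k + 2 * e + 2"
  by (simp add: pad_def)

definition pad_conj :: "nat \<Rightarrow> word" where
  "pad_conj e = xpow e @ [la]"

context normal_words
begin

text \<open>With a in place of its inverse, the inverse of the conjugator alternates again, so it
  can be written into \<open>pad\<close> without any cancellation.\<close>

lemma cong_pad_conj_inv: "cong (winv (pad_conj e)) (alt (replicate e False) @ [la])"
proof -
  have "cong ([la] @ winv (xpow e)) (alt (replicate e False) @ [la])"
  proof (induction e)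
    case (Suc e)
    have "cong ([la] @ winv (xpow (Suc e))) ([la] @ winv (xpow e) @ [lbi, la])"
      using cong_ctxt[OF cong_la, of "[la] @ winv (xpow e) @ [lbi]" "[]"]
      apow_add[of True 1 e] by (simp add: apow_simps)
    also have "cong \<dots> ((alt (replicate e False) @ [la]) @ [lbi, la])"
      using cong_ctxt[OF Suc, of "[]" "[lbi, la]"] by simp
    also have "(alt (replicate e False) @ [la]) @ [lbi, la] = alt (replicate (Suc e) False) @ [la]"
      unfolding replicate_Suc replicate_append_same[symmetric] by (simp add: bl_def)
    finally show ?case .
  qed (simp add: apow_simps)
  moreover have "cong (winv (pad_conj e)) ([la] @ winv (xpow e))"
    unfolding pad_conj_def using cong_append[OF cong_la, of "winv (xpow e)" "winv (xpow e)"] by simp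
  ultimately show ?thesis using cong_trans by blast
qed

lemma cong_pad:
  assumes "k \<ge> 1"
  shows "cong (alt (pad es d k e))
    (alt es @ [la, bl (\<not> d)] @ pad_conj e @ [lbi] @ xpow k @ [lb] @ winv (pad_conj e) @ [bl (\<not> d)])"
proof -
  obtain j where k: "k = Suc j" using assms by (cases k) auto
  let ?p = "alt es @ [la, bl (\<not> d)] @ pad_conj e @ [lbi]"
  have x: "xpow k = xpow j @ [la, lb]"
    using apow_add[of True j 1] k by (simp add: apow_simps)
  have "cong (?p @ xpow k @ [lb] @ winv (pad_conj e) @ [bl (\<not> d)])
     (?p @ xpow j @ [la, lbi] @ winv (pad_conj e) @ [bl (\<not> d)])"
    using cong_ctxt[OF cong_lbb(1), of "?p @ xpow j @ [la]" "winv (pad_conj e) @ [bl (\<not> d)]"]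
    by (simp add: x)
  also have "cong \<dots> (?p @ xpow j @ [la, lbi] @ (alt (replicate e False) @ [la]) @ [bl (\<not> d)])"
    using cong_ctxt[OF cong_pad_conj_inv, of "?p @ xpow j @ [la, lbi]" e "[bl (\<not> d)]"] by simp
  also have "\<dots> = alt (pad es d k e)"
    by (simp add: pad_def pad_conj_def apow_def k bl_def)
  finally show ?thesis by (simp add: cong_sym)
qed

lemma cong_pad_trivial:
  assumes "k \<ge> 1" "K (xpow k)"
  shows "cong (alt (pad es d k e)) (alt (es @ [d]))"
proof -
  let ?p = "alt es @ [la, bl (\<not> d)] @ pad_conj e" and ?q = "winv (pad_conj e) @ [bl (\<not> d)]"
  note cong_pad[OF assms(1), of es d e]
  also have "cong (alt es @ [la, bl (\<not> d)] @ pad_conj e @ [lbi] @ xpow k @ [lb] @ ?q) (?p @ [lbi, lb] @ ?q)"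
    using cong_del[OF assms(2), of "?p @ [lbi]" "[lb] @ ?q"] by simp
  also have "cong \<dots> (?p @ ?q)"
    using cong_del[OF K_pair[of lbi], of ?p ?q] by simp
  also have "cong \<dots> (alt es @ [la, bl (\<not> d), bl (\<not> d)])"
    using cong_cancel(1)[of "alt es @ [la, bl (\<not> d)]" "pad_conj e" "[bl (\<not> d)]"] by simp
  also have "cong \<dots> (alt (es @ [d]))"
    using cong_ctxt[OF cong_bl[of "\<not> d"], of "alt es @ [la]" "[]"] by simp
  finally show ?thesis .
qed

text \<open>Here (ab)^k is not assumed to be trivial. A padded power of ab is a product of two
  conjugates of powers of ab, which is the form in which relators can force a power to be
  trivial.\<close>

lemma cong_pad_xpow:
  fixes e :: nat
  assumes "k \<ge> 1"
  defines "Q \<equiv> [lb] @ pad_conj e @ [lbi]"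
  shows "cong (alt (pad (replicate j True) True k e)) (xpow (Suc j) @ Q @ xpow k @ winv Q)"
proof -
  let ?r = "pad_conj e @ [lbi] @ xpow k @ [lb] @ winv (pad_conj e) @ [lbi]"
  have x: "xpow (Suc j) = xpow j @ [la, lb]"
    using apow_add[of True j 1] by (simp add: apow_simps)
  have "cong (alt (pad (replicate j True) True k e)) (xpow j @ [la, lbi] @ ?r)"
    using cong_pad[OF assms(1), of "replicate j True" True e] by (simp add: apow_def bl_def)
  also have "cong \<dots> (xpow j @ [la, lb, lb] @ ?r)"
    using cong_ctxt[OF cong_sym[OF cong_lbb(1)], of "xpow j @ [la]" ?r] by simp
  finally show ?thesis by (simp add: Q_def x)
qed

text \<open>A relator (ab)^N would have the wrong length, so it is replaced by three padded ones.
  With A = (ab)^N and a conjugate B of A, the first two say A B^2 = 1 and A^2 B = 1; the conjugator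
  is the same because both use the same \<open>e\<close>. So B = A^-2 and A^3 = 1. The third is A^3
  times a conjugate of A^i, whence A^i = 1, and \<open>i\<close> is coprime to 3.\<close>

lemma xpow_trivial:
  assumes N: "N \<ge> 1"
    and 1: "K (alt (pad (replicate (N - 1) True) True (2 * N) e))"
    and 2: "K (alt (pad (replicate (2 * N - 1) True) True N e))"
    and 3: "K (alt (pad (replicate (3 * N - 1) True) True (i * N) e'))" "i = 1 \<or> i = 2"
  shows "K (xpow N)"
proof -
  let ?A = "xpow N"
  define Q where "Q = [lb] @ pad_conj e @ [lbi]"
  define B where "B = Q @ ?A @ winv Q"
  have pw: "xpow (2 * N) = ?A @ ?A" "xpow (3 * N) = ?A @ ?A @ ?A"
    using apow_add[of True N N] apow_add[of True N "2 * N"] by (simp_all add: mult_2 numeral_3_eq_3)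
  have "K (?A @ Q @ (?A @ ?A) @ winv Q)"
    using cong_K'[OF cong_pad_xpow[of "2 * N" "N - 1" e]] 1 N by (simp add: Q_def pw)
  moreover have "cong (?A @ B @ B) (?A @ Q @ (?A @ ?A) @ winv Q)"
    using cong_cancel(2)[of "?A @ Q @ ?A" Q "?A @ winv Q"] by (simp add: B_def)
  ultimately have ABB: "K (?A @ B @ B)" using cong_K' by blast
  have AAB: "K ((?A @ ?A) @ B)"
    using cong_K'[OF cong_pad_xpow[of N "2 * N - 1" e]] 2 N by (simp add: Q_def B_def pw)
  have B: "cong B (winv (?A @ ?A))"
    using cong_iff_left[of "winv (?A @ ?A)" B] AAB cong_sym by simp
  have "cong (?A @ B @ B) (?A @ winv (?A @ ?A) @ winv (?A @ ?A))"
    by (intro cong_append cong_refl B)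
  then have "K (?A @ winv (?A @ ?A) @ winv (?A @ ?A))" using ABB cong_K' by blast
  then have "K (winv (?A @ ?A @ ?A))"
    using K_cancel(1)[of "[]" ?A "winv (?A @ ?A @ ?A)"] by simp
  then have A3: "K (?A @ ?A @ ?A)" using K_winv by blast
  have "K (xpow (i * N))"
  proof -
    define P where "P = [lb] @ pad_conj e' @ [lbi]"
    have "K (xpow (3 * N) @ P @ xpow (i * N) @ winv P)"
      using cong_K'[OF cong_pad_xpow[of "i * N" "3 * N - 1" e']] 3 N by (auto simp: P_def)
    then show ?thesis using K_insert_left[of "xpow (3 * N)"] A3 K_conj pw by simp
  qed
  with 3(2) show ?thesis
  proof (elim disjE)
    assume "i = 2" "K (xpow (i * N))"
    then have "K (?A @ ?A)" by (simp add: pw)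
    then show ?thesis using K_insert_left[of "?A @ ?A" ?A] A3 by simp
  qed simp
qed

end

definition count_a :: "word \<Rightarrow> nat" where
  "count_a w = length (filter (\<lambda>l. fst l = Gen_a) w)"

lemma count_a_simps [simp]:
  "count_a [] = 0" "count_a (l # w) = (if fst l = Gen_a then 1 else 0) + count_a w"
  "count_a (u @ v) = count_a u + count_a v"
  by (simp_all add: count_a_def)

lemma count_a_winv [simp]: "count_a (winv w) = count_a w"
  by (induction w) auto

lemma count_a_alt [simp]: "count_a (alt es) = length es"
  by (induction es) auto

lemma normal_words_even: "normal_words (\<lambda>w. even (count_a w))"
  by unfold_locales auto

lemma list_of_set_with_length:
  assumes "finite R" "R \<noteq> {}" "card R \<le> m"
  shows "\<exists>rs. set rs = R \<and> length rs = m"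
proof -
  obtain xs where xs: "set xs = R" "distinct xs" using assms(1) finite_distinct_list by blast
  then have l: "length xs \<le> m" using assms(3) distinct_card by force
  have "xs \<noteq> []" using xs assms(2) by auto
  then show ?thesis
    using xs l by (intro exI[of _ "xs @ replicate (m - length xs) (hd xs)"]) auto
qed

lemma even_diff_half:
  assumes "(b::nat) \<le> t" "even (t - b)"
  shows "\<exists>e. b + 2 * e = t"
  using assms by (metis evenE le_add_diff_inverse)

text \<open>A word of \<open>W\<close> that is nontrivial in \<open>M\<close> is conjugate to an
  alternating word, because \<open>P\<close> excludes single letters. Padding it adds
  \<open>i * N + 2 * e + 2\<close> pairs of letters: \<open>e\<close> adjusts the length and
  \<open>i\<close> in {1, 2} the parity. For even \<open>N\<close> the choice of \<open>i\<close>
  does not change the parity, so the words of \<open>W\<close> must have an even number of letters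
  a. The 3 extra relators are those of \<open>xpow_trivial\<close>.\<close>

lemma padded_relators:
  assumes W: "finite W" "card W + 3 \<le> m" and N: "N \<ge> 1"
    and P: "normal_words P" "\<not> P [la]" "\<not> P [lb]" "\<And>v. v \<in> W \<Longrightarrow> P v"
    and len: "\<And>v. v \<in> W \<Longrightarrow> length v + 2 * N + 2 \<le> t" "5 * N + 2 \<le> t"
    and par: "odd N \<and> odd t \<or> even N \<and> even t \<and> (\<forall>v\<in>W. even (count_a v))"
  shows "\<exists>rs. length rs = m \<and> (\<forall>r\<in>set rs. r \<in> lists A \<and> cyclically_reduced r \<and> length r = 2 * t) \<and>
     (\<forall>K. normal_words K \<longrightarrow> (\<forall>r\<in>set rs. K r) = (K (xpow N) \<and> (\<forall>v\<in>W. K v)))"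
proof -
  \<comment> \<open>Conjugacy is taken in \<open>M\<close> itself, so that it holds in every
    quotient \<open>K\<close> at once.\<close>
  interpret T: normal_words "trivial_in []" by (rule normal_words_trivial_in)
  have lift: "K u = K v" if vu: "T.conj_to v u" and nK: "normal_words K" for K u v
  proof -
    interpret K: normal_words K by fact
    obtain p where "trivial_in [] ((p @ v @ winv p) @ winv u)"
      using vu unfolding T.conj_to_def T.cong_def by blast
    then have "K.cong (p @ v @ winv p) u"
      using trivial_in_least[OF nK, of "[]"] by (simp add: K.cong_def)
    then show ?thesis using K.cong_K' K.K_conj by blast
  qed
  have ex: "\<exists>i e. (i = 1 \<or> i = 2) \<and> l + i * N + 2 * e + 2 = t"
    if "l + 2 * N + 2 \<le> t" "odd N \<and> odd t \<or> even N \<and> even t \<and> even l" for l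
  proof (cases "odd N \<and> odd l")
    case True
    then have "odd t" using that by auto
    then have "\<exists>e. (l + 2 * N + 2) + 2 * e = t"
      by (intro even_diff_half) (use that(1) True in auto)
    then show ?thesis by (metis add.assoc add.commute)
  next
    case False
    then have "\<exists>e. (l + 1 * N + 2) + 2 * e = t"
      by (intro even_diff_half) (use that in auto)
    then show ?thesis by (metis add.assoc add.commute)
  qed
  have "\<exists>R. finite R \<and> card R \<le> 1 \<and> (\<forall>r\<in>R. \<exists>fs. r = alt fs \<and> length fs = t) \<and>
     (\<forall>K. normal_words K \<longrightarrow> K (xpow N) \<longrightarrow> (\<forall>r\<in>R. K r) = K v)" if v: "v \<in> W" for v
  proof -
    obtain u where u: "T.conj_to v u" "length u \<le> length v"
      "u = [] \<or> u = [la] \<or> (\<exists>e. u = [bl e]) \<or> (\<exists>es. es \<noteq> [] \<and> u = alt es)"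
      using T.cyclic_normal_form by blast
    interpret P: normal_words P by fact
    have Pu: "P u" using lift[OF u(1) P(1)] P(4)[OF v] by simp
    have "\<not> P [lbi]" using P(3) P.K_winv[of "[lb]"] by simp
    then have "\<not> P [bl e]" for e using P(3) by (simp add: bl_def)
    then consider "u = []" | es where "es \<noteq> []" "u = alt es" using u(3) Pu P(2) by metis
    then show ?thesis
    proof cases
      case 1
      have "K v" if "normal_words K" for K
        using lift[OF u(1) that] normal_words.K_Nil[OF that] 1 by simp
      then show ?thesis by (intro exI[of _ "{}"]) auto
    next
      case (2 es)
      then obtain es' d where es: "es = es' @ [d]" by (cases es rule: rev_cases) auto
      have "even (length es)" if "even (count_a v)"
        using lift[OF u(1) normal_words_even] that 2 by simp
      then obtain i e where ie: "i = 1 \<or> i = 2" "length es + i * N + 2 * e + 2 = t"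
        using ex[of "length es"] par v len(1)[OF v] u(2) 2 by fastforce
      have iN: "i * N \<ge> 1" using ie(1) N by auto
      have "K (alt (pad es' d (i * N) e)) = K v" if K: "normal_words K" and X: "K (xpow N)" for K
      proof -
        interpret K: normal_words K by fact
        have "K (xpow (i * N))" using ie(1) X K.K_append[OF X X] apow_add[of True N N]
          by (auto simp: mult_2)
        then show ?thesis
          using K.cong_K'[OF K.cong_pad_trivial[OF iN]] lift[OF u(1) K] 2 es by simp
      qed
      moreover have "length (pad es' d (i * N) e) = t"
        using ie(2) length_pad[OF iN] es by simp
      ultimately show ?thesis
        by (intro exI[of _ "{alt (pad es' d (i * N) e)}"]) auto
    qed
  qed
  then obtain R where R: "\<And>v. v \<in> W \<Longrightarrow> finite (R v) \<and> card (R v) \<le> 1 \<and>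
     (\<forall>r\<in>R v. \<exists>fs. r = alt fs \<and> length fs = t) \<and>
     (\<forall>K. normal_words K \<longrightarrow> K (xpow N) \<longrightarrow> (\<forall>r\<in>R v. K r) = K v)" by metis
  obtain e where e: "3 * N + 2 * e + 2 = t"
  proof -
    have "\<exists>e. (3 * N + 2) + 2 * e = t" by (rule even_diff_half) (use par len(2) in auto)
    then show ?thesis using that by (metis add.assoc add.commute)
  qed
  obtain i e' where ie: "i = 1 \<or> i = 2" "3 * N + i * N + 2 * e' + 2 = t"
    using ex[of "3 * N"] par len(2) by fastforce
  have iN: "i * N \<ge> 1" using ie(1) N by auto
  define Xs where "Xs = {pad (replicate (N - 1) True) True (2 * N) e,
     pad (replicate (2 * N - 1) True) True N e, pad (replicate (3 * N - 1) True) True (i * N) e'}"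
  have Xs: "length fs = t" if "fs \<in> Xs" for fs
    using that N e ie iN by (auto simp: Xs_def length_pad)
  define RR where "RR = alt ` Xs \<union> \<Union> (R ` W)"
  have "card (\<Union> (R ` W)) \<le> (\<Sum>v\<in>W. card (R v))" by (rule card_UN_le[OF W(1)])
  also have "\<dots> \<le> (\<Sum>v\<in>W. 1)" by (rule sum_mono) (use R in blast)
  finally have "card (\<Union> (R ` W)) \<le> card W" by simp
  moreover have "card (alt ` Xs) \<le> 3"
  proof -
    have "card Xs \<le> 3" unfolding Xs_def by (simp add: card_insert_if)
    then show ?thesis using card_image_le[of Xs alt] by (simp add: Xs_def)
  qed
  ultimately have "card RR \<le> m"
    using card_Un_le[of "alt ` Xs" "\<Union> (R ` W)"] W(2) by (simp add: RR_def)
  moreover have "finite RR" using R W(1) by (auto simp: RR_def Xs_def)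
  moreover have "RR \<noteq> {}" by (simp add: RR_def Xs_def)
  ultimately obtain rs where rs: "set rs = RR" "length rs = m" using list_of_set_with_length by blast
  have RRt: "\<exists>fs. r = alt fs \<and> length fs = t" if "r \<in> RR" for r
    using that R Xs by (auto simp: RR_def)
  have "(\<forall>r\<in>RR. K r) = (K (xpow N) \<and> (\<forall>v\<in>W. K v))" if K: "normal_words K" for K
  proof -
    interpret K: normal_words K by fact
    have "K (xpow N)" if "\<forall>fs\<in>Xs. K (alt fs)"
      by (rule K.xpow_trivial[OF N _ _ _ ie(1), of e e']) (use that in \<open>auto simp: Xs_def\<close>)
    moreover have "K (alt fs)" if "fs \<in> Xs" "K (xpow N)" for fs
    proof -
      have *: "K (xpow (j * N))" for j
        by (induction j) (use that(2) K.K_append in \<open>auto simp: apow_add apow_simps\<close>)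
      have **: "K (alt (pad (replicate (j * N - 1) True) True (k * N) e))"
        if "j \<ge> 1" "k \<ge> 1" for j k e
      proof -
        have "replicate (j * N - 1) True @ [True] = replicate (j * N) True"
          using that N by (metis Suc_pred' mult_pos_pos one_le_numeral order_less_le_trans
              replicate_Suc replicate_append_same zero_less_one less_eq_Suc_le One_nat_def)
        then show ?thesis
          using K.cong_K'[OF K.cong_pad_trivial[OF _ *[of k]], of "replicate (j * N - 1) True" True e]
            *[of j] that N by (simp add: apow_def)
      qed
      from **[of 1 2 e] **[of 2 1 e] **[of 3 i e'] show ?thesis
        using that(1) ie(1) by (auto simp: Xs_def)
    qed
    ultimately have eq: "(\<forall>fs\<in>Xs. K (alt fs)) = K (xpow N)" using Xs_def by blast
    have "(\<forall>v\<in>W. \<forall>r\<in>R v. K r) = (\<forall>v\<in>W. K v)" if "K (xpow N)"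
      using R K that by (intro ball_cong refl) blast
    with eq show ?thesis by (auto simp: RR_def)
  qed
  moreover have "r \<in> lists A \<and> cyclically_reduced r \<and> length r = 2 * t" if r: "r \<in> RR" for r
  proof -
    obtain fs where "r = alt fs" "length fs = t" using RRt[OF r] by blast
    then show ?thesis using alt_in_lists[of fs] cyclically_reduced_alt[of fs] by simp
  qed
  ultimately show ?thesis using rs by (intro exI[of _ rs]) blast
qed

section \<open>Bounding the isomorphism classes\<close>

context group
begin

definition center5 :: "'a set" where
  "center5 = {z \<in> carrier G. (\<forall>g\<in>carrier G. z \<otimes> g = g \<otimes> z) \<and> z [^] (5::nat) = \<one>}"

lemma center5_closed [simp]: "z \<in> center5 \<Longrightarrow> z \<in> carrier G"
  and center5_comm: "z \<in> center5 \<Longrightarrow> g \<in> carrier G \<Longrightarrow> z \<otimes> g = g \<otimes> z"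
  and center5_pow: "z \<in> center5 \<Longrightarrow> z [^] (5::nat) = \<one>"
  unfolding center5_def by blast+

lemma center5I:
  "z \<in> carrier G \<Longrightarrow> (\<And>g. g \<in> carrier G \<Longrightarrow> z \<otimes> g = g \<otimes> z) \<Longrightarrow> z [^] (5::nat) = \<one> \<Longrightarrow> z \<in> center5"
  unfolding center5_def by blast

lemma center5_one [simp]: "\<one> \<in> center5"
  by (rule center5I) auto

lemma center5_mult: "z \<in> center5 \<Longrightarrow> z' \<in> center5 \<Longrightarrow> z \<otimes> z' \<in> center5"
proof -
  assume z: "z \<in> center5" "z' \<in> center5"
  then have "(z \<otimes> z') [^] (5::nat) = \<one>"
    using pow_mult_distrib[OF center5_comm[of z z'], of 5] by (simp add: center5_pow)
  moreover have "z \<otimes> z' \<otimes> g = g \<otimes> (z \<otimes> z')" if "g \<in> carrier G" for g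
    using that z center5_comm[of z] center5_comm[of z'] by (metis center5_closed m_assoc)
  ultimately show ?thesis using z by (intro center5I) auto
qed

text \<open>An element of order dividing 2 or 3 is determined by its coset of \<^term>\<open>center5\<close>, because 5 is coprime to 6.\<close>

lemma center5_unique:
  assumes z: "z \<in> center5" "z' \<in> center5" and r: "r \<in> carrier G"
    and p: "(r \<otimes> z) [^] p = \<one>" "(r \<otimes> z') [^] p = \<one>" "p = 2 \<or> p = (3::nat)"
  shows "z = z'"
proof -
  have c: "z \<in> carrier G" "z' \<in> carrier G" using z by auto
  have "r [^] p \<otimes> z [^] p = \<one>" "r [^] p \<otimes> z' [^] p = \<one>"
    using p(1,2) pow_mult_distrib[OF center5_comm[OF z(1) r, symmetric] r c(1), of p]
      pow_mult_distrib[OF center5_comm[OF z(2) r, symmetric] r c(2), of p] by simp_all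
  then have eq: "z [^] p = z' [^] p"
    using r c by (metis l_cancel nat_pow_closed)
  have five: "z [^] (5::nat) = \<one>" "z' [^] (5::nat) = \<one>" using z center5_pow by auto
  have rec: "(y [^] (2::nat)) [^] (3::nat) = y" "(y [^] (3::nat)) [^] (2::nat) = y"
    if "y \<in> carrier G" "y [^] (5::nat) = \<one>" for y
  proof -
    have "y [^] (6::nat) = y [^] (5::nat) \<otimes> y [^] (1::nat)"
      using nat_pow_mult[OF that(1), of 5 1] by simp
    then have "y [^] (6::nat) = y" using that by simp
    then show "(y [^] (2::nat)) [^] (3::nat) = y" "(y [^] (3::nat)) [^] (2::nat) = y"
      using that(1) by (simp_all add: nat_pow_pow)
  qed
  from p(3) show ?thesis
  proof
    assume "p = 2"
    then have "(z [^] (2::nat)) [^] (3::nat) = (z' [^] (2::nat)) [^] (3::nat)" using eq by (simp only:)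
    then show ?thesis by (simp only: rec(1)[OF c(1) five(1)] rec(1)[OF c(2) five(2)])
  next
    assume "p = 3"
    then have "(z [^] (3::nat)) [^] (2::nat) = (z' [^] (3::nat)) [^] (2::nat)" using eq by (simp only:)
    then show ?thesis by (simp only: rec(2)[OF c(1) five(1)] rec(2)[OF c(2) five(2)])
  qed
qed

text \<open>The head of the list is the last factor, so a generator multiplied from the right meets
  the head first.\<close>

primrec ordered_products :: "'a list \<Rightarrow> 'a set" where
  "ordered_products [] = {\<one>}"
| "ordered_products (k # ks) = (\<lambda>(x, e). x \<otimes> k [^] e) ` (ordered_products ks \<times> {..<5::nat})"

lemma ordered_products_closed:
  "set ks \<subseteq> carrier G \<Longrightarrow> ordered_products ks \<subseteq> carrier G"
  by (induction ks) auto

lemma ordered_products_one: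
  "set ks \<subseteq> carrier G \<Longrightarrow> \<one> \<in> ordered_products ks"
proof (induction ks)
  case (Cons k ks)
  then show ?case by (auto intro!: image_eqI[of _ _ "(\<one>, 0)"])
qed simp

lemma finite_ordered_products [simp]: "finite (ordered_products ks)"
  by (induction ks) auto

lemma card_ordered_products: "card (ordered_products ks) \<le> 5 ^ length ks"
proof (induction ks)
  case (Cons k ks)
  have "card (ordered_products (k # ks)) \<le> card (ordered_products ks \<times> {..<5::nat})"
    by (simp only: ordered_products.simps) (rule card_image_le, simp)
  also have "\<dots> \<le> 5 ^ length (k # ks)" using Cons by (simp add: card_cartesian_product)
  finally show ?case .
qed simp

lemma pow_commute_center5:
  assumes "x \<in> carrier G" "y \<in> carrier G" "z \<in> center5" "x \<otimes> y = z \<otimes> (y \<otimes> x)"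
  shows "\<exists>z'\<in>center5. x [^] (e::nat) \<otimes> y = z' \<otimes> (y \<otimes> x [^] e)"
proof (induction e)
  case 0
  show ?case using assms by (intro bexI[of _ \<one>]) auto
next
  case (Suc e)
  then obtain z' where z': "z' \<in> center5" "x [^] e \<otimes> y = z' \<otimes> (y \<otimes> x [^] e)" by blast
  have c: "z \<in> carrier G" "z' \<in> carrier G" using assms z' by auto
  have "x [^] Suc e \<otimes> y = x [^] e \<otimes> (z \<otimes> (y \<otimes> x))"
    using assms by (simp add: m_assoc)
  also have "\<dots> = (x [^] e \<otimes> z) \<otimes> (y \<otimes> x)" using assms c by (simp add: m_assoc)
  also have "\<dots> = (z \<otimes> x [^] e) \<otimes> (y \<otimes> x)" using assms c center5_comm[OF assms(3)] by simp
  also have "\<dots> = z \<otimes> ((x [^] e \<otimes> y) \<otimes> x)" using assms c by (simp add: m_assoc)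
  also have "\<dots> = (z \<otimes> z') \<otimes> (y \<otimes> x [^] Suc e)" unfolding z'(2) using assms c by (simp add: m_assoc)
  finally show ?case using center5_mult[OF assms(3) z'(1)] by blast
qed

text \<open>Collection: \<open>k\<close> moves to the left until it meets its own power, whose
  exponent is then reduced modulo 5. Each exchange costs an element of \<open>center5\<close>, which
  is moved to the end.\<close>

lemma ordered_products_mult:
  assumes "set ks \<subseteq> carrier G" "\<And>k. k \<in> set ks \<Longrightarrow> k [^] (5::nat) = \<one>"
    and "\<And>k k'. k \<in> set ks \<Longrightarrow> k' \<in> set ks \<Longrightarrow> \<exists>z\<in>center5. k \<otimes> k' = z \<otimes> (k' \<otimes> k)"
    and "x \<in> ordered_products ks" "k \<in> set ks"
  shows "\<exists>y\<in>ordered_products ks. \<exists>z\<in>center5. x \<otimes> k = y \<otimes> z"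
  using assms
proof (induction ks arbitrary: x)
  case (Cons k0 ks)
  obtain y e where y: "y \<in> ordered_products ks" "e < (5::nat)" "x = y \<otimes> k0 [^] e"
    using Cons.prems(4) by auto
  have c: "k0 \<in> carrier G" "k \<in> carrier G" "y \<in> carrier G"
    using Cons.prems y ordered_products_closed[of ks] by auto
  show ?case
  proof (cases "k = k0")
    case True
    have "x \<otimes> k = y \<otimes> k0 [^] Suc e" using True y(3) c by (simp add: m_assoc)
    moreover have "k0 [^] Suc e = k0 [^] (Suc e mod 5)"
    proof (cases "Suc e = 5")
      case True
      then show ?thesis using Cons.prems(2)[of k0] by simp
    next
      case False
      then show ?thesis using y(2) by simp
    qed
    ultimately have "x \<otimes> k = (y \<otimes> k0 [^] (Suc e mod 5)) \<otimes> \<one>" using c by simp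
    moreover have "y \<otimes> k0 [^] (Suc e mod 5) \<in> ordered_products (k0 # ks)"
      using y(1) by (auto intro!: image_eqI[of _ _ "(y, Suc e mod 5)"])
    ultimately show ?thesis using center5_one by blast
  next
    case False
    then have k: "k \<in> set ks" using Cons.prems by simp
    obtain z where z: "z \<in> center5" "k0 [^] e \<otimes> k = z \<otimes> (k \<otimes> k0 [^] e)"
      using Cons.prems(3)[of k0 k] Cons.prems(5) pow_commute_center5[OF c(1,2)] by auto
    obtain y' z' where y': "y' \<in> ordered_products ks" "z' \<in> center5" "y \<otimes> k = y' \<otimes> z'"
      using Cons.IH[OF _ _ _ y(1) k] Cons.prems by auto
    have c': "z \<in> carrier G" "z' \<in> carrier G" "y' \<in> carrier G"
      using z y' ordered_products_closed[of ks] Cons.prems(1) by auto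
    have "x \<otimes> k = y \<otimes> (z \<otimes> (k \<otimes> k0 [^] e))" using y(3) c z(2) by (simp add: m_assoc)
    also have "\<dots> = (y \<otimes> k) \<otimes> k0 [^] e \<otimes> z"
      using c c' center5_comm[OF z(1)] by (simp add: m_assoc)
    also have "\<dots> = y' \<otimes> (z' \<otimes> (k0 [^] e \<otimes> z))"
      unfolding y'(3) using c c' by (simp add: m_assoc)
    also have "\<dots> = (y' \<otimes> k0 [^] e) \<otimes> (z \<otimes> z')"
      using c c' center5_comm[OF y'(2)] by (simp add: m_assoc)
    finally have "x \<otimes> k = (y' \<otimes> k0 [^] e) \<otimes> (z \<otimes> z')" .
    moreover have "y' \<otimes> k0 [^] e \<in> ordered_products (k0 # ks)"
      using y'(1) y(2) by (auto intro!: image_eqI[of _ _ "(y', e)"])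
    ultimately show ?thesis using center5_mult[OF z(1) y'(2)] by blast
  qed
qed simp

definition almost_central :: "nat \<Rightarrow> bool" where
  "almost_central N \<longleftrightarrow> (\<exists>R \<subseteq> carrier G. finite R \<and> card R \<le> N \<and>
     (\<forall>g \<in> carrier G. \<exists>r\<in>R. \<exists>z\<in>center5. g = r \<otimes> z))"

lemma almost_central_mono: "almost_central N \<Longrightarrow> N \<le> N' \<Longrightarrow> almost_central N'"
  unfolding almost_central_def by (meson order_trans)

text \<open>Since \<open>c\<close> is central, k^e k' = c^e k' k^e for all e. For e = 5 this gives
  c^5 = 1, so no separate relators are needed for the exponent of the commutators.\<close>

lemma commutator_center5:
  assumes k: "k \<in> carrier G" "k' \<in> carrier G" "k [^] (5::nat) = \<one>"
    and c: "c \<in> carrier G" "\<And>g. g \<in> carrier G \<Longrightarrow> c \<otimes> g = g \<otimes> c" "k \<otimes> k' = c \<otimes> (k' \<otimes> k)"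
  shows "c \<in> center5"
proof -
  have "k [^] e \<otimes> k' = c [^] e \<otimes> (k' \<otimes> k [^] e)" for e :: nat
  proof (induction e)
    case (Suc e)
    have "k [^] Suc e \<otimes> k' = k [^] e \<otimes> (c \<otimes> (k' \<otimes> k))" using k c(1) by (simp add: m_assoc c(3))
    also have "\<dots> = (k [^] e \<otimes> k') \<otimes> (k \<otimes> c)" using k c(1) c(2)[of k] c(2)[of "k' \<otimes> k"] by (simp add: m_assoc)
    also have "\<dots> = ((c [^] e \<otimes> (k' \<otimes> k [^] e)) \<otimes> k) \<otimes> c" using k c(1) by (simp add: Suc.IH m_assoc)
    also have "\<dots> = c \<otimes> ((c [^] e \<otimes> (k' \<otimes> k [^] e)) \<otimes> k)" using k c(1) by (intro c(2)[symmetric]) simp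
    also have "\<dots> = c [^] Suc e \<otimes> (k' \<otimes> k [^] Suc e)"
      unfolding nat_pow_Suc2[OF c(1)] nat_pow_Suc[of k] using k c(1) by (simp add: m_assoc)
    finally show ?case .
  qed (use k in simp)
  from this[of 5] have "c [^] (5::nat) = \<one>" using k c(1) by simp
  then show ?thesis using c by (intro center5I) auto
qed

text \<open>The Schreier generators \<open>S\<close> of the subgroup with transversal \<open>T\<close> commute modulo the centre,
  so they can be collected.\<close>

lemma almost_centralI:
  assumes gen: "carrier G = range q" "q [] = \<one>" "\<And>w l. q (w @ [l]) = q w \<otimes> q [l]"
    and T: "finite T" "[] \<in> T" and S: "finite S"
    and step: "\<And>\<tau> l. \<tau> \<in> T \<Longrightarrow> \<exists>k\<in>S. \<exists>\<tau>'\<in>T. q \<tau> \<otimes> q [l] = q k \<otimes> q \<tau>'"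
    and pow: "\<And>k. k \<in> S \<Longrightarrow> q k [^] (5::nat) = \<one>"
    and com: "\<And>k k'. k \<in> S \<Longrightarrow> k' \<in> S \<Longrightarrow> \<exists>z\<in>center5. q k \<otimes> q k' = z \<otimes> (q k' \<otimes> q k)"
  shows "almost_central (card T * 5 ^ card S)"
proof -
  have qc: "q w \<in> carrier G" for w using gen(1) by blast
  obtain ks where ks: "set ks = q ` S" "distinct ks"
    using finite_distinct_list[OF finite_imageI[OF S, of q]] by (elim exE conjE)
  have kslen: "length ks \<le> card S"
    using card_image_le[OF S, of q] distinct_card[OF ks(2)] ks(1) by simp
  have ksc: "set ks \<subseteq> carrier G" using ks qc by auto
  define R where "R = (\<lambda>(x, \<tau>). x \<otimes> q \<tau>) ` (ordered_products ks \<times> T)"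
  have "card R \<le> card (ordered_products ks \<times> T)"
    unfolding R_def using T by (intro card_image_le) simp
  also have "\<dots> \<le> 5 ^ card S * card T"
    using order_trans[OF card_ordered_products[of ks] power_increasing[OF kslen, of "5::nat"]]
    by (simp add: card_cartesian_product)
  finally have cR: "card R \<le> card T * 5 ^ card S" by (simp add: mult.commute)
  have RI: "x \<otimes> q \<tau> \<in> R" if "x \<in> ordered_products ks" "\<tau> \<in> T" for x \<tau>
    using that by (auto simp: R_def)
  have "\<exists>x\<in>ordered_products ks. \<exists>\<tau>\<in>T. \<exists>z\<in>center5. q w = (x \<otimes> q \<tau>) \<otimes> z" for w
  proof (induction w rule: rev_induct)
    case Nil
    show ?case
      using ordered_products_one[OF ksc] T(2) gen(2) by (intro bexI[of _ \<one>] bexI[of _ "[]"]) auto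
  next
    case (snoc l w)
    then obtain x \<tau> z where x: "x \<in> ordered_products ks" "\<tau> \<in> T" "z \<in> center5"
      "q w = (x \<otimes> q \<tau>) \<otimes> z" by (elim bexE)
    obtain k \<tau>' where k: "k \<in> S" "\<tau>' \<in> T" "q \<tau> \<otimes> q [l] = q k \<otimes> q \<tau>'"
      using step[OF x(2), of l] by (elim bexE)
    have "\<exists>y\<in>ordered_products ks. \<exists>z'\<in>center5. x \<otimes> q k = y \<otimes> z'"
    proof (rule ordered_products_mult[OF ksc _ _ x(1)])
      show "q k \<in> set ks" using k(1) ks(1) by simp
      show "k' [^] (5::nat) = \<one>" if "k' \<in> set ks" for k' using that pow by (auto simp: ks(1))
      show "\<exists>z\<in>center5. h \<otimes> h' = z \<otimes> (h' \<otimes> h)" if "h \<in> set ks" "h' \<in> set ks" for h h'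
        using that com unfolding ks(1) by (elim imageE) simp
    qed
    then obtain y z' where y: "y \<in> ordered_products ks" "z' \<in> center5" "x \<otimes> q k = y \<otimes> z'"
      by (elim bexE)
    have c: "x \<in> carrier G" "y \<in> carrier G" "z \<in> carrier G" "z' \<in> carrier G"
      using x y ordered_products_closed[OF ksc] by auto
    have "q (w @ [l]) = (x \<otimes> q \<tau>) \<otimes> (z \<otimes> q [l])" using c qc by (simp add: gen(3) x(4) m_assoc)
    also have "\<dots> = (x \<otimes> (q \<tau> \<otimes> q [l])) \<otimes> z"
      using c qc center5_comm[OF x(3)] by (simp add: m_assoc)
    also have "\<dots> = ((x \<otimes> q k) \<otimes> q \<tau>') \<otimes> z" using c qc by (simp add: k(3) m_assoc)
    also have "\<dots> = (y \<otimes> (z' \<otimes> q \<tau>')) \<otimes> z" using c qc by (simp add: y(3) m_assoc)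
    also have "\<dots> = (y \<otimes> q \<tau>') \<otimes> (z' \<otimes> z)"
      using c qc center5_comm[OF y(2)] by (simp add: m_assoc)
    finally show ?case
      using y(1) k(2) center5_mult[OF y(2) x(3)]
      by (intro bexI[of _ y] bexI[of _ \<tau>'] bexI[of _ "z' \<otimes> z"])
  qed
  then have "\<exists>r\<in>R. \<exists>z\<in>center5. q w = r \<otimes> z" for w using RI by metis
  then have "\<forall>g\<in>carrier G. \<exists>r\<in>R. \<exists>z\<in>center5. g = r \<otimes> z" unfolding gen(1) by simp
  moreover have "R \<subseteq> carrier G" using ordered_products_closed[OF ksc] qc by (auto simp: R_def)
  moreover have "finite R" using T by (simp add: R_def)
  ultimately show ?thesis
    unfolding almost_central_def using cR by (intro exI[of _ R] conjI) simp_all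
qed

end

section \<open>The bound on isomorphism classes for quotients of \<open>M\<close>\<close>

definition comm :: "word \<Rightarrow> word \<Rightarrow> word" where
  "comm u v = u @ v @ winv u @ winv v"

lemma length_comm [simp]: "length (comm u v) = 2 * (length u + length v)"
  by (simp add: comm_def)

lemma inv_quot_elem: "inv\<^bsub>M_quotient rs\<^esub> (quot_elem rs w) = quot_elem rs (winv w)"
proof -
  interpret G: group "M_quotient rs" by (rule group_M_quotient)
  interpret normal_words "trivial_in rs" by (rule normal_words_trivial_in)
  show ?thesis
    by (rule G.inv_equality)
      (auto simp: carrier_M_quotient quot_elem_eq_one simp flip: quot_elem_append)
qed

lemma quot_elem_closed [simp]: "quot_elem rs w \<in> carrier (M_quotient rs)"
  by (simp add: carrier_M_quotient)

lemma quot_elem_Nil: "quot_elem rs [] = \<one>\<^bsub>M_quotient rs\<^esub>"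
  using normal_words.K_Nil[OF normal_words_trivial_in] by (simp add: quot_elem_eq_one)

lemma quot_elem_eq_iff: "quot_elem rs u = quot_elem rs v \<longleftrightarrow> trivial_in rs (u @ winv v)"
proof -
  interpret G: group "M_quotient rs" by (rule group_M_quotient)
  have "quot_elem rs u \<otimes>\<^bsub>M_quotient rs\<^esub> inv\<^bsub>M_quotient rs\<^esub> quot_elem rs v = \<one>\<^bsub>M_quotient rs\<^esub> \<longleftrightarrow>
      quot_elem rs u = quot_elem rs v"
    using G.inv_equality G.inv_inv G.r_inv by (metis G.inv_closed quot_elem_closed)
  then show ?thesis by (simp add: inv_quot_elem quot_elem_eq_one flip: quot_elem_append)
qed

lemma almost_central_M_quotient:
  assumes T: "finite T" "[] \<in> T" and S: "finite S"
    and step: "\<And>\<tau> l. \<tau> \<in> T \<Longrightarrow> \<exists>k\<in>S. \<exists>\<tau>'\<in>T. trivial_in rs ((\<tau> @ [l]) @ winv (k @ \<tau>'))"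
    and pow: "\<And>k. k \<in> S \<Longrightarrow> trivial_in rs (k @ k @ k @ k @ k)"
    and com: "\<And>k k' l. k \<in> S \<Longrightarrow> k' \<in> S \<Longrightarrow> trivial_in rs (comm (comm k k') [l])"
  shows "group.almost_central (M_quotient rs) (card T * 5 ^ card S)"
proof -
  interpret G: group "M_quotient rs" by (rule group_M_quotient)
  interpret T: normal_words "trivial_in rs" by (rule normal_words_trivial_in)
  let ?q = "quot_elem rs"
  let ?m = "\<lambda>x y. x \<otimes>\<^bsub>M_quotient rs\<^esub> y"
  have pow5: "?q k [^]\<^bsub>M_quotient rs\<^esub> (5::nat) = \<one>\<^bsub>M_quotient rs\<^esub>" if "k \<in> S" for k
    using pow[OF that]
    by (simp add: quot_elem_append numeral_eq_Suc G.m_assoc flip: quot_elem_eq_one)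
  show ?thesis
  proof (rule G.almost_centralI[of ?q, OF carrier_M_quotient quot_elem_Nil quot_elem_append T S _ pow5])
    show "\<exists>k\<in>S. \<exists>\<tau>'\<in>T. ?m (?q \<tau>) (?q [l]) = ?m (?q k) (?q \<tau>')" if "\<tau> \<in> T" for \<tau> l
      using step[OF that, of l] by (simp only: quot_elem_append flip: quot_elem_eq_iff)
    fix k k' assume k: "k \<in> S" "k' \<in> S"
    let ?c = "comm k k'"
    \<comment> \<open>The relators make the commutator commute with single letters only; the letters
      generate.\<close>
    have "?m (?q ?c) (?q w) = ?m (?q w) (?q ?c)" for w
    proof (induction w rule: rev_induct)
      case (snoc l w)
      have "?q (?c @ [l]) = ?q ([l] @ ?c)"
        using com[OF k, of l] by (simp add: quot_elem_eq_iff comm_def)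
      then have l: "?m (?q ?c) (?q [l]) = ?m (?q [l]) (?q ?c)" by (simp only: quot_elem_append)
      have "?m (?q ?c) (?q (w @ [l])) = ?m (?m (?q ?c) (?q w)) (?q [l])"
        by (simp add: quot_elem_append G.m_assoc)
      also have "\<dots> = ?m (?q (w @ [l])) (?q ?c)"
        unfolding snoc by (simp add: quot_elem_append G.m_assoc l)
      finally show ?case .
    qed (simp add: quot_elem_Nil)
    then have c: "?m (?q ?c) g = ?m g (?q ?c)" if "g \<in> carrier (M_quotient rs)" for g
      using that by (auto simp: carrier_M_quotient)
    have "trivial_in rs ((k @ k') @ winv (?c @ k' @ k))"
      using T.K_winv_right[of ?c] T.K_commute T.K_cancel[of "[]"] by (simp add: comm_def)
    then have kk: "?m (?q k) (?q k') = ?m (?q ?c) (?m (?q k') (?q k))"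
      by (simp only: quot_elem_append flip: quot_elem_eq_iff)
    have "?q ?c \<in> G.center5"
      by (rule G.commutator_center5[OF _ _ pow5[OF k(1)] _ c kk]) simp_all
    with kk show "\<exists>z\<in>G.center5. ?m (?q k) (?q k') = ?m z (?m (?q k') (?q k))" by (rule bexI)
  qed
qed

text \<open>An isomorphism turns the projection from \<open>M\<close> into a homomorphism to
  \<open>G\<close> with kernel \<open>trivial_in (R f)\<close>. It is fixed by the images of a and
  b, which \<open>center5_unique\<close> recovers from their two cosets: hence the exponent
  2.\<close>

lemma (in group) iso_class_bound:
  assumes F: "finite F" and ac: "almost_central N"
    and iso: "\<And>f. f \<in> F \<Longrightarrow> M_quotient (R f) \<cong> G"
    and inj: "\<And>f f'. f \<in> F \<Longrightarrow> f' \<in> F \<Longrightarrow> trivial_in (R f) = trivial_in (R f') \<Longrightarrow> f = f'"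
  shows "card F \<le> N ^ 2"
proof -
  obtain Q where Q: "Q \<subseteq> carrier G" "finite Q" "card Q \<le> N"
    "\<forall>g\<in>carrier G. \<exists>r\<in>Q. \<exists>z\<in>center5. g = r \<otimes> z"
    using ac unfolding almost_central_def by (elim exE conjE)
  obtain \<phi> where \<phi>: "\<And>f. f \<in> F \<Longrightarrow> \<phi> f \<in> Group.iso (M_quotient (R f)) G"
    using bchoice[of F "\<lambda>f h. h \<in> Group.iso (M_quotient (R f)) G"] iso
    unfolding is_iso_def by blast
  obtain \<rho> \<zeta> where \<rho>: "\<And>g. g \<in> carrier G \<Longrightarrow> \<rho> g \<in> Q \<and> \<zeta> g \<in> center5 \<and> g = \<rho> g \<otimes> \<zeta> g"
    using Q(4) by metis
  define img where "img f w = \<phi> f (quot_elem (R f) w)" for f w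
  have hom: "\<phi> f \<in> hom (M_quotient (R f)) G"
    and bij: "bij_betw (\<phi> f) (carrier (M_quotient (R f))) (carrier G)" if "f \<in> F" for f
    using \<phi>[OF that] by (auto simp: Group.iso_def)
  have img_closed: "img f w \<in> carrier G" if "f \<in> F" for f w
    using hom[OF that] by (auto simp: img_def hom_def)
  have img_append: "img f (u @ v) = img f u \<otimes> img f v" if "f \<in> F" for f u v
    using hom[OF that] by (simp add: img_def hom_def quot_elem_append)
  have img_one: "img f w = \<one> \<longleftrightarrow> trivial_in (R f) w" if f: "f \<in> F" for f w
  proof -
    have "img f [] = \<one>"
      using img_append[OF f, of "[]" "[]"] img_closed[OF f, of "[]"] by (simp add: r_cancel_one')
    moreover have "img f w = img f [] \<longleftrightarrow> quot_elem (R f) w = quot_elem (R f) []"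
      unfolding img_def using bij_betw_imp_inj_on[OF bij[OF f]] by (simp add: inj_on_eq_iff)
    ultimately show ?thesis by (simp add: quot_elem_Nil quot_elem_eq_one)
  qed
  have img_inv: "img f (winv w) = inv img f w" if f: "f \<in> F" for f w
    using img_append[OF f, of "winv w" w] img_closed[OF f]
      normal_words.K_winv_left[OF normal_words_trivial_in, of "R f" w]
    by (metis inv_equality img_one[OF f])
  define code where "code f = (\<rho> (img f [la]), \<rho> (img f [lb]))" for f
  have img_pow: "img f [la] [^] (2::nat) = \<one>" "img f [lb] [^] (3::nat) = \<one>" if f: "f \<in> F" for f
  proof -
    have "img f [la, la] = \<one>" "img f [lb, lb, lb] = \<one>"
      unfolding img_one[OF f]
      using normal_words.K_aa[OF normal_words_trivial_in] normal_words.K_bbb[OF normal_words_trivial_in]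
      by blast+
    then show "img f [la] [^] (2::nat) = \<one>" "img f [lb] [^] (3::nat) = \<one>"
      using img_append[OF f, of "[la]" "[la]"] img_append[OF f, of "[lb]" "[lb, lb]"]
        img_append[OF f, of "[lb]" "[lb]"] img_closed[OF f]
      by (simp_all add: numeral_eq_Suc m_assoc)
  qed
  have "inj_on code F"
  proof
    fix f f' assume f: "f \<in> F" "f' \<in> F" and "code f = code f'"
    then have eq: "\<rho> (img f [la]) = \<rho> (img f' [la])" "\<rho> (img f [lb]) = \<rho> (img f' [lb])"
      by (simp_all add: code_def)
    have lift: "img f [l] = img f' [l]"
      if r: "\<rho> (img f [l]) = \<rho> (img f' [l])" and p: "p = 2 \<or> p = (3::nat)"
        "img f [l] [^] p = \<one>" "img f' [l] [^] p = \<one>" for l p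
    proof -
      note a = \<rho>[OF img_closed[OF f(1), of "[l]"]] and b = \<rho>[OF img_closed[OF f(2), of "[l]"]]
      have "\<zeta> (img f [l]) = \<zeta> (img f' [l])"
        by (rule center5_unique[of _ _ "\<rho> (img f [l])" p])
          (use a b r p Q(1) in \<open>auto simp: subset_iff\<close>)
      then show ?thesis using a b r by metis
    qed
    have la: "img f [la] = img f' [la]" and lb: "img f [lb] = img f' [lb]"
      using lift[OF eq(1), of 2] lift[OF eq(2), of 3] img_pow f by auto
    have letter: "img f [l] = img f' [l]" for l
      using letter_cases[of l] la lb img_inv[OF f(1), of "[la]"] img_inv[OF f(2), of "[la]"]
        img_inv[OF f(1), of "[lb]"] img_inv[OF f(2), of "[lb]"] by auto
    have "img f w = img f' w" for w
    proof (induction w)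
      case Nil
      then show ?case using img_one[OF f(1), of "[]"] img_one[OF f(2), of "[]"]
          normal_words.K_Nil[OF normal_words_trivial_in] by metis
    next
      case (Cons l w)
      then show ?case
        using img_append[OF f(1), of "[l]" w] img_append[OF f(2), of "[l]" w] letter by simp
    qed
    then have "trivial_in (R f) = trivial_in (R f')"
      using img_one[OF f(1)] img_one[OF f(2)] by (intro ext) metis
    then show "f = f'" using inj f by blast
  qed
  moreover have "code ` F \<subseteq> Q \<times> Q" using \<rho> img_closed by (auto simp: code_def)
  ultimately have "card F \<le> card (Q \<times> Q)" using card_inj_on_le Q(2) by blast
  also have "\<dots> \<le> N ^ 2" using Q(3) by (simp add: card_cartesian_product power2_eq_square mult_mono)
  finally show ?thesis .
qed

lemma J_lower_bound:
  assumes F: "finite F"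
    and R: "\<And>f. f \<in> F \<Longrightarrow> length (R f) = nat \<lfloor>2 powr (real t * \<epsilon>)\<rfloor> \<and>
       (\<forall>r\<in>set (R f). r \<in> lists A \<and> cyclically_reduced r \<and> length r = 2 * t)"
    and ac: "\<And>f. f \<in> F \<Longrightarrow> group.almost_central (M_quotient (R f)) N"
    and inj: "\<And>f f'. f \<in> F \<Longrightarrow> f' \<in> F \<Longrightarrow> trivial_in (R f) = trivial_in (R f') \<Longrightarrow> f = f'"
  shows "card F \<le> J \<epsilon> t * N ^ 2"
proof -
  let ?\<G> = "M_quotients \<epsilon> t"
  let ?r = "{(G, H). G \<in> ?\<G> \<and> H \<in> ?\<G> \<and> G \<cong> H}"
  have mem: "M_quotient (R f) \<in> ?\<G>" if "f \<in> F" for f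
    using R[OF that] unfolding M_quotients_def by blast
  have eqv: "equiv ?\<G> ?r"
    by (rule equiv_iso_on) (auto simp: M_quotients_def group_M_quotient)
  have fin: "finite (iso_types ?\<G>)"
    unfolding iso_types_def by (rule finite_quotient[OF finite_M_quotients]) auto
  have "F \<subseteq> (\<Union>c\<in>iso_types ?\<G>. {f \<in> F. M_quotient (R f) \<in> c})"
  proof
    fix f assume f: "f \<in> F"
    have "?r `` {M_quotient (R f)} \<in> iso_types ?\<G>"
      unfolding iso_types_def by (rule quotientI[OF mem[OF f]])
    moreover have "M_quotient (R f) \<in> ?r `` {M_quotient (R f)}"
      using mem[OF f] by (simp add: iso_refl)
    ultimately show "f \<in> (\<Union>c\<in>iso_types ?\<G>. {f \<in> F. M_quotient (R f) \<in> c})" using f by blast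
  qed
  then have "card F \<le> card (\<Union>c\<in>iso_types ?\<G>. {f \<in> F. M_quotient (R f) \<in> c})"
    using F fin by (intro card_mono) auto
  also have "\<dots> \<le> (\<Sum>c\<in>iso_types ?\<G>. card {f \<in> F. M_quotient (R f) \<in> c})"
    by (rule card_UN_le[OF fin])
  also have "\<dots> \<le> (\<Sum>c\<in>iso_types ?\<G>. N ^ 2)"
  proof (rule sum_mono)
    fix c assume c: "c \<in> iso_types ?\<G>"
    let ?Fc = "{f \<in> F. M_quotient (R f) \<in> c}"
    show "card ?Fc \<le> N ^ 2"
    proof (cases "?Fc = {}")
      case True
      then show ?thesis by (simp only: card.empty)
    next
      case False
      then obtain f0 where f0: "f0 \<in> F" "M_quotient (R f0) \<in> c" by blast
      have "M_quotient (R f) \<cong> M_quotient (R f0)" if "f \<in> ?Fc" for f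
        using quotient_eq_iff[OF eqv, of c c "M_quotient (R f)" "M_quotient (R f0)"] c f0 that
        by (auto simp: iso_types_def)
      then show ?thesis
        using F inj by (intro group.iso_class_bound[OF group_M_quotient _ ac[OF f0(1)]]) auto
    qed
  qed
  finally show ?thesis by (simp add: J_def)
qed

section \<open>Central quotients of a finite quotient\<close>

context normal_words
begin

definition cls :: "word \<Rightarrow> word set" where
  "cls w = {v. cong w v}"

lemma cls_eq_iff: "cls u = cls v \<longleftrightarrow> cong u v"
proof
  assume "cls u = cls v"
  moreover have "v \<in> cls v" by (simp add: cls_def)
  ultimately have "v \<in> cls u" by (simp only:)
  then show "cong u v" by (simp add: cls_def)
next
  assume c: "cong u v"
  have "cong u w = cong v w" for w
    using cong_trans[OF c, of w] cong_trans[OF cong_sym[OF c], of w] by blast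
  then show "cls u = cls v" by (simp add: cls_def)
qed

lemma mem_cls: "v \<in> cls w \<longleftrightarrow> cong w v"
  by (simp add: cls_def)

end

text \<open>If \<open>u\<close> is a loop modulo \<open>K1\<close> starting with the letter \<open>e\<close>, say \<open>u = e B\<close>, then \<open>u\<^sup>2\<close> is trivial
  modulo \<open>K\<close>, so that \<open>e B e\<close> may be replaced by the shorter word \<open>B\<^sup>-\<^sup>1\<close>.\<close>

lemma short_representatives:
  assumes K: "normal_words K" and K1: "normal_words K1"
    and sq: "\<And>u. K1 u \<Longrightarrow> K (u @ u)"
    and fin: "finite (range (normal_words.cls K1))"
  shows "\<exists>v. normal_words.cong K w v \<and> length v \<le> 4 * card (range (normal_words.cls K1))"
proof (induction "length w" arbitrary: w rule: less_induct)
  case less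
  interpret K: normal_words K by fact
  interpret K1: normal_words K1 by fact
  let ?s = "card (range K1.cls)"
  show ?case
  proof (cases "length w \<le> 4 * ?s")
    case True
    then show ?thesis using K.cong_refl by blast
  next
    case False
    let ?L = "{la, linv la, lb, lbi}"
    \<comment> \<open>Pigeonhole on the class of a prefix together with the next letter: a
      repetition is a loop modulo \<open>K1\<close> followed by its own first letter. Four letters
      give the factor 4.\<close>
    let ?f = "\<lambda>i. (K1.cls (take i w), w ! i)"
    have fin': "finite (range K1.cls \<times> ?L)" using fin by simp
    have L: "card ?L \<le> 4" by (simp add: card_insert_if)
    have "card (range K1.cls \<times> ?L) \<le> ?s * 4" unfolding card_cartesian_product by (rule mult_le_mono2[OF L])
    then have "card (range K1.cls \<times> ?L) < card {..<length w}" using False by simp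
    moreover have "?f ` {..<length w} \<subseteq> range K1.cls \<times> ?L" using letter_cases by auto
    ultimately have "\<not> inj_on ?f {..<length w}"
      using card_inj_on_le[OF _ _ fin', of ?f "{..<length w}"] by linarith
    then obtain i0 j0 where ij0: "i0 < length w" "j0 < length w" "?f i0 = ?f j0" "i0 \<noteq> j0"
      by (auto simp: inj_on_def)
    define i j where "i = min i0 j0" and "j = max i0 j0"
    have ij: "i < j" "j < length w" "K1.cls (take i w) = K1.cls (take j w)" "w ! i = w ! j"
      using ij0 by (auto simp: i_def j_def min_def max_def)
    define A' B C where "A' = take i w" and "B = take (j - Suc i) (drop (Suc i) w)" and "C = drop (Suc j) w"
    let ?e = "w ! i"
    have w1: "take j w = A' @ ?e # B"
    proof -
      have "take j w = take i w @ take (j - i) (drop i w)"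
        using ij(1) by (metis le_add_diff_inverse less_imp_le_nat take_add)
      also have "drop i w = ?e # drop (Suc i) w"
        using ij(1,2) by (intro Cons_nth_drop_Suc[symmetric]) simp
      finally show ?thesis using ij(1) by (simp add: A'_def B_def take_Cons' Suc_diff_Suc)
    qed
    have w2: "w = A' @ (?e # B @ [?e]) @ C"
      using id_take_nth_drop[OF ij(2)] w1 ij(4) by (simp add: C_def)
    have "K1.cong (A' @ []) (A' @ ?e # B)" using ij(3) w1 by (simp add: K1.cls_eq_iff A'_def)
    then have "K1 (?e # B)"
      using K1.cong_cancel_left K1.cong_sym K1.cong_Nil by blast
    from sq[OF this] have "K.cong (?e # B @ [?e]) (winv B)" by (simp add: K.cong_def)
    then have c: "K.cong w (A' @ winv B @ C)"
      using K.cong_ctxt[of "?e # B @ [?e]" "winv B" A' C] w2 by simp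
    have "length (A' @ winv B @ C) < length w" using arg_cong[OF w2, of length] by simp
    from less[OF this] show ?thesis using K.cong_trans[OF c] by blast
  qed
qed

lemma short_transversal:
  assumes K: "normal_words K" and fin: "finite (range (normal_words.cls K))"
    and short: "\<And>w. \<exists>v. normal_words.cong K w v \<and> length v \<le> l"
  shows "\<exists>T. finite T \<and> [] \<in> T \<and> card T = card (range (normal_words.cls K)) \<and>
    (\<forall>\<tau>\<in>T. length \<tau> \<le> l) \<and> (\<forall>w. \<exists>\<tau>\<in>T. normal_words.cong K w \<tau>)"
proof -
  interpret normal_words K by fact
  \<comment> \<open>The trivial class must be represented by the empty word, at which the collection
    in \<open>almost_centralI\<close> starts.\<close>
  have "\<exists>v. v \<in> c \<and> length v \<le> l \<and> ([] \<in> c \<longrightarrow> v = [])" if "c \<in> range cls" for c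
  proof (cases "[] \<in> c")
    case True
    then show ?thesis by (intro exI[of _ "[]"]) auto
  next
    case False
    then show ?thesis using that short by (auto simp: mem_cls)
  qed
  then obtain r where r: "\<And>c. c \<in> range cls \<Longrightarrow> r c \<in> c \<and> length (r c) \<le> l \<and> ([] \<in> c \<longrightarrow> r c = [])"
    by metis
  have inj: "inj_on r (range cls)"
  proof
    fix c c' assume c: "c \<in> range cls" "c' \<in> range cls" "r c = r c'"
    then obtain u v where "c = cls u" "c' = cls v" by auto
    moreover have "cong u (r c)" "cong v (r c)" using r[OF c(1)] r[OF c(2)] c calculation
      by (auto simp: mem_cls)
    ultimately show "c = c'" using cong_sym cong_trans cls_eq_iff by blast
  qed
  have "[] \<in> cls []" by (simp add: mem_cls)
  then have "[] = r (cls [])" using r[of "cls []"] by simp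
  then have "[] \<in> r ` range cls" by blast
  moreover have "\<exists>\<tau>\<in>r ` range cls. cong w \<tau>" for w
    using r[of "cls w"] by (auto simp: mem_cls)
  ultimately show ?thesis
    using fin r card_image[OF inj] by (intro exI[of _ "r ` range cls"]) auto
qed

text \<open>A maximal conflict-free set is in conflict with every element of \<open>V\<close>, and
  each of its members accounts for at most \<Delta> of them. It serves below for the positions of
  lamps and for the words h.\<close>

lemma greedy_independent_set:
  assumes V: "finite V" and conf: "\<And>x. x \<in> V \<Longrightarrow> conf x x" "\<And>x y. conf x y \<Longrightarrow> conf y x"
    and deg: "\<And>x. x \<in> V \<Longrightarrow> card {y \<in> V. conf x y} \<le> \<Delta>"
  shows "\<exists>S \<subseteq> V. (\<forall>x\<in>S. \<forall>y\<in>S. x \<noteq> y \<longrightarrow> \<not> conf x y) \<and> card V \<le> card S * \<Delta>"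
proof -
  let ?P = "\<lambda>S. S \<subseteq> V \<and> (\<forall>x\<in>S. \<forall>y\<in>S. x \<noteq> y \<longrightarrow> \<not> conf x y)"
  have fin: "finite (Collect ?P)" by (rule finite_subset[of _ "Pow V"]) (use V in auto)
  have ne: "Collect ?P \<noteq> {}" by (auto intro: exI[of _ "{}"])
  from finite_has_maximal[OF fin ne] obtain S where "S \<in> Collect ?P" "\<forall>S'\<in>Collect ?P. S \<subseteq> S' \<longrightarrow> S = S'"
    by (elim bexE)
  then have S: "?P S" and max: "\<forall>S'. ?P S' \<longrightarrow> S \<subseteq> S' \<longrightarrow> S = S'"
    by simp_all
  have finS: "finite S" using S V finite_subset by blast
  have "V \<subseteq> (\<Union>x\<in>S. {y \<in> V. conf x y})"
  proof
    fix y assume y: "y \<in> V"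
    show "y \<in> (\<Union>x\<in>S. {y \<in> V. conf x y})"
    proof (rule ccontr)
      assume n: "y \<notin> (\<Union>x\<in>S. {y \<in> V. conf x y})"
      then have "\<not> conf x y \<and> \<not> conf y x" if "x \<in> S" for x using that y conf(2) by blast
      then have "?P (insert y S)" using S y by auto
      then have "S = insert y S" using max by blast
      then show False using n y conf(1) by blast
    qed
  qed
  then have "card V \<le> card (\<Union>x\<in>S. {y \<in> V. conf x y})"
    using finS V by (intro card_mono) auto
  also have "\<dots> \<le> (\<Sum>x\<in>S. card {y \<in> V. conf x y})" by (rule card_UN_le[OF finS])
  also have "\<dots> \<le> (\<Sum>x\<in>S. \<Delta>)" using S deg by (intro sum_mono) auto
  finally show ?thesis using S by auto
qed

definition pow5 :: "word \<Rightarrow> word" where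
  "pow5 k = k @ k @ k @ k @ k"

lemma xpow_pow5: "xpow (5 * N) = pow5 (xpow N)"
  using apow_add[of True N "4 * N"] apow_add[of True N "3 * N"] apow_add[of True N "2 * N"]
    apow_add[of True N N]
  by (simp add: pow5_def numeral_eq_Suc)

text \<open>In the group with kernel \<open>Q\<close> the words \<open>x i\<close> represent the elements \<open>\<mu> i\<close> of a central subgroup \<open>Z/5\<close>.\<close>

definition central_values :: "(word \<Rightarrow> bool) \<Rightarrow> nat \<Rightarrow> (nat \<Rightarrow> word) \<Rightarrow> (nat \<Rightarrow> int) \<Rightarrow> (word \<Rightarrow> bool) \<Rightarrow> bool" where
  "central_values K r x \<mu> Q \<longleftrightarrow> normal_words Q \<and> (\<forall>k. K k \<longrightarrow> Q (pow5 k)) \<and>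
     (\<forall>k k' l. K k \<longrightarrow> K k' \<longrightarrow> Q (comm (comm k k') [l])) \<and>
     (\<forall>i<r. \<forall>j<r. Q (x i @ winv (x j)) \<longleftrightarrow> \<mu> i mod 5 = \<mu> j mod 5)"

lemma (in normal_words) K_comm: "K u \<Longrightarrow> K v \<Longrightarrow> K (comm u v)"
  by (simp add: comm_def K_append K_winv)

lemma (in normal_words) K_comm': "K u \<Longrightarrow> K (comm u v)"
  using K_conj[of v "winv u"] K_append[of u "v @ winv u @ winv v"] by (simp add: comm_def K_winv)

text \<open>The relators \<open>x\<^sub>i = x\<^bsub>q+f(i)\<^esub>\<close> identify elements of the central subgroup generated by the commutators
  of the Schreier generators; the assumption \<open>heis\<close> says that they are independent.\<close>

theorem quotient_count:
  fixes x :: "nat \<Rightarrow> word"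
  assumes K: "normal_words K" "\<not> K [la]" "\<not> K [lb]"
    and T: "finite T" "[] \<in> T" "card T = n" "\<And>\<tau>. \<tau> \<in> T \<Longrightarrow> length \<tau> \<le> l"
      "\<And>w. \<exists>\<tau>\<in>T. normal_words.cong K w \<tau>"
    and x: "\<And>i. i < 2 * q \<Longrightarrow> K (x i)" "\<And>i. i < 2 * q \<Longrightarrow> length (x i) \<le> lx"
    and heis: "\<And>\<mu>. \<exists>Q. central_values K (2 * q) x \<mu> Q"
    and N: "N = 5 * N0" "N0 \<ge> 1" "K (xpow N0)"
    and par: "odd N \<and> odd t \<or> even N \<and> even t \<and> (\<forall>w. K w \<longrightarrow> even (count_a w))"
    and len: "16 * (2 * l + 1) + 2 * lx + 2 * N + 4 \<le> t" "5 * N + 2 \<le> t"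
    and m: "64 * n ^ 2 + 4 * n + q + 3 \<le> nat \<lfloor>2 powr (real t * \<epsilon>)\<rfloor>"
  shows "q ^ q \<le> J \<epsilon> t * (n * 5 ^ (4 * n)) ^ 2"
proof -
  interpret K: normal_words K by fact
  have N1: "N \<ge> 1" using N by simp
  let ?L = "{la, linv la, lb, lbi}"
  obtain nxt where nxt: "\<And>w. nxt w \<in> T \<and> K.cong w (nxt w)" using T(5) by metis
  define k where "k \<tau> e = \<tau> @ [e] @ winv (nxt (\<tau> @ [e]))" for \<tau> :: word and e :: letter
  define S where "S = (\<lambda>(\<tau>, e). k \<tau> e) ` (T \<times> ?L)"
  have L: "card ?L \<le> 4" by (simp add: card_insert_if)
  have finS: "finite S" using T(1) by (simp add: S_def)
  have "card S \<le> card (T \<times> ?L)" unfolding S_def by (rule card_image_le) (use T(1) in simp)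
  also have "\<dots> \<le> n * 4" unfolding card_cartesian_product T(3) by (rule mult_le_mono2[OF L])
  finally have cS: "card S \<le> 4 * n" by simp
  have kS: "k \<tau> e \<in> S" if "\<tau> \<in> T" for \<tau> e
    unfolding S_def using that letter_cases[of e] by (intro image_eqI[of _ _ "(\<tau>, e)"]) auto
  have SK: "K u" if u: "u \<in> S" for u
  proof -
    obtain \<tau> e where "u = k \<tau> e" using u by (auto simp: S_def)
    then show ?thesis using nxt[of "\<tau> @ [e]"] by (simp add: k_def K.cong_def)
  qed
  have Slen: "length u \<le> 2 * l + 1" if u: "u \<in> S" for u
  proof -
    obtain \<tau> e where "\<tau> \<in> T" "u = k \<tau> e" using u by (auto simp: S_def)
    then show ?thesis
      using T(4)[of \<tau>] T(4)[of "nxt (\<tau> @ [e])"] nxt[of "\<tau> @ [e]"] by (simp add: k_def)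
  qed
  \<comment> \<open>\<open>W0\<close> defines the central extension and is common to all
    \<open>f\<close>; only the q identifications in \<open>W f\<close> depend on \<open>f\<close>.
    The count 64 n^2 + 4 n + q + 3 comes from at most 4 n Schreier generators, 4 letters, the
    identifications and the three relators for padding.\<close>
  define W0 where "W0 = (\<lambda>((u, v), e). comm (comm u v) [e]) ` ((S \<times> S) \<times> ?L) \<union> pow5 ` S"
  define W where "W f = W0 \<union> (\<lambda>i. x i @ winv (x (q + f i))) ` {..<q}" for f :: "nat \<Rightarrow> nat"
  define F where "F = {..<q} \<rightarrow>\<^sub>E {..<q}"
  have F: "q + f i < 2 * q" if "f \<in> F" "i < q" for f i
    using that by (auto simp: F_def PiE_def Pi_def)
  have finW: "finite (W f)" for f
    using finS by (auto simp: W_def W0_def)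
  have cW: "card (W f) + 3 \<le> nat \<lfloor>2 powr (real t * \<epsilon>)\<rfloor>" for f
  proof -
    have "card ((\<lambda>((u, v), e). comm (comm u v) [e]) ` ((S \<times> S) \<times> ?L)) \<le> card ((S \<times> S) \<times> ?L)"
      by (rule card_image_le) (use finS in simp)
    also have "\<dots> \<le> ((4 * n) * (4 * n)) * 4"
      unfolding card_cartesian_product by (intro mult_le_mono cS L)
    finally have 1: "card ((\<lambda>((u, v), e). comm (comm u v) [e]) ` ((S \<times> S) \<times> ?L)) \<le> 64 * n ^ 2"
      by (simp add: power2_eq_square)
    have 2: "card (pow5 ` S) \<le> 4 * n" using card_image_le[OF finS, of pow5] cS by simp
    have 3: "card ((\<lambda>i. x i @ winv (x (q + f i))) ` {..<q}) \<le> q"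
      using card_image_le[of "{..<q}" "\<lambda>i. x i @ winv (x (q + f i))"] by simp
    show ?thesis
      using 1 2 3 m card_Un_le[of "(\<lambda>((u, v), e). comm (comm u v) [e]) ` ((S \<times> S) \<times> ?L)" "pow5 ` S"]
        card_Un_le[of W0 "(\<lambda>i. x i @ winv (x (q + f i))) ` {..<q}"]
      unfolding W_def W0_def by linarith
  qed
  have WK: "K v" if "f \<in> F" "v \<in> W f" for f v
    using that SK x(1) F
    by (auto simp: W_def W0_def pow5_def K.K_winv intro!: K.K_append K.K_comm' K.K_comm)
  have Wlen: "length v + 2 * N + 2 \<le> t" if f: "f \<in> F" and v: "v \<in> W f" for f v
  proof -
    consider u u' e where "u \<in> S" "u' \<in> S" "v = comm (comm u u') [e]" | u where "u \<in> S" "v = pow5 u"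
      | i where "i < q" "v = x i @ winv (x (q + f i))"
      using v by (auto simp: W_def W0_def)
    then show ?thesis
    proof cases
      case 1
      then show ?thesis using Slen[of u] Slen[of u'] len by simp
    next
      case 2
      then show ?thesis using Slen[of u] len by (simp add: pow5_def)
    next
      case 3
      then show ?thesis using x(2)[of i] x(2)[of "q + f i"] F[OF f] len by simp
    qed
  qed
  define good where "good f rs \<longleftrightarrow> (length rs = nat \<lfloor>2 powr (real t * \<epsilon>)\<rfloor> \<and>
     (\<forall>r\<in>set rs. r \<in> lists A \<and> cyclically_reduced r \<and> length r = 2 * t)) \<and>
     (\<forall>K. normal_words K \<longrightarrow> (\<forall>r\<in>set rs. K r) = (K (xpow N) \<and> (\<forall>v\<in>W f. K v)))" for f rs
  have "\<exists>rs. good f rs" if f: "f \<in> F" for f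
    unfolding good_def conj_assoc
    by (rule padded_relators[OF finW cW N1 K WK[OF f] Wlen[OF f] len(2)]) (use par WK[OF f] in auto)
  then obtain R where R: "\<And>f. f \<in> F \<Longrightarrow> good f (R f)" by metis
  have R_iff: "(\<forall>r\<in>set (R f). Q r) = (Q (xpow N) \<and> (\<forall>v\<in>W f. Q v))" if "f \<in> F" "normal_words Q" for f Q
    using R[OF that(1)] that(2) unfolding good_def by blast
  have RW: "trivial_in (R f) v" if "f \<in> F" "v \<in> W f" for f v
    using R_iff[OF that(1) normal_words_trivial_in[of "R f"]] trivial_in_relator that(2) by metis
  have "card F \<le> J \<epsilon> t * (n * 5 ^ (4 * n)) ^ 2"
  proof (rule J_lower_bound[where R = R])
    show "finite F" by (simp add: F_def finite_PiE)
    show "length (R f) = nat \<lfloor>2 powr (real t * \<epsilon>)\<rfloor> \<and>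
      (\<forall>r\<in>set (R f). r \<in> lists A \<and> cyclically_reduced r \<and> length r = 2 * t)" if "f \<in> F" for f
      using R[OF that] unfolding good_def by (rule conjunct1)
    show "group.almost_central (M_quotient (R f)) (n * 5 ^ (4 * n))" if f: "f \<in> F" for f
    proof -
      have "group.almost_central (M_quotient (R f)) (card T * 5 ^ card S)"
      proof (rule almost_central_M_quotient[OF T(1,2) finS])
        fix \<tau> e assume \<tau>: "\<tau> \<in> T"
        have "trivial_in (R f) ((\<tau> @ [e]) @ winv (k \<tau> e @ nxt (\<tau> @ [e])))"
          using normal_words.K_cancel(2)[OF normal_words_trivial_in, of "R f" "\<tau> @ [e]" "nxt (\<tau> @ [e])" "winv (\<tau> @ [e])"]
            normal_words.K_cancel(1)[OF normal_words_trivial_in, of "R f" "\<tau> @ [e]" "winv (nxt (\<tau> @ [e]))"]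
            normal_words.K_winv_right[OF normal_words_trivial_in, of "R f" "\<tau> @ [e]"]
          by (simp add: k_def)
        then show "\<exists>k\<in>S. \<exists>\<tau>'\<in>T. trivial_in (R f) ((\<tau> @ [e]) @ winv (k @ \<tau>'))"
          using kS[OF \<tau>, of e] nxt[of "\<tau> @ [e]"] by (intro bexI[of _ "k \<tau> e"] bexI[of _ "nxt (\<tau> @ [e])"]) simp_all
      next
        fix u assume "u \<in> S"
        then have "pow5 u \<in> W f" by (auto simp: W_def W0_def)
        from RW[OF f this] show "trivial_in (R f) (u @ u @ u @ u @ u)" by (simp add: pow5_def)
      next
        fix u v e assume "u \<in> S" "v \<in> S"
        then have "((u, v), e) \<in> (S \<times> S) \<times> ?L" using letter_cases[of e] by auto
        then have "comm (comm u v) [e] \<in> W f" unfolding W_def W0_def by force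
        from RW[OF f this] show "trivial_in (R f) (comm (comm u v) [e])" .
      qed
      moreover have "card T * 5 ^ card S \<le> n * 5 ^ (4 * n)"
        using cS by (simp add: T(3) power_increasing)
      ultimately show ?thesis using group.almost_central_mono[OF group_M_quotient] by blast
    qed
    fix f f' assume f: "f \<in> F" "f' \<in> F" and eq: "trivial_in (R f) = trivial_in (R f')"
    show "f = f'"
    proof (rule ccontr)
      assume "f \<noteq> f'"
      then obtain i where i: "i < q" "f i \<noteq> f' i"
        using f unfolding F_def by (metis PiE_ext lessThan_iff)
      \<comment> \<open>\<open>\<mu>\<close> is 1 exactly on the commutators that the relators of f'
        identify with the one of index q + f'(i). So it is compatible with f', but takes different
        values at i and at q + f(i).\<close>
      define \<mu> :: "nat \<Rightarrow> int" where
        "\<mu> j = (if j < q then of_bool (f' j = f' i) else of_bool (j = q + f' i))" for j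
      obtain Q where Q0: "central_values K (2 * q) x \<mu> Q" using heis by blast
      \<comment> \<open>As \<open>N = 5 * N0\<close>, the padding power is a fifth power of an
        element of \<open>K\<close>, hence trivial in every such group.\<close>
      then have Q: "normal_words Q" "Q (xpow N)" "\<And>k. K k \<Longrightarrow> Q (pow5 k)"
        "\<And>k k' l. K k \<Longrightarrow> K k' \<Longrightarrow> Q (comm (comm k k') [l])"
        "\<And>i j. i < 2 * q \<Longrightarrow> j < 2 * q \<Longrightarrow> Q (x i @ winv (x j)) \<longleftrightarrow> \<mu> i mod 5 = \<mu> j mod 5"
        using N(3) xpow_pow5 unfolding central_values_def N(1) by auto
      have "Q v" if v: "v \<in> W f'" for v
      proof -
        consider "v \<in> W0" | j where "j < q" "v = x j @ winv (x (q + f' j))" using v by (auto simp: W_def)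
        then show ?thesis
        proof cases
          case 1
          then consider u u' e where "u \<in> S" "u' \<in> S" "v = comm (comm u u') [e]" | u where "u \<in> S" "v = pow5 u"
            by (auto simp: W0_def)
          then show ?thesis by cases (use Q(3,4) SK in simp_all)
        next
          case 2
          then show ?thesis using Q(5)[of j "q + f' j"] F[OF f(2)] by (simp add: \<mu>_def)
        qed
      qed
      then have "Q r" if "r \<in> set (R f')" for r using R_iff[OF f(2) Q(1)] Q(2) that by metis
      moreover have "x i @ winv (x (q + f i)) \<in> W f" using i by (auto simp: W_def)
      ultimately have "Q (x i @ winv (x (q + f i)))"
        using RW[OF f(1)] eq trivial_in_least[OF Q(1)] by metis
      then show False using Q(5)[of i "q + f i"] F[OF f(1) i(1)] i by (simp add: \<mu>_def)
    qed
  qed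
  moreover have "card F = q ^ q" by (simp add: F_def card_PiE)
  ultimately show ?thesis by simp
qed

section \<open>Heisenberg groups\<close>

text \<open>An equivalence \<open>r\<close> in place of equality covers actions considered modulo 5
  or modulo k.\<close>

lemma normal_words_action:
  assumes closed: "\<And>l s. s \<in> St \<Longrightarrow> act l s \<in> St"
    and r: "\<And>s. r s s" "\<And>s s'. r s s' \<Longrightarrow> r s' s" "\<And>s s' s''. r s s' \<Longrightarrow> r s' s'' \<Longrightarrow> r s s''"
    and resp: "\<And>l s s'. s \<in> St \<Longrightarrow> s' \<in> St \<Longrightarrow> r s s' \<Longrightarrow> r (act l s) (act l s')"
    and rel: "\<And>l s. s \<in> St \<Longrightarrow> r (act l (act (linv l) s)) s" "\<And>s. s \<in> St \<Longrightarrow> r (act la (act la s)) s"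
      "\<And>s. s \<in> St \<Longrightarrow> r (act lb (act lb (act lb s))) s"
  shows "normal_words (\<lambda>w. \<forall>s\<in>St. r (foldr act w s) s)"
proof
  have closed': "foldr act w s \<in> St" if "s \<in> St" for w s
    using that by (induction w) (auto intro: closed)
  have resp': "r (foldr act w s) (foldr act w s')" if "s \<in> St" "s' \<in> St" "r s s'" for w s s'
    using that(3) by (induction w) (auto intro!: resp closed' that)
  fix p v q assume v: "\<forall>s\<in>St. r (foldr act v s) s"
  have "r (foldr act (p @ v @ q) s) (foldr act (p @ q) s)" if "s \<in> St" for s
    using resp'[of "foldr act v (foldr act q s)" "foldr act q s" p] closed' that v by simp
  then show "(\<forall>s\<in>St. r (foldr act (p @ v @ q) s) s) = (\<forall>s\<in>St. r (foldr act (p @ q) s) s)"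
    using r(2,3) by meson
qed (use rel r(1) in auto)

text \<open>For a prefix \<open>g\<close> of \<open>w\<close> that is followed by the letter \<open>a\<close>, \<open>psi f w x\<close> collects the value
  \<open>f (g\<^sup>-\<^sup>1 x)\<close> and \<open>pint f w\<close> collects \<open>f g\<close>. So \<open>psi f\<close> is the derivation with value \<open>f\<close> at \<open>a\<close> and \<open>0\<close> at \<open>b\<close>.\<close>

primrec psi :: "(word \<Rightarrow> int) \<Rightarrow> word \<Rightarrow> word \<Rightarrow> int" where
  "psi f [] x = 0"
| "psi f (l # w) x = (if fst l = Gen_a then f x else 0) + psi f w (linv l # x)"

primrec pint :: "(word \<Rightarrow> int) \<Rightarrow> word \<Rightarrow> int" where
  "pint f [] = 0"
| "pint f (l # w) = (if fst l = Gen_a then f [] else 0) + pint (\<lambda>x. f (l # x)) w"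

lemma psi_append: "psi f (u @ v) x = psi f u x + psi f v (winv u @ x)"
  by (induction u arbitrary: x) auto

lemma pint_append: "pint f (u @ v) = pint f u + pint (\<lambda>x. f (u @ x)) v"
  by (induction u arbitrary: f) auto

lemma pint_add: "pint (\<lambda>x. f x + g x) w = pint f w + pint g w"
  by (induction w arbitrary: f g) auto

lemma pint_scale: "pint (\<lambda>x. c * f x) w = c * pint f w"
  by (induction w arbitrary: f) (auto simp: distrib_left)

lemma psi_apow: "psi f (apow e k) x = (\<Sum>i<k. f (winv (apow e i) @ x))"
proof (induction k)
  case (Suc k)
  have "psi f (apow e (Suc k)) x = psi f (apow e k) x + psi f (apow e 1) (winv (apow e k) @ x)"
    using apow_add[of e k 1] psi_append by simp
  then show ?case using Suc by (simp add: apow_simps)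
qed (simp add: apow_simps)

lemma pint_xpow: "pint f (xpow k) = (\<Sum>i<k. f (xpow i))"
proof (induction k)
  case (Suc k)
  have "pint f (xpow (Suc k)) = pint f (xpow k) + pint (\<lambda>x. f (xpow k @ x)) (xpow 1)"
    using apow_add[of True k 1] pint_append by simp
  then show ?case using Suc by (simp add: apow_simps)
qed (simp add: apow_simps)

context normal_words
begin

definition invar :: "(word \<Rightarrow> int) \<Rightarrow> bool" where
  "invar f \<longleftrightarrow> (\<forall>x y. cong x y \<longrightarrow> f x = f y)"

lemma invarD: "invar f \<Longrightarrow> cong x y \<Longrightarrow> f x = f y"
  by (simp add: invar_def)

lemma cong_la_la: "cong (la # la # x) x" "cong (linv la # x) (la # x)" "cong (x @ [linv la]) (x @ [la])"
  using cong_del[OF K_aa, of "[]" x] cong_ctxt[OF cong_la, of "[]" x] cong_ctxt[OF cong_la, of x "[]"]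
  by simp_all

lemma Gen_a_cases: "fst l = Gen_a \<Longrightarrow> l = la \<or> l = linv la"
  using letter_cases[of l] by auto

lemma invar_a:
  assumes "invar f" "fst l = Gen_a"
  shows "f (l # x) = f (la # x)" "f (x @ [l]) = f (x @ [la])"
  using Gen_a_cases[OF assms(2)] invarD[OF assms(1)] cong_la_la by auto

lemma psi_cong: "invar f \<Longrightarrow> cong x y \<Longrightarrow> psi f w x = psi f w y"
proof (induction w arbitrary: x y)
  case (Cons l w)
  have "cong (linv l # x) (linv l # y)" using cong_ctxt[OF Cons.prems(2), of "[linv l]" "[]"] by simp
  then show ?case using Cons.IH[OF Cons.prems(1)] invarD[OF Cons.prems] by simp
qed simp

text \<open>A derivation with value f at a is compatible with a^2 = 1 only if f(x) + f(a x) = 0.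
  This is the origin of the sign conditions on all coefficient functions.\<close>

lemma psi_cancel:
  assumes f: "invar f" "\<And>x. f (la # x) = - f x"
  shows "psi f (u @ winv u) x = 0"
proof (induction u arbitrary: x)
  case (Cons l u)
  have "psi f ((l # u) @ winv (l # u)) x =
      (if fst l = Gen_a then f x else 0) + psi f (u @ winv u) (linv l # x) +
      psi f [linv l] (winv (u @ winv u) @ linv l # x)"
    using psi_append[of f "u @ winv u" "[linv l]" "linv l # x"] by simp
  moreover have "psi f [linv l] (winv (u @ winv u) @ linv l # x) = psi f [linv l] (linv l # x)"
    using cong_cancel(1)[of "[]" u "linv l # x"] by (intro psi_cong f) simp
  ultimately show ?case
    using Cons invar_a(1)[OF f(1), of "linv l" x] f(2) by simp
qed simp

lemma invar_psi: "invar f \<Longrightarrow> invar (psi f w)"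
  using psi_cong by (auto simp: invar_def)

lemma psi_right: "(\<And>x. f (x @ [la]) = - f x) \<Longrightarrow> psi f w (x @ [la]) = - psi f w x"
proof (induction w arbitrary: x)
  case (Cons l w)
  then show ?case using Cons.IH[of "linv l # x"] by simp
qed simp

text \<open>The contributions of \<open>h\<close> and \<open>winv h\<close> cancel because
  \<open>w\<close> does not move the argument. Thus conjugation becomes translation.\<close>

lemma psi_conj:
  assumes f: "invar f" "\<And>x. f (la # x) = - f x" and w: "K w"
  shows "psi f (h @ w @ winv h) x = psi f w (winv h @ x)"
proof -
  have "cong (winv (h @ w) @ x) (winv h @ x)"
    using cong_del[of "winv w" "[]" "winv h @ x"] K_winv w by simp
  then have "psi f (winv h) (winv (h @ w) @ x) = psi f (winv h) (winv h @ x)"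
    by (rule psi_cong[OF f(1)])
  then have "psi f (h @ w @ winv h) x = psi f w (winv h @ x) + psi f (h @ winv h) x"
    by (simp add: psi_append)
  then show ?thesis using psi_cancel[OF f] by simp
qed

lemma psi_diff:
  assumes f: "invar f" "\<And>x. f (la # x) = - f x" and uv: "cong u v"
  shows "psi f (u @ winv v) x = psi f u x - psi f v x"
proof -
  have "cong (winv u @ x) (winv v @ x)" using cong_ctxt[OF cong_winv[OF uv], of "[]" x] by simp
  then have "psi f (winv v) (winv u @ x) = psi f (winv v) (winv v @ x)" by (rule psi_cong[OF f(1)])
  then show ?thesis using psi_cancel[OF f, of v x] by (simp add: psi_append)
qed

lemma pint_cancel:
  assumes f: "invar f" "\<And>x. f (x @ [la]) = - f x"
  shows "pint (\<lambda>x. f (p @ x)) (u @ winv u) = 0"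
proof (induction u arbitrary: p)
  case (Cons l u)
  have "pint (\<lambda>x. f (p @ x)) ((l # u) @ winv (l # u)) =
      (if fst l = Gen_a then f p else 0) + pint (\<lambda>x. f ((p @ [l]) @ x)) (u @ winv u) +
      (if fst l = Gen_a then f (p @ [l] @ u @ winv u) else 0)"
    using pint_append[of "\<lambda>x. f (p @ l # x)" "u @ winv u" "[linv l]"] by simp
  moreover have "f (p @ [l] @ u @ winv u) = f (p @ [l])"
    using invarD[OF f(1) cong_del[OF K_winv_right[of u], of "p @ [l]" "[]"]] by simp
  ultimately show ?case
    using Cons[of "p @ [l]"] invar_a(2)[OF f(1), of l p] f(2) by simp
qed simp

lemma pint_conj:
  assumes f: "invar f" "\<And>x. f (x @ [la]) = - f x" and w: "K w"
  shows "pint f (h @ w @ winv h) = pint (\<lambda>x. f (h @ x)) w"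
proof -
  have "f (h @ w @ x) = f (h @ x)" for x
    using invarD[OF f(1) cong_del[OF w, of h x]] by simp
  then have "pint f (h @ w @ winv h) = pint (\<lambda>x. f (h @ x)) w + pint f (h @ winv h)"
    by (simp add: pint_append)
  then show ?thesis using pint_cancel[OF f, of "[]" h] by simp
qed

end

text \<open>The module of functions \<open>\<phi>\<close> is extended by a central coordinate \<open>c\<close>, which makes it a Heisenberg group;
  on words of \<open>K\<close> the group commutator becomes the alternating form \<open>symp\<close>.\<close>

fun hact :: "(word \<Rightarrow> int) \<Rightarrow> letter \<Rightarrow> (word \<Rightarrow> int) \<times> int \<Rightarrow> (word \<Rightarrow> int) \<times> int" where
  "hact \<kappa> l (\<phi>, c) =
     (if fst l = Gen_a then (\<lambda>x. \<kappa> x + \<phi> (la # x), c - \<phi> [la]) else (\<lambda>x. \<phi> (linv l # x), c))"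

fun heq :: "(word \<Rightarrow> int) \<times> int \<Rightarrow> (word \<Rightarrow> int) \<times> int \<Rightarrow> bool" where
  "heq (\<phi>, c) (\<phi>', c') \<longleftrightarrow> (\<forall>x. \<phi> x mod 5 = \<phi>' x mod 5) \<and> c mod 5 = c' mod 5"

definition symp :: "(word \<Rightarrow> int) \<Rightarrow> word \<Rightarrow> word \<Rightarrow> int" where
  "symp \<kappa> k k' = pint (psi \<kappa> k) k' - pint (psi \<kappa> k') k"

text \<open>\<open>kap_left\<close> makes a^2 act trivially on the functions,
  \<open>kap_right\<close> keeps the states inside \<open>St\<close>, and \<open>kap_Nil\<close>
  makes a^2 act trivially on the central coordinate.\<close>

locale heisenberg = normal_words +
  fixes \<kappa> :: "word \<Rightarrow> int"
  assumes kap: "invar \<kappa>" and kap_left: "\<kappa> (la # x) = - \<kappa> x" and kap_right: "\<kappa> (x @ [la]) = - \<kappa> x"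
    and kap_Nil: "\<kappa> [] = 0"
begin

definition St :: "((word \<Rightarrow> int) \<times> int) set" where
  "St = {(\<phi>, c). invar \<phi> \<and> (\<forall>x. \<phi> (x @ [la]) = - \<phi> x)}"

abbreviation hw :: "word \<Rightarrow> (word \<Rightarrow> int) \<times> int \<Rightarrow> (word \<Rightarrow> int) \<times> int" where
  "hw \<equiv> foldr (hact \<kappa>)"

lemma invar_Cons: "invar \<phi> \<Longrightarrow> invar (\<lambda>x. \<phi> (l # x))"
  unfolding invar_def using cong_ctxt[of _ _ "[l]" "[]"] by simp

lemma St_hact: "s \<in> St \<Longrightarrow> hact \<kappa> l s \<in> St"
proof -
  assume "s \<in> St"
  then obtain \<phi> c where s: "s = (\<phi>, c)" "invar \<phi>" "\<And>x. \<phi> (x @ [la]) = - \<phi> x" by (auto simp: St_def)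
  have "\<phi> (l' # x @ [la]) = - \<phi> (l' # x)" for l' x using s(3)[of "l' # x"] by simp
  moreover have "invar (\<lambda>x. \<kappa> x + \<phi> (la # x))"
    using invar_Cons[OF s(2), of la] kap by (simp add: invar_def)
  ultimately show ?thesis using s invar_Cons[OF s(2)] kap_right by (simp add: St_def)
qed

lemma hact_aa:
  assumes "s \<in> St" "fst l = Gen_a" "fst l' = Gen_a"
  shows "hact \<kappa> l (hact \<kappa> l' s) = s"
proof -
  obtain \<phi> c where s: "s = (\<phi>, c)" "invar \<phi>" "\<And>x. \<phi> (x @ [la]) = - \<phi> x"
    using assms(1) by (auto simp: St_def)
  show ?thesis
    using assms s kap_left kap_left[of "[]"] kap_Nil s(3)[of "[la]"] invarD[OF s(2) cong_la_la(1)] by simp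
qed

lemma hact_rel:
  assumes "s \<in> St"
  shows "hact \<kappa> l (hact \<kappa> (linv l) s) = s" "hact \<kappa> lb (hact \<kappa> lb (hact \<kappa> lb s)) = s"
proof -
  obtain \<phi> c where s: "s = (\<phi>, c)" "invar \<phi>" using assms by (auto simp: St_def)
  have "\<phi> (l # linv l # x) = \<phi> x" "\<phi> (lbi # lbi # lbi # x) = \<phi> x" for x
    using invarD[OF s(2) cong_del[OF K_pair, of "[]" l x]] invarD[OF s(2) cong_del[of "winv [lb, lb, lb]" "[]" x]]
      K_bbb K_winv[of "[lb, lb, lb]"] by simp_all
  then show "hact \<kappa> l (hact \<kappa> (linv l) s) = s" "hact \<kappa> lb (hact \<kappa> lb (hact \<kappa> lb s)) = s"
    using hact_aa[OF assms, of l "linv l"] s by (cases "fst l = Gen_a"; simp)+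
qed

definition HQ :: "word \<Rightarrow> bool" where
  "HQ w \<longleftrightarrow> (\<forall>s\<in>St. heq (hw w s) s)"

lemma normal_words_HQ: "normal_words HQ"
  unfolding HQ_def
proof (rule normal_words_action)
  show refl: "heq s s" for s by (cases s) simp
  show "heq s s' \<Longrightarrow> heq s' s" for s s' by (cases s; cases s') simp
  show "heq s s' \<Longrightarrow> heq s' s'' \<Longrightarrow> heq s s''" for s s' s'' by (cases s; cases s'; cases s'') simp
  show "heq (hact \<kappa> l s) (hact \<kappa> l s')" if "heq s s'" for l s s'
    using that by (cases s; cases s') (auto intro: mod_add_cong mod_diff_cong)
  fix s assume s: "s \<in> St"
  show "hact \<kappa> l s \<in> St" for l by (rule St_hact[OF s])
  show "heq (hact \<kappa> l (hact \<kappa> (linv l) s)) s" for l by (simp only: hact_rel[OF s] refl)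
  show "heq (hact \<kappa> lb (hact \<kappa> lb (hact \<kappa> lb s))) s" by (simp only: hact_rel[OF s] refl)
  show "heq (hact \<kappa> la (hact \<kappa> la s)) s" using hact_aa[OF s, of la la] refl by (simp del: hact.simps)
qed

text \<open>Over the integers the relations of \<open>M\<close> hold exactly on \<open>St\<close>.
  Commutators can therefore be computed with true inverses, and reduction modulo 5 enters only in
  \<open>HQ\<close>.\<close>

lemma normal_words_exact: "normal_words (\<lambda>w. \<forall>s\<in>St. hw w s = s)"
  by (rule normal_words_action) (use St_hact hact_rel hact_aa in auto)

lemma St_hw: "s \<in> St \<Longrightarrow> hw w s \<in> St"
  by (induction w) (auto intro: St_hact)

lemma hw_fst:
  assumes "(\<phi>, c) \<in> St"
  shows "fst (hw w (\<phi>, c)) x = psi \<kappa> w x + \<phi> (winv w @ x)"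
proof (induction w arbitrary: x)
  case (Cons l w)
  have inv: "invar \<phi>" using assms by (simp add: St_def)
  have "invar (\<lambda>x. psi \<kappa> w x + \<phi> (winv w @ x))"
    using St_hw[OF assms, of w] Cons by (auto simp: St_def invar_def)
  note * = invarD[OF this cong_la_la(2)]
  obtain \<psi> d where e: "hw w (\<phi>, c) = (\<psi>, d)" by (cases "hw w (\<phi>, c)")
  with Cons have \<psi>: "\<psi> x = psi \<kappa> w x + \<phi> (winv w @ x)" for x by simp
  show ?case
  proof (cases "fst l = Gen_a")
    case True
    then show ?thesis using e \<psi> * Gen_a_cases[OF True] by auto
  next
    case False
    then show ?thesis using e \<psi> by simp
  qed
qed simp

text \<open>The part of the central coordinate that depends on the word alone; it cancels in
  commutators.\<close>

primrec cocyc :: "word \<Rightarrow> int" where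
  "cocyc [] = 0"
| "cocyc (l # w) = cocyc w - (if fst l = Gen_a then psi \<kappa> w [la] else 0)"

primrec suffix_sum :: "(word \<Rightarrow> int) \<Rightarrow> word \<Rightarrow> int" where
  "suffix_sum \<phi> [] = 0"
| "suffix_sum \<phi> (l # w) = suffix_sum \<phi> w + (if fst l = Gen_a then \<phi> (winv w) else 0)"

lemma hw_snd:
  assumes "(\<phi>, c) \<in> St"
  shows "snd (hw w (\<phi>, c)) = c + cocyc w + suffix_sum \<phi> w"
proof (induction w)
  case (Cons l w)
  obtain \<psi> d where e: "hw w (\<phi>, c) = (\<psi>, d)" by (cases "hw w (\<phi>, c)")
  have "\<psi> [la] = psi \<kappa> w [la] - \<phi> (winv w)"
    using hw_fst[OF assms, of w "[la]"] e assms by (auto simp: St_def)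
  then show ?case using Cons e by simp
qed simp

text \<open>In a word of \<open>K\<close> the inverse of the suffix after \<open>l\<close> is
  congruent to the prefix ending with \<open>l\<close>. If \<open>l\<close> is a, removing it from
  the prefix gives the sign.\<close>

lemma suffix_sum_K:
  assumes \<phi>: "invar \<phi>" "\<And>x. \<phi> (x @ [la]) = - \<phi> x" and "K (p @ w)"
  shows "suffix_sum \<phi> w = - pint (\<lambda>x. \<phi> (p @ x)) w"
  using assms(3)
proof (induction w arbitrary: p)
  case (Cons l w)
  have "cong (p @ [l]) (winv w)" using Cons.prems by (simp add: cong_def)
  then have "\<phi> (winv w) = \<phi> (p @ [l])" using invarD[OF \<phi>(1)] by simp
  then show ?case
    using Cons.IH[of "p @ [l]"] Cons.prems invar_a(2)[OF \<phi>(1), of l p] \<phi>(2) by simp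
qed simp

text \<open>A word of \<open>K\<close> translates \<open>\<phi>\<close> and changes \<open>c\<close>
  by an affine function of \<open>\<phi>\<close>. Two such maps commute up to a shift of
  \<open>c\<close>, as in a Heisenberg group.\<close>

lemma hw_K:
  assumes s: "(\<phi>, c) \<in> St" and k: "K k"
  shows "hw k (\<phi>, c) = (\<lambda>x. psi \<kappa> k x + \<phi> x, c + cocyc k - pint \<phi> k)"
proof -
  have \<phi>: "invar \<phi>" "\<And>x. \<phi> (x @ [la]) = - \<phi> x" using s by (auto simp: St_def)
  have "\<phi> (winv k @ x) = \<phi> x" for x
    using invarD[OF \<phi>(1) cong_del[of "winv k" "[]" x]] K_winv k by simp
  then have "fst (hw k (\<phi>, c)) = (\<lambda>x. psi \<kappa> k x + \<phi> x)"
    using hw_fst[OF s, of k] by (intro ext) simp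
  moreover have "snd (hw k (\<phi>, c)) = c + cocyc k - pint \<phi> k"
    using hw_snd[OF s, of k] suffix_sum_K[OF \<phi>, of "[]" k] k by simp
  ultimately show ?thesis by (metis prod.collapse)
qed

lemma hw_KK:
  assumes s: "(\<phi>, c) \<in> St" and k: "K k" "K k'"
  shows "hw (k @ k') (\<phi>, c) = (\<lambda>x. psi \<kappa> k x + psi \<kappa> k' x + \<phi> x,
     c + cocyc k + cocyc k' - pint \<phi> k - pint \<phi> k' - pint (psi \<kappa> k') k)"
proof -
  have "(\<lambda>x. psi \<kappa> k' x + \<phi> x, c + cocyc k' - pint \<phi> k') \<in> St"
    using St_hw[OF s, of k'] hw_K[OF s k(2)] by simp
  from hw_K[OF this k(1)] show ?thesis
    by (simp add: hw_K[OF s k(2)] pint_add algebra_simps)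
qed

lemma hw_comm:
  assumes s: "(\<phi>, c) \<in> St" and k: "K k" "K k'"
  shows "hw (comm k k') (\<phi>, c) = (\<phi>, c + symp \<kappa> k k')"
proof -
  interpret E: normal_words "\<lambda>w. \<forall>s\<in>St. hw w s = s" by (rule normal_words_exact)
  \<comment> \<open>From the state that k' k maps to the given one, the commutator just compares k
    k' with k' k.\<close>
  obtain \<phi>' c' where s0: "hw (winv (k' @ k)) (\<phi>, c) = (\<phi>', c')" by (cases "hw (winv (k' @ k)) (\<phi>, c)")
  have s0': "(\<phi>', c') \<in> St" using St_hw[OF s] s0 by metis
  have "\<forall>s\<in>St. hw ((k' @ k) @ winv (k' @ k)) s = s" by (rule E.K_winv_right)
  then have "hw (k' @ k) (\<phi>', c') = (\<phi>, c)" using s s0 by (metis foldr_append comp_apply)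
  then have 1: "\<phi> = (\<lambda>x. psi \<kappa> k' x + psi \<kappa> k x + \<phi>' x)"
    "c = c' + cocyc k' + cocyc k - pint \<phi>' k' - pint \<phi>' k - pint (psi \<kappa> k) k'"
    unfolding hw_KK[OF s0' k(2,1)] by auto
  have "hw (comm k k') (\<phi>, c) = hw (k @ k') (\<phi>', c')"
    using s0 by (simp add: comm_def)
  also have "\<dots> = (\<phi>, c + symp \<kappa> k k')"
    unfolding hw_KK[OF s0' k] by (simp add: 1 symp_def algebra_simps)
  finally show ?thesis .
qed

lemma hw_comm_winv:
  assumes s: "(\<phi>, c) \<in> St" and k: "K k" "K k'"
  shows "hw (winv (comm k k')) (\<phi>, c) = (\<phi>, c - symp \<kappa> k k')"
proof -
  interpret E: normal_words "\<lambda>w. \<forall>s\<in>St. hw w s = s" by (rule normal_words_exact)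
  have s': "(\<phi>, c - symp \<kappa> k k') \<in> St" using s by (simp add: St_def)
  have "\<forall>s\<in>St. hw (winv (comm k k') @ comm k k') s = s" by (rule E.K_winv_left)
  then have "hw (winv (comm k k')) (hw (comm k k') (\<phi>, c - symp \<kappa> k k')) = (\<phi>, c - symp \<kappa> k k')"
    using s' by simp
  then show ?thesis by (simp add: hw_comm[OF s' k])
qed

text \<open>In the fifth power the pairing of \<open>k\<close> with itself occurs 0 + 1 + 2 + 3 + 4
  = 10 times, a multiple of 5, and every other term five times.\<close>

lemma HQ_pow5: "K k \<Longrightarrow> HQ (pow5 k)"
  unfolding HQ_def
proof
  fix s assume k: "K k" and "s \<in> St"
  then obtain \<phi> c where s: "s = (\<phi>, c)" "(\<phi>, c) \<in> St" by (cases s) auto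
  have step: "(\<lambda>x. psi \<kappa> k x + \<psi> x, d + cocyc k - pint \<psi> k) \<in> St" if "(\<psi>, d) \<in> St" for \<psi> d
    using St_hw[OF that, of k] hw_K[OF that k] by simp
  note s1 = step[OF s(2)] and e1 = hw_K[OF s(2) k]
  note s2 = step[OF s1] and e2 = hw_K[OF s1 k]
  note s3 = step[OF s2] and e3 = hw_K[OF s2 k]
  note s4 = step[OF s3] and e4 = hw_K[OF s3 k]
  note e5 = hw_K[OF s4 k]
  have "hw (pow5 k) (\<phi>, c) = (\<lambda>x. \<phi> x + 5 * psi \<kappa> k x,
      c + 5 * (cocyc k - pint \<phi> k - 2 * pint (psi \<kappa> k) k))"
    unfolding pow5_def foldr_append comp_apply e1 e2 e3 e4 e5
    by (simp add: pint_add pint_scale add.commute)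
  then show "heq (hw (pow5 k) s) s"
    by (simp only: s heq.simps mod_mult_self2 simp_thms)
qed

lemma HQ_central: "K k \<Longrightarrow> K k' \<Longrightarrow> HQ (comm (comm k k') [l])"
  unfolding HQ_def
proof
  fix s assume k: "K k" "K k'" and s: "s \<in> St"
  obtain \<phi> c where s1: "hact \<kappa> (linv l) s = (\<phi>, c)" by (cases "hact \<kappa> (linv l) s")
  then have s1': "(\<phi>, c) \<in> St" using St_hact[OF s] by metis
  let ?g = "symp \<kappa> k k'"
  obtain \<psi> d where e: "hact \<kappa> l (\<phi>, c) = (\<psi>, d)" by (cases "hact \<kappa> l (\<phi>, c)")
  then have e': "hact \<kappa> l (\<phi>, c - ?g) = (\<psi>, d - ?g)" by (auto split: if_splits)
  have sd: "s = (\<psi>, d)" using hact_rel(1)[OF s, of l] s1 e by simp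
  then have "(\<psi>, d - ?g) \<in> St" using s by (simp add: St_def)
  then have "hw (comm (comm k k') [l]) s = (\<psi>, d)"
    using s1 hw_comm_winv[OF s1' k] e' hw_comm[of \<psi> "d - ?g" k k'] k
    by (simp add: comm_def[of "comm k k'"])
  moreover have "heq s s" by (cases s) simp
  ultimately show "heq (hw (comm (comm k k') [l]) s) s" using sd by simp
qed

lemma HQ_comm_iff:
  assumes "K k" "K k'" "K h" "K h'"
  shows "HQ (comm k k' @ winv (comm h h')) \<longleftrightarrow> symp \<kappa> k k' mod 5 = symp \<kappa> h h' mod 5"
proof -
  have e: "hw (comm k k' @ winv (comm h h')) (\<phi>, c) = (\<phi>, c - symp \<kappa> h h' + symp \<kappa> k k')"
    if "(\<phi>, c) \<in> St" for \<phi> c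
    using hw_comm_winv[OF that assms(3,4)] hw_comm[of \<phi> "c - symp \<kappa> h h'" k k'] that assms
    by (simp add: St_def)
  have z: "(\<lambda>x. 0, 0) \<in> St" by (simp add: St_def invar_def)
  have m: "(c - b + a) mod 5 = c mod 5 \<longleftrightarrow> a mod 5 = b mod 5" for a b c :: int
    by (simp add: mod_eq_dvd_iff)
  show ?thesis
  proof
    assume "HQ (comm k k' @ winv (comm h h'))"
    then have "heq (hw (comm k k' @ winv (comm h h')) (\<lambda>x. 0, 0)) (\<lambda>x. 0, 0)"
      unfolding HQ_def by (rule bspec) (rule z)
    then show "symp \<kappa> k k' mod 5 = symp \<kappa> h h' mod 5"
      unfolding e[OF z] using m[of 0 "symp \<kappa> h h'" "symp \<kappa> k k'"] by simp
  next
    assume eq: "symp \<kappa> k k' mod 5 = symp \<kappa> h h' mod 5"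
    show "HQ (comm k k' @ winv (comm h h'))"
      unfolding HQ_def
    proof
      fix s assume "s \<in> St"
      moreover obtain \<phi> c where "s = (\<phi>, c)" by (cases s)
      ultimately show "heq (hw (comm k k' @ winv (comm h h')) s) s"
        using e[of \<phi> c] m[of c "symp \<kappa> h h'" "symp \<kappa> k k'"] eq by (simp del: foldr_append)
    qed
  qed
qed

end

section \<open>The finite quotients\<close>

context normal_words
begin

definition ends :: "word set" where
  "ends = {[], [la]}"

text \<open>The positions \<open>g\<^sup>-\<^sup>1 h g'\<close> for prefixes \<open>g\<close>, \<open>g'\<close> of \<open>xpow k\<close>, closed under multiplication by \<open>a\<close> on both sides.\<close>

definition spread :: "nat \<Rightarrow> word \<Rightarrow> word \<Rightarrow> bool" where
  "spread k h x \<longleftrightarrow> (\<exists>i<k. \<exists>j<k. \<exists>p\<in>ends. \<exists>p'\<in>ends. cong x (p @ winv (xpow i) @ h @ xpow j @ p'))"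

lemma spread_cong: "cong x y \<Longrightarrow> spread k h x = spread k h y"
  unfolding spread_def using cong_trans cong_sym by meson

lemma spread_left: "spread k h x \<Longrightarrow> spread k h (la # x)"
proof -
  assume "spread k h x"
  then obtain i j p p' where *: "i < k" "j < k" "p \<in> ends" "p' \<in> ends"
    "cong x (p @ winv (xpow i) @ h @ xpow j @ p')" unfolding spread_def by blast
  let ?y = "winv (xpow i) @ h @ xpow j @ p'"
  have c: "cong (la # x) (la # p @ ?y)" using cong_ctxt[OF *(5), of "[la]" "[]"] by simp
  from *(3) have "\<exists>p0\<in>ends. cong (la # p @ ?y) (p0 @ ?y)"
    using cong_la_la(1)[of ?y] cong_refl[of "la # ?y"] by (auto simp: ends_def)
  then show ?thesis using * cong_trans[OF c] unfolding spread_def by blast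
qed

lemma spread_right: "spread k h x \<Longrightarrow> spread k h (x @ [la])"
proof -
  assume "spread k h x"
  then obtain i j p p' where *: "i < k" "j < k" "p \<in> ends" "p' \<in> ends"
    "cong x (p @ winv (xpow i) @ h @ xpow j @ p')" unfolding spread_def by blast
  let ?y = "p @ winv (xpow i) @ h @ xpow j"
  have c: "cong (x @ [la]) (?y @ p' @ [la])" using cong_ctxt[OF *(5), of "[]" "[la]"] by simp
  have "cong (?y @ [la, la]) ?y" using cong_del[OF K_aa, of ?y "[]"] by simp
  with *(4) have "\<exists>p0\<in>ends. cong (?y @ p' @ [la]) (?y @ p0)"
    using cong_refl[of "?y @ [la]"] by (auto simp: ends_def)
  then obtain p0 where "p0 \<in> ends" "cong (x @ [la]) (?y @ p0)" using cong_trans[OF c] by blast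
  then show ?thesis using * unfolding spread_def by (metis append.assoc)
qed

lemma spread_la:
  "spread k h (la # x) = spread k h x" "spread k h (x @ [la]) = spread k h x"
proof -
  have "cong ((x @ [la]) @ [la]) x" using cong_del[OF K_aa, of x "[]"] by simp
  then show "spread k h (x @ [la]) = spread k h x"
    using spread_right spread_cong by blast
  show "spread k h (la # x) = spread k h x"
    using spread_left spread_cong[OF cong_la_la(1)] by blast
qed

lemma spread_mid: "i < k \<Longrightarrow> j < k \<Longrightarrow> spread k h (winv (xpow i) @ h @ xpow j)"
proof -
  assume ij: "i < k" "j < k"
  have "cong (winv (xpow i) @ h @ xpow j) ([] @ winv (xpow i) @ h @ xpow j @ [])" by simp
  with ij show ?thesis unfolding spread_def ends_def by blast
qed

text \<open>The form pairs w = (ab)^k with its conjugate by h by summing \<open>\<kappa>\<close>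
  over the positions g^-1 h g', where g and g' are prefixes of w. As the spreads are disjoint,
  \<open>\<kappa>1\<close> can be rescaled by \<open>\<mu> l\<close> around each \<open>h l\<close>
  separately, and as they are closed under a on both sides, the sign conditions survive. The
  opposite half of the form uses the positions of the inverse of h, where \<open>\<kappa>1\<close>
  vanishes.\<close>

theorem independent_commutators:
  fixes h :: "nat \<Rightarrow> word" and \<mu> :: "nat \<Rightarrow> int"
  assumes w: "K (xpow k)"
    and \<kappa>1: "invar \<kappa>1" "\<And>x. \<kappa>1 (la # x) = - \<kappa>1 x" "\<And>x. \<kappa>1 (x @ [la]) = - \<kappa>1 x" "\<kappa>1 [] = 0"
    and sum: "\<And>l. l < r \<Longrightarrow> (\<Sum>j<k. \<Sum>i<k. \<kappa>1 (winv (xpow i) @ h l @ xpow j)) = c"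
    and zero: "\<And>l i j. l < r \<Longrightarrow> i < k \<Longrightarrow> j < k \<Longrightarrow> \<kappa>1 (winv (xpow i) @ winv (h l) @ xpow j) = 0"
    and disj: "\<And>l l' x. l < r \<Longrightarrow> l' < r \<Longrightarrow> spread k (h l) x \<Longrightarrow> spread k (h l') x \<Longrightarrow> l = l'"
    and c: "c mod 5 = 1"
  defines "x \<equiv> \<lambda>i. comm (xpow k) (h i @ xpow k @ winv (h i))"
  shows "\<exists>Q. central_values K r x \<mu> Q"
proof -
  define \<kappa> where "\<kappa> y = (\<Sum>l<r. of_bool (spread k (h l) y) * \<mu> l * \<kappa>1 y)" for y
  interpret heisenberg K \<kappa>
  proof
    show "invar \<kappa>"
      unfolding invar_def \<kappa>_def using spread_cong invarD[OF \<kappa>1(1)] by (auto intro!: sum.cong)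
  qed (simp_all add: \<kappa>_def spread_la \<kappa>1 sum_negf)
  let ?w = "xpow k"
  have K: "K (h l @ ?w @ winv (h l))" for l using w by (simp add: K_conj)
  have val: "symp \<kappa> ?w (h l @ ?w @ winv (h l)) = \<mu> l * c" if l: "l < r" for l
  proof -
    have k1: "\<kappa> (winv (xpow i) @ h l @ xpow j) = \<mu> l * \<kappa>1 (winv (xpow i) @ h l @ xpow j)"
      if ij: "i < k" "j < k" for i j
    proof -
      have "spread k (h l') (winv (xpow i) @ h l @ xpow j) = (l' = l)" if "l' < r" for l'
        using disj[OF that l] spread_mid[OF ij] by blast
      then have "\<kappa> (winv (xpow i) @ h l @ xpow j) =
          (\<Sum>l'<r. if l' = l then \<mu> l * \<kappa>1 (winv (xpow i) @ h l @ xpow j) else 0)"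
        unfolding \<kappa>_def by (intro sum.cong) auto
      then show ?thesis using l by simp
    qed
    have k2: "\<kappa> (winv (xpow i) @ winv (h l) @ xpow j) = 0" if "i < k" "j < k" for i j
      using zero[OF l that] by (simp add: \<kappa>_def)
    have "pint (psi \<kappa> ?w) (h l @ ?w @ winv (h l)) = pint (\<lambda>y. psi \<kappa> ?w (h l @ y)) ?w"
      by (rule pint_conj[OF invar_psi[OF kap] psi_right[where f = \<kappa>, OF kap_right] w])
    also have "\<dots> = (\<Sum>j<k. \<Sum>i<k. \<kappa> (winv (xpow i) @ h l @ xpow j))"
      by (simp add: pint_xpow psi_apow)
    also have "\<dots> = \<mu> l * c"
      using sum[OF l] by (simp add: k1 flip: sum_distrib_left)
    finally have 1: "pint (psi \<kappa> ?w) (h l @ ?w @ winv (h l)) = \<mu> l * c" .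
    have "psi \<kappa> (h l @ ?w @ winv (h l)) = (\<lambda>y. psi \<kappa> ?w (winv (h l) @ y))"
      by (rule ext, rule psi_conj[OF kap kap_left w])
    then have "pint (psi \<kappa> (h l @ ?w @ winv (h l))) ?w = (\<Sum>j<k. \<Sum>i<k. \<kappa> (winv (xpow i) @ winv (h l) @ xpow j))"
      by (simp add: pint_xpow psi_apow)
    also have "\<dots> = 0" by (simp add: k2)
    finally show ?thesis using 1 by (simp add: symp_def)
  qed
  have "\<mu> i * c mod 5 = \<mu> i mod 5" for i
    using mod_mult_right_eq[of "\<mu> i" c 5] c by simp
  then have "HQ (x i @ winv (x j)) \<longleftrightarrow> \<mu> i mod 5 = \<mu> j mod 5" if "i < r" "j < r" for i j
    unfolding x_def HQ_comm_iff[OF w K w K] using val that by simp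
  then show ?thesis
    using normal_words_HQ HQ_pow5 HQ_central unfolding central_values_def by (intro exI[of _ HQ]) blast
qed

end

lemma normal_words_conj:
  assumes "normal_words K" "normal_words K'"
  shows "normal_words (\<lambda>w. K w \<and> K' w)"
proof -
  interpret K: normal_words K by fact
  interpret K': normal_words K' by fact
  show ?thesis
    by unfold_locales (auto simp: K.K_insert K'.K_insert K.K_aa K'.K_aa K.K_bbb K'.K_bbb)
qed

text \<open>The lamplighter construction: lamps \<open>d\<close> with values in \<open>Z/2\<close> at the positions modulo \<open>K\<close>.\<close>

lemma (in normal_words) normal_words_lamps:
  assumes d: "invar d" "\<And>x. d (la # x) = - d x"
  shows "normal_words (\<lambda>w. K w \<and> (\<forall>x. even (psi d w x)))"
proof
  fix p v q assume v: "K v \<and> (\<forall>x. even (psi d v x))"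
  have "psi d q (winv v @ winv p @ x) = psi d q (winv p @ x)" for x
    using v cong_del[of "winv v" "[]" "winv p @ x"] K_winv by (intro psi_cong[OF d(1)]) simp
  then have "even (psi d (p @ v @ q) x) = even (psi d (p @ q) x)" for x
    using v by (simp add: psi_append)
  then show "(K (p @ v @ q) \<and> (\<forall>x. even (psi d (p @ v @ q) x))) = (K (p @ q) \<and> (\<forall>x. even (psi d (p @ q) x)))"
    using K_insert v by simp
next
  show "K [l, linv l] \<and> (\<forall>x. even (psi d [l, linv l] x))" for l
    using psi_cancel[OF d, of "[l]"] by simp
  have "d (linv la # x) = - d x" for x using invar_a(1)[OF d(1), of "linv la" x] d(2) by simp
  then show "K [la, la] \<and> (\<forall>x. even (psi d [la, la] x))" using K_aa by simp
qed (use K_bbb in auto)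

text \<open>So squares of elements of \<open>K\<close> switch no lamp on; this is the hypothesis of
  \<open>short_representatives\<close>.\<close>

lemma (in normal_words) psi_double: "invar d \<Longrightarrow> K u \<Longrightarrow> even (psi d (u @ u) x)"
  using psi_cong[of d "winv u @ x" x u] cong_del[of "winv u" "[]" x] K_winv
  by (simp add: psi_append)

subsection \<open>A permutation action with labels\<close>

text \<open>Here ab is i + 1 modulo 13. The generators a and b have 7 and 5 cycles, and ab has one,
  so the surface of this action has genus 1 by 7 + 5 + 1 - 13 = 0. Hence a point stabiliser has
  homomorphisms onto Z that vanish on (ab)^13.\<close>

definition pa :: "nat \<Rightarrow> nat" where
  "pa i = (if i < 13 then [0,4,7,8,1,12,9,2,3,6,11,10,5] ! i else i)"

definition pb :: "nat \<Rightarrow> nat" where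
  "pb i = (if i < 13 then [4,7,8,1,12,9,2,3,6,11,10,5,0] ! i else i)"

definition pbi :: "nat \<Rightarrow> nat" where
  "pbi i = (if i < 13 then [12,3,6,7,0,11,8,1,2,5,10,9,4] ! i else i)"

text \<open>One such homomorphism, spread over the points: a exchanges 1 and 4 with opposite labels,
  as a^2 = 1 demands, and b adds nothing.\<close>

definition lab :: "nat \<Rightarrow> int" where
  "lab i = (if i = 1 then 1 else if i = 4 then - 1 else 0)"

fun lact :: "letter \<Rightarrow> int \<times> nat \<Rightarrow> int \<times> nat" where
  "lact l (c, i) = (if fst l = Gen_a then (c + lab i, pa i) else (c, if snd l then pb i else pbi i))"

lemma perm_table:
  "\<forall>i\<in>set [0..<13]. pa i < 13 \<and> pb i < 13 \<and> pbi i < 13 \<and> pa (pa i) = i \<and> pb (pbi i) = i \<and>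
     pbi (pb i) = i \<and> pb (pb (pb i)) = i \<and> lab (pa i) = - lab i"
  by code_simp

lemma perm_less: "i < 13 \<Longrightarrow> pa i < 13" "i < 13 \<Longrightarrow> pb i < 13" "i < 13 \<Longrightarrow> pbi i < 13"
  using perm_table by auto

lemma perm_rel:
  "i < 13 \<Longrightarrow> pa (pa i) = i" "i < 13 \<Longrightarrow> pb (pbi i) = i" "i < 13 \<Longrightarrow> pbi (pb i) = i"
  "i < 13 \<Longrightarrow> pb (pb (pb i)) = i" "i < 13 \<Longrightarrow> lab (pa i) = - lab i"
  using perm_table by auto

lemma la_lb_parts: "la = (Gen_a, True)" "lb = (Gen_b, True)" "lbi = (Gen_b, False)"
  by (simp_all add: la_def lb_def lbi_def)

abbreviation lw :: "word \<Rightarrow> int \<times> nat \<Rightarrow> int \<times> nat" where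
  "lw \<equiv> foldr lact"

definition states :: "(int \<times> nat) set" where
  "states = UNIV \<times> {..<13}"

lemma lact_states: "s \<in> states \<Longrightarrow> lact l s \<in> states"
  by (cases s) (auto simp: states_def perm_less)

lemma lw_states: "s \<in> states \<Longrightarrow> lw w s \<in> states"
  by (induction w) (auto intro: lact_states)

lemma lact_rel:
  assumes "s \<in> states"
  shows "lact l (lact (linv l) s) = s" "lact la (lact la s) = s" "lact lb (lact lb (lact lb s)) = s"
  using assms
  by (auto simp: states_def perm_rel perm_less linv_def la_lb_parts)

lemma lact_add: "lact l (c + d, i) = (fst (lact l (c, i)) + d, snd (lact l (c, i)))"
  by simp

lemma lw_add: "lw w (c + d, i) = (fst (lw w (c, i)) + d, snd (lw w (c, i)))"
proof (induction w)
  case (Cons l w)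
  then show ?case using lact_add[of l "fst (lw w (c, i))" d "snd (lw w (c, i))"] by simp
qed simp

lemma snd_lw: "snd (lw w (c, p)) = snd (lw w (0, p))"
  using lw_add[of w 0 c p] by simp

lemma snd_lw_less: "p < 13 \<Longrightarrow> snd (lw w (c, p)) < 13"
  using lw_states[of "(c, p)" w] by (simp add: states_def mem_Times_iff)

definition leq :: "int \<Rightarrow> int \<times> nat \<Rightarrow> int \<times> nat \<Rightarrow> bool" where
  "leq k s s' \<longleftrightarrow> fst s mod k = fst s' mod k \<and> snd s = snd s'"

text \<open>\<open>KB 1\<close> sees only the permutations, while \<open>KB 0\<close> has integer
  labels and thus describes the action exactly.\<close>

definition KB :: "int \<Rightarrow> word \<Rightarrow> bool" where
  "KB k w \<longleftrightarrow> (\<forall>s\<in>states. leq k (lw w s) s)"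

lemma leq_lact: "leq k s s' \<Longrightarrow> leq k (lact l s) (lact l s')"
  by (cases s; cases s') (auto simp: leq_def intro: mod_add_cong)

lemma leq_lw: "leq k s s' \<Longrightarrow> leq k (lw w s) (lw w s')"
  by (induction w) (auto intro: leq_lact)

lemma normal_words_KB: "normal_words (KB k)"
  unfolding KB_def
proof (rule normal_words_action)
  show "leq k (lact l s) (lact l s')" if "leq k s s'" for l s s'
    by (rule leq_lact[OF that])
  show "lact l s \<in> states" if "s \<in> states" for l s using that by (rule lact_states)
  show "leq k (lact l (lact (linv l) s)) s" "leq k (lact la (lact la s)) s"
    "leq k (lact lb (lact lb (lact lb s))) s" if "s \<in> states" for l s
    using lact_rel[OF that] by (simp_all only:) (simp_all add: leq_def)
qed (auto simp: leq_def)

primrec bexp :: "word \<Rightarrow> int" where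
  "bexp [] = 0"
| "bexp (l # w) = (if fst l = Gen_a then 0 else if snd l then 1 else - 1) + bexp w"

lemma bexp_append [simp]: "bexp (u @ v) = bexp u + bexp v"
  by (induction u) auto

lemma bexp_winv [simp]: "bexp (winv u) = - bexp u"
  by (induction u) (auto simp: linv_def)

lemma normal_words_bexp: "normal_words (\<lambda>w. bexp w mod 3 = 0)"
proof
  fix p v q assume "bexp v mod 3 = 0"
  then have "(bexp v + bexp (p @ q)) mod 3 = bexp (p @ q) mod 3"
    by (metis add_0 mod_add_left_eq)
  then show "(bexp (p @ v @ q) mod 3 = 0) = (bexp (p @ q) mod 3 = 0)"
    by (simp add: add.left_commute)
qed (auto simp: linv_def la_lb_parts)

definition K1 :: "int \<Rightarrow> word \<Rightarrow> bool" where
  "K1 k w \<longleftrightarrow> KB k w \<and> bexp w mod 3 = 0"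

lemma normal_words_K1: "normal_words (K1 k)"
  unfolding K1_def by (rule normal_words_conj[OF normal_words_KB normal_words_bexp])

text \<open>A lamp has values in the nontrivial irreducible module \<open>F\<^sub>4\<close> of \<open>Z/3\<close>, realised as the vectors of \<open>F\<^sub>2\<^sup>3\<close> with
  coordinate sum 0. This makes \<open>(ab)\<^sup>3\<^sup>9\<close>, a word with an odd number of letters \<open>a\<close>, trivial.
  The values are taken in \<open>{-1, 0, 1}\<close>, with the sign making \<open>lamp k (a x) = - lamp k x\<close> exact.\<close>

definition lamp :: "int \<Rightarrow> word \<Rightarrow> int" where
  "lamp k x = (if bexp x mod 3 = 2 then 0 else of_bool (KB k x) - of_bool (KB k (la # x)))"

definition K2 :: "int \<Rightarrow> word \<Rightarrow> bool" where
  "K2 k w \<longleftrightarrow> K1 k w \<and> (\<forall>x. even (psi (lamp k) w x))"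

definition K3 :: "bool \<Rightarrow> int \<Rightarrow> word \<Rightarrow> bool" where
  "K3 ev k w \<longleftrightarrow> K2 k w \<and> (ev \<longrightarrow> even (count_a w))"

lemma invar_lamp: "normal_words.invar (K1 k) (lamp k)"
proof -
  interpret K1: normal_words "K1 k" by (rule normal_words_K1)
  interpret KB: normal_words "KB k" by (rule normal_words_KB)
  have "lamp k x = lamp k y" if c: "K1.cong x y" for x y
  proof -
    have "KB.cong x y" "(bexp x - bexp y) mod 3 = 0"
      using c by (simp_all add: K1.cong_def KB.cong_def K1_def)
    then have "KB k x = KB k y" "KB k (la # x) = KB k (la # y)"
      using KB.cong_K[of x y "[]" "[]"] KB.cong_K[of x y "[la]" "[]"] by simp_all
    moreover have "bexp x mod 3 = bexp y mod 3"
      unfolding mod_eq_dvd_iff dvd_eq_mod_eq_0 by fact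
    ultimately show ?thesis by (simp add: lamp_def)
  qed
  then show ?thesis by (simp add: K1.invar_def)
qed

lemma lamp_la: "lamp k (la # x) = - lamp k x"
proof -
  interpret KB: normal_words "KB k" by (rule normal_words_KB)
  have "KB k (la # la # x) = KB k x" using KB.K_insert[OF KB.K_aa, of "[]" x] by simp
  then show ?thesis by (simp add: lamp_def la_lb_parts)
qed

lemma normal_words_K2: "normal_words (K2 k)"
  unfolding K2_def
  by (rule normal_words.normal_words_lamps[OF normal_words_K1 invar_lamp lamp_la])

lemma normal_words_K3: "normal_words (K3 ev k)"
  unfolding K3_def using normal_words_conj[OF normal_words_K2 normal_words_even, of k] normal_words_K2[of k]
  by (cases ev) simp_all

lemma K1_square: "K1 k u \<Longrightarrow> K3 ev k (u @ u)"
  using normal_words.psi_double[OF normal_words_K1 invar_lamp, of k u]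
    normal_words.K_append[OF normal_words_K1, of k u u]
  by (simp add: K3_def K2_def)

lemma card_range_le:
  assumes "finite (range f)" "\<And>u v. f u = f v \<Longrightarrow> g u = g v"
  shows "finite (range g)" "card (range g) \<le> card (range f)"
proof -
  define h where "h y = g (SOME u. f u = y)" for y
  have "g u = h (f u)" for u
    unfolding h_def by (rule assms(2)) (metis (mono_tags, lifting) someI)
  then have "range g = h ` range f" by auto
  then show "finite (range g)" "card (range g) \<le> card (range f)"
    using assms(1) card_image_le by auto
qed

lemma KB_I: "\<forall>i\<in>set [0..<13]. lw w (0, i) = (0, i) \<Longrightarrow> KB k w"
proof -
  assume w: "\<forall>i\<in>set [0..<13]. lw w (0, i) = (0, i)"
  have "lw w (c, i) = (c, i)" if "i < 13" for c i
    using lw_add[of w 0 c i] bspec[OF w, of i] that by simp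
  then show ?thesis by (simp add: KB_def states_def leq_def)
qed

lemma KB_exact: "KB 0 w \<Longrightarrow> s \<in> states \<Longrightarrow> lw w s = s"
  by (simp add: KB_def leq_def prod_eq_iff)

lemma lw_winv: "s \<in> states \<Longrightarrow> lw (winv u) (lw u s) = s" "s \<in> states \<Longrightarrow> lw u (lw (winv u) s) = s"
  using KB_exact[OF normal_words.K_winv_left[OF normal_words_KB], of s u]
    KB_exact[OF normal_words.K_winv_right[OF normal_words_KB], of s u] by simp_all

lemma perm_ab_table:
  "\<forall>i\<in>set [0..<13]. pa (pb i) = (if i = 12 then 0 else Suc i) \<and>
     lab (pb i) = (if i = 3 then 1 else if i = 0 then - 1 else 0)"
  by code_simp

text \<open>Along the 13-cycle the label is a coboundary: ab adds -1 on entering {1..3} and +1 on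
  leaving it. A full turn contributes 0 for every k.\<close>

lemma lw_xpow:
  assumes "i < 13"
  shows "lw (xpow j) (c, i) = (c - of_bool ((i + j) mod 13 \<in> {1..3}) + of_bool (i \<in> {1..3}), (i + j) mod 13)"
proof (induction j)
  case (Suc j)
  let ?m = "(i + j) mod 13"
  have m: "?m < 13" by simp
  have nxt: "(i + Suc j) mod 13 = (if ?m = 12 then 0 else Suc ?m)"
    using mod_Suc[of "i + j" 13] by simp
  have "lw (xpow (Suc j)) (c, i) = lact la (lact lb (lw (xpow j) (c, i)))"
    by (simp add: apow_simps)
  also have "\<dots> = (c - of_bool (?m \<in> {1..3}) + of_bool (i \<in> {1..3}) + lab (pb ?m), pa (pb ?m))"
    by (simp add: Suc la_lb_parts)
  also have "\<dots> = (c - of_bool ((i + Suc j) mod 13 \<in> {1..3}) + of_bool (i \<in> {1..3}), (i + Suc j) mod 13)"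
    using bspec[OF perm_ab_table, of ?m] m unfolding nxt by auto
  finally show ?case .
qed (use assms in \<open>simp add: apow_simps\<close>)

lemma KB_xpow_13: "KB k (xpow 13)"
  by (rule KB_I) (simp add: lw_xpow)

abbreviation ypow :: "nat \<Rightarrow> word" where
  "ypow \<equiv> apow False"

lemma bexp_apow [simp]: "bexp (apow e k) = (if e then int k else - int k)"
  by (induction k) (auto simp: apow_simps bl_def la_lb_parts)

lemma (in normal_words) cong_ypow: "cong (ypow j) ([la] @ winv (xpow j) @ [linv la])"
proof (induction j)
  case (Suc j)
  have "cong (ypow (Suc j)) ([la, lbi] @ [la] @ winv (xpow j) @ [linv la])"
    using cong_ctxt[OF Suc, of "[la, lbi]" "[]"] by (simp add: apow_simps)
  also have "cong \<dots> ([la, lbi] @ [linv la] @ winv (xpow j) @ [linv la])"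
    using cong_ctxt[OF cong_sym[OF cong_la], of "[la, lbi]" "winv (xpow j) @ [linv la]"] by simp
  also have "\<dots> = [la] @ winv (xpow (Suc j)) @ [linv la]"
    using apow_add[of True j 1] by (simp add: apow_simps)
  finally show ?case .
qed (simp add: apow_simps cong_sym cong_Nil)

lemma (in normal_words) K_ypow:
  "K (ypow j) = K (xpow j)" "K (la # winv (ypow j)) = K (la # winv (xpow j))"
proof -
  show "K (ypow j) = K (xpow j)"
    using cong_K'[OF cong_ypow[of j]] K_conj[of "[la]" "winv (xpow j)"] by (simp add: K_winv)
  have "K [linv la, linv la]" using K_aa K_winv[of "[la, la]"] by simp
  then have "K (ypow j @ [linv la]) = K (la # winv (xpow j))"
    using cong_K[OF cong_ypow[of j], of "[]" "[linv la]"] K_insert_right[of "[linv la, linv la]" "la # winv (xpow j)"]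
    by simp
  then show "K (la # winv (ypow j)) = K (la # winv (xpow j))" using K_winv[of "ypow j @ [linv la]"] by simp
qed

lemma KB_ypow_13: "KB k (ypow 13)"
  using normal_words.K_ypow[OF normal_words_KB] KB_xpow_13 by blast

lemma not_KB_apow:
  assumes "0 < i" "i < 13"
  shows "\<not> KB k (winv (apow e i))" "\<not> KB k (la # winv (apow e i))"
proof -
  interpret KB: normal_words "KB k" by (rule normal_words_KB)
  have moves: "\<not> KB k u" if "snd (lw u (0, 0)) \<noteq> 0" for u
  proof
    assume "KB k u"
    then have "leq k (lw u (0, 0)) (0, 0)" by (simp add: KB_def states_def)
    then show False using that by (simp add: leq_def)
  qed
  have "\<not> KB k (xpow i)" "\<not> KB k (xpow i @ [linv la])"
    by (rule moves, use assms in \<open>simp add: lw_xpow la_lb_parts linv_def lab_def pa_def\<close>)+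
  then have x: "\<not> KB k (xpow i)" "\<not> KB k (la # winv (xpow i))"
    using KB.K_winv[of "xpow i @ [linv la]"] by simp_all
  then show "\<not> KB k (winv (apow e i))" "\<not> KB k (la # winv (apow e i))"
    using KB.K_ypow[of i] by (cases e; simp add: KB.K_winv)+
qed

lemma not_KB_letters: "\<not> KB k [la]" "\<not> KB k [lb]"
proof -
  have "snd (lw [la] (0, 1)) = 4" "snd (lw [lb] (0, 0)) = 4"
    by (simp_all add: la_lb_parts pa_def pb_def)
  then show "\<not> KB k [la]" "\<not> KB k [lb]"
    unfolding KB_def states_def leq_def by fastforce+
qed

lemma KB_xpow_mult: "KB k (xpow (13 * j))"
proof (induction j)
  case (Suc j)
  then show ?case
    using normal_words.K_append[OF normal_words_KB KB_xpow_13 Suc] apow_add[of True 13 "13 * j"] by simp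
qed (simp add: apow_simps normal_words.K_Nil[OF normal_words_KB])

text \<open>(ab)^13 lies in \<open>KB k\<close>, but its exponent sum 13 in b is nonzero modulo 3.
  The factor (a b^-1)^13, in which b is inverted, restores the sum 0 and yields an element of
  \<open>K1 k\<close>.\<close>

definition rho :: word where
  "rho = xpow 13 @ ypow 13"

lemma K1_rho: "K1 k rho"
  using normal_words.K_append[OF normal_words_KB KB_xpow_13 KB_ypow_13, of k]
  by (simp add: K1_def rho_def)

text \<open>Of the 26 prefixes preceding an a only the empty one and (ab)^13 could contribute. The
  first gives 1; at the second the exponent sum -13 is 2 modulo 3, where \<open>lamp\<close> is 0 by
  definition.\<close>

lemma psi_rho_Nil: "psi (lamp k) rho [] = 1"
proof -
  interpret KB: normal_words "KB k" by (rule normal_words_KB)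
  have x: "lamp k (winv (xpow i)) = of_bool (i = 0)" if "i < 13" for i
  proof (cases "i = 0")
    case True
    then show ?thesis using not_KB_letters by (simp add: lamp_def apow_simps)
  next
    case False
    then show ?thesis using not_KB_apow[of i k True] that by (simp add: lamp_def)
  qed
  have y: "lamp k (winv (ypow i) @ winv (xpow 13)) = 0" if "i < 13" for i
  proof (cases "i = 0")
    case True
    then show ?thesis by (simp add: lamp_def apow_simps)
  next
    case False
    have "KB k (winv (xpow 13))" using KB_xpow_13 by (simp add: KB.K_winv)
    from KB.K_insert_right[OF this]
    have "KB k (winv (ypow i) @ winv (xpow 13)) = KB k (winv (ypow i))"
      "KB k (la # winv (ypow i) @ winv (xpow 13)) = KB k (la # winv (ypow i))"
      using KB.K_insert_right[of "winv (xpow 13)" "la # winv (ypow i)"] \<open>KB k (winv (xpow 13))\<close> by simp_all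
    then show ?thesis using not_KB_apow[of i k False] that False by (simp add: lamp_def)
  qed
  have "psi (lamp k) rho [] = (\<Sum>i<13. lamp k (winv (xpow i))) +
      (\<Sum>i<13. lamp k (winv (ypow i) @ winv (xpow 13)))"
    by (simp add: rho_def psi_append psi_apow)
  also have "\<dots> = (\<Sum>i<(13::nat). if i = 0 then 1 else 0) + (\<Sum>i<(13::nat). 0)"
    by (intro arg_cong2[of _ _ _ _ "(+)"] sum.cong refl) (use x y in auto)
  finally show ?thesis by simp
qed

text \<open>\<open>lamp k\<close> vanishes at x unless x or a x lies in \<open>KB k\<close>, and the
  elements (ab)^(13 j) with j < 3 cover the classes of \<open>K1 k\<close> inside
  \<open>KB k\<close>. This gives 26 * 2 * 3 = 156 candidates.\<close>

definition rho_support :: "word set" where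
  "rho_support = (\<lambda>(g, p, j). g @ p @ xpow (13 * j)) `
     ((xpow ` {..<13} \<union> (\<lambda>i. xpow 13 @ ypow i) ` {..<13}) \<times> {[], [linv la]} \<times> {..<3::nat})"

lemma finite_rho_support: "finite rho_support" "card rho_support \<le> 156"
proof -
  let ?D = "(xpow ` {..<13} \<union> (\<lambda>i. xpow 13 @ ypow i) ` {..<13}) \<times> {[], [linv la]} \<times> {..<3::nat}"
  show "finite rho_support" by (simp add: rho_support_def)
  have "card (xpow ` {..<13} \<union> (\<lambda>i. xpow 13 @ ypow i) ` {..<13}) \<le> 13 + 13"
    by (rule order_trans[OF card_Un_le add_mono]) (rule order_trans[OF card_image_le], simp, simp)+
  then have "card ?D \<le> 26 * (2 * 3)"
    unfolding card_cartesian_product by (intro mult_le_mono) (auto simp: card_insert_if)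
  then show "card rho_support \<le> 156"
    unfolding rho_support_def using card_image_le[of ?D "\<lambda>(g, p, j). g @ p @ xpow (13 * j)"] by simp
qed

lemma Nil_rho_support: "[] \<in> rho_support"
  by (auto simp: rho_support_def apow_simps intro!: image_eqI[of _ _ "([], [], 0)"] image_eqI[of _ _ 0])

lemma psi_rho_support:
  assumes "psi (lamp k) rho x \<noteq> 0"
  shows "\<exists>f\<in>rho_support. normal_words.cong (K1 k) x f"
proof -
  interpret KB: normal_words "KB k" by (rule normal_words_KB)
  interpret K1: normal_words "K1 k" by (rule normal_words_K1)
  let ?G = "xpow ` {..<13} \<union> (\<lambda>i. xpow 13 @ ypow i) ` {..<13}"
  have "psi (lamp k) rho x = (\<Sum>i<13. lamp k (winv (xpow i) @ x)) +
      (\<Sum>i<13. lamp k (winv (xpow 13 @ ypow i) @ x))"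
    by (simp add: rho_def psi_append psi_apow)
  then have "(\<Sum>i<13. lamp k (winv (xpow i) @ x)) \<noteq> 0 \<or> (\<Sum>i<13. lamp k (winv (xpow 13 @ ypow i) @ x)) \<noteq> 0"
    using assms by auto
  then have "\<exists>g\<in>?G. lamp k (winv g @ x) \<noteq> 0"
  proof
    assume "(\<Sum>i<13. lamp k (winv (xpow i) @ x)) \<noteq> 0"
    then obtain i where "i \<in> {..<13}" "lamp k (winv (xpow i) @ x) \<noteq> 0" by (rule sum.not_neutral_contains_not_neutral)
    then show ?thesis by blast
  next
    assume "(\<Sum>i<13. lamp k (winv (xpow 13 @ ypow i) @ x)) \<noteq> 0"
    then obtain i where "i \<in> {..<13}" "lamp k (winv (xpow 13 @ ypow i) @ x) \<noteq> 0"
      by (rule sum.not_neutral_contains_not_neutral)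
    then show ?thesis by blast
  qed
  then obtain g where g: "g \<in> ?G" "lamp k (winv g @ x) \<noteq> 0" by blast
  then have "KB k (winv g @ x) \<or> KB k (la # winv g @ x)" by (auto simp: lamp_def split: if_splits)
  then obtain p where p: "p \<in> {[], [linv la]}" "KB k (winv (g @ p) @ x)" by fastforce
  define y where "y = winv (g @ p) @ x"
  define j where "j = nat (bexp y mod 3)"
  have j: "j < 3" "int j = bexp y mod 3" by (auto simp: j_def)
  have "(bexp y - 13 * int j) mod 3 = 0"
    unfolding j(2) by presburger
  moreover have "KB k (y @ winv (xpow (13 * j)))"
    using KB.K_append[of y "winv (xpow (13 * j))"] p(2) KB_xpow_mult by (simp add: y_def KB.K_winv)
  ultimately have "K1.cong y (xpow (13 * j))" by (simp add: K1.cong_def K1_def)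
  then have "K1.cong ((g @ p) @ y) ((g @ p) @ xpow (13 * j))" by (simp add: K1.cong_cancel_left del: append_assoc)
  moreover have "K1.cong x ((g @ p) @ y)"
    using K1.cong_sym[OF K1.cong_cancel(1)[of "[]" "g @ p" x]] by (simp add: y_def)
  ultimately have "K1.cong x (g @ p @ xpow (13 * j))" using K1.cong_trans by simp
  moreover have "g @ p @ xpow (13 * j) \<in> rho_support"
    unfolding rho_support_def using g(1) p(1) j(1) by (intro image_eqI[of _ _ "(g, p, j)"]) auto
  ultimately show ?thesis by blast
qed

text \<open>The three turns of (ab)^13 meet the same lamps with exponent sums differing by 13, that
  is, in the three residues modulo 3. One of the three values is 0 and the other two are equal: this
  is 1 + \<omega> + \<omega>^2 = 0 in F_4.\<close>

lemma K2_xpow_39: "K2 k (xpow 39)"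
proof -
  interpret KB: normal_words "KB k" by (rule normal_words_KB)
  have "KB k (xpow 39)" using KB_xpow_mult[of k 3] by simp
  then have K1: "K1 k (xpow 39)" by (simp add: K1_def)
  have shift: "lamp k (winv (xpow (13 * j + i)) @ x) =
      (if (bexp (winv (xpow i) @ x) - 13 * int j) mod 3 = 2 then 0
       else of_bool (KB k (winv (xpow i) @ x)) - of_bool (KB k (la # winv (xpow i) @ x)))" for i j x
  proof -
    have K: "KB k (winv (xpow (13 * j)))" using KB_xpow_mult by (simp add: KB.K_winv)
    have "KB k (winv (xpow i) @ winv (xpow (13 * j)) @ x) = KB k (winv (xpow i) @ x)"
      "KB k (la # winv (xpow i) @ winv (xpow (13 * j)) @ x) = KB k (la # winv (xpow i) @ x)"
      using KB.K_insert[OF K, of "winv (xpow i)" x] KB.K_insert[OF K, of "la # winv (xpow i)" x] by simp_all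
    moreover have "winv (xpow (13 * j + i)) @ x = winv (xpow i) @ winv (xpow (13 * j)) @ x"
      by (simp add: apow_add)
    moreover have "bexp (winv (xpow (13 * j + i)) @ x) = bexp (winv (xpow i) @ x) - 13 * int j"
      by simp
    ultimately show ?thesis unfolding lamp_def by (simp only: append_Cons)
  qed
  have three: "even ((if b mod 3 = 2 then 0 else v) + (if (b - 13) mod 3 = 2 then 0 else v) +
     (if (b - 26) mod 3 = 2 then 0 else v))" for b v :: int
  proof -
    have d: "(b - 13) mod 3 = (b mod 3 - 13) mod 3" "(b - 26) mod 3 = (b mod 3 - 26) mod 3"
      by (simp_all only: mod_diff_left_eq)
    have "b mod 3 = 0 \<or> b mod 3 = 1 \<or> b mod 3 = 2"
      using pos_mod_sign[of 3 b] pos_mod_bound[of 3 b] by linarith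
    then show ?thesis unfolding d by (elim disjE) (simp_all only:, simp_all)
  qed
  have "even (psi (lamp k) (xpow 39) x)" for x
  proof -
    have "xpow 39 = xpow 13 @ xpow 13 @ xpow 13" using apow_add[of True 13 13] apow_add[of True 13 26] by simp
    then have "psi (lamp k) (xpow 39) x = (\<Sum>i<13. lamp k (winv (xpow (13 * 0 + i)) @ x)) +
        (\<Sum>i<13. lamp k (winv (xpow (13 * 1 + i)) @ x)) + (\<Sum>i<13. lamp k (winv (xpow (13 * 2 + i)) @ x))"
      using apow_add[of True 13 13] by (simp add: psi_append psi_apow apow_add[of True 13] apow_add[of True 26])
    also have "\<dots> = (\<Sum>i<13. lamp k (winv (xpow (13 * 0 + i)) @ x) + lamp k (winv (xpow (13 * 1 + i)) @ x) +
        lamp k (winv (xpow (13 * 2 + i)) @ x))"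
      by (simp only: sum.distrib)
    also have "even \<dots>"
      unfolding shift by (rule dvd_sum) (use three in simp)
    finally show ?thesis .
  qed
  with K1 show ?thesis by (simp add: K2_def)
qed

subsection \<open>Counting classes\<close>

definition index :: "(word \<Rightarrow> bool) \<Rightarrow> nat" where
  "index K = card (range (normal_words.cls K))"

definition signature :: "int \<Rightarrow> word \<Rightarrow> (int \<times> nat) list \<times> int" where
  "signature k w = (map (\<lambda>i. (fst (lw w (0, i)) mod k, snd (lw w (0, i)))) [0..<13], bexp w mod 3)"

lemma signature_eq:
  "signature k u = signature k v \<longleftrightarrow>
     (\<forall>s\<in>states. leq k (lw u s) (lw v s)) \<and> bexp u mod 3 = bexp v mod 3"
proof -
  have "leq k (lw u (c, i)) (lw v (c, i)) = leq k (lw u (0, i)) (lw v (0, i))" for c i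
  proof -
    have "lw w (c, i) = (fst (lw w (0, i)) + c, snd (lw w (0, i)))" for w
      using lw_add[of w 0 c i] by simp
    then show ?thesis by (simp add: leq_def mod_eq_dvd_iff)
  qed
  note eq = this
  have "(\<forall>s\<in>states. leq k (lw u s) (lw v s)) = (\<forall>i<13. leq k (lw u (0, i)) (lw v (0, i)))"
  proof (intro iffI ballI allI impI)
    fix s assume "\<forall>i<13. leq k (lw u (0, i)) (lw v (0, i))" "s \<in> states"
    moreover obtain c i where "s = (c, i)" by (cases s)
    ultimately show "leq k (lw u s) (lw v s)" using eq[of c i] by (simp add: states_def)
  qed (simp add: states_def)
  then show ?thesis by (auto simp: signature_def leq_def)
qed

lemma leq_sym: "leq k s s' \<Longrightarrow> leq k s' s"
  by (simp add: leq_def)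

lemma K1_cong_iff: "normal_words.cong (K1 k) u v \<longleftrightarrow> signature k u = signature k v"
proof -
  interpret K1: normal_words "K1 k" by (rule normal_words_K1)
  have "leq k (lw (winv u @ v) s) s = leq k (lw u s) (lw v s)" if s: "s \<in> states" for s
  proof -
    have sv: "lw v s \<in> states" using lw_states[OF s] .
    have app: "lw (winv u @ v) s = lw (winv u) (lw v s)" by simp
    show ?thesis
    proof
      assume "leq k (lw (winv u @ v) s) s"
      from leq_lw[OF this, of u] have "leq k (lw v s) (lw u s)"
        unfolding app lw_winv(2)[OF sv] .
      then show "leq k (lw u s) (lw v s)" by (rule leq_sym)
    next
      assume "leq k (lw u s) (lw v s)"
      from leq_lw[OF leq_sym[OF this], of "winv u"] show "leq k (lw (winv u @ v) s) s"
        unfolding app lw_winv(1)[OF s] .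
    qed
  qed
  moreover have "(bexp (winv u @ v) mod 3 = 0) = (bexp u mod 3 = bexp v mod 3)"
    unfolding mod_eq_dvd_iff by (auto simp: mod_eq_0_iff_dvd dvd_diff_commute)
  ultimately show ?thesis
    unfolding K1.cong_iff_left K1_def KB_def signature_eq by auto
qed

lemma K1_cls: "normal_words.cls (K1 k) u = normal_words.cls (K1 k) v \<longleftrightarrow> signature k u = signature k v"
  using normal_words.cls_eq_iff[OF normal_words_K1] K1_cong_iff by simp

lemma finite_signature:
  assumes "k > 0"
  shows "finite (range (signature k))"
proof -
  let ?L = "{xs. set xs \<subseteq> {0..<k} \<times> {..<13::nat} \<and> length xs = 13}"
  have "range (signature k) \<subseteq> ?L \<times> {0..<3}"
    using assms snd_lw_less by (auto simp: signature_def)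
  moreover have "finite (?L \<times> {0..<3::int})"
    by (intro finite_cartesian_product finite_lists_length_eq) auto
  ultimately show ?thesis by (rule finite_subset)
qed

lemma index_K1_signature:
  assumes "k > 0"
  shows "finite (range (normal_words.cls (K1 k)))" "index (K1 k) = card (range (signature k))"
proof -
  have "finite (range (normal_words.cls (K1 k)))" "index (K1 k) \<le> card (range (signature k))"
    unfolding index_def using card_range_le[OF finite_signature[OF assms], of "normal_words.cls (K1 k)"]
    by (simp_all add: K1_cls)
  moreover from this(1) have "card (range (signature k)) \<le> index (K1 k)"
    unfolding index_def using card_range_le[of "normal_words.cls (K1 k)" "signature k"] by (simp add: K1_cls)
  ultimately show "finite (range (normal_words.cls (K1 k)))" "index (K1 k) = card (range (signature k))"
    by simp_all
qed

text \<open>A label modulo 2k has one bit more than a label modulo k, and there are 13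
  labels.\<close>

lemma index_K1_double:
  assumes "k > 0"
  shows "index (K1 (2 * k)) \<le> 2 ^ 13 * index (K1 k)"
proof -
  define f where "f w = (signature k w, map (\<lambda>i. fst (lw w (0, i)) div k mod 2) [0..<13])" for w
  let ?B = "{xs. set xs \<subseteq> {0, 1::int} \<and> length xs = 13}"
  have sub: "range f \<subseteq> range (signature k) \<times> ?B" by (auto simp: f_def)
  have fin: "finite (range (signature k) \<times> ?B)"
    using finite_signature[OF assms] by (intro finite_cartesian_product finite_lists_length_eq) auto
  have "signature (2 * k) u = signature (2 * k) v" if "f u = f v" for u v
    using that assms by (auto simp: f_def signature_def mult.commute[of 2 k] zmod_zmult2_eq)
  then have "card (range (signature (2 * k))) \<le> card (range f)"
    using card_range_le(2) finite_subset[OF sub fin] by blast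
  also have "\<dots> \<le> card (range (signature k) \<times> ?B)" by (rule card_mono[OF fin sub])
  also have "card {0, 1::int} = 2" by simp
  then have "card ?B = 2 ^ 13" using card_lists_length_eq[of "{0, 1::int}" 13] by (simp only: finite.intros)
  then have "card (range (signature k) \<times> ?B) = 2 ^ 13 * card (range (signature k))"
    by (simp add: card_cartesian_product)
  finally show ?thesis using assms by (simp add: index_K1_signature)
qed

lemma index_K1_ge:
  assumes "k > 0"
  shows "nat k \<le> index (K1 k)"
proof -
  \<comment> \<open>A loop at the point 6 with total label 1; its powers are distinguished by the
    label modulo k.\<close>
  define g where "g = alt [True, True, True, False]"
  define gp where "gp m = concat (replicate m g)" for m :: nat
  have g0: "lw g (0, 6) = (1, 6)" unfolding g_def by code_simp
  then have g: "lw g (c, 6) = (c + 1, 6)" for c using lw_add[of g 0 c 6] by simp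
  have gp: "lw (gp m) (c, 6) = (c + int m, 6)" for m c
    by (induction m) (simp_all add: gp_def g)
  have "inj_on (\<lambda>m. signature k (gp m)) {..<nat k}"
  proof
    fix m m' assume m: "m \<in> {..<nat k}" "m' \<in> {..<nat k}" "signature k (gp m) = signature k (gp m')"
    have "(0, 6) \<in> states" by (simp add: states_def)
    then have "leq k (lw (gp m) (0, 6)) (lw (gp m') (0, 6))" using m(3) signature_eq by blast
    then show "m = m'" using m(1,2) gp by (simp add: leq_def)
  qed
  then have "card {..<nat k} \<le> card (range (signature k))"
    using finite_signature[OF assms] by (intro card_inj_on_le[where f = "\<lambda>m. signature k (gp m)"]) auto
  then show ?thesis using assms by (simp add: index_K1_signature)
qed

text \<open>Along the powers of 2 the index is unbounded but grows by a factor of at most 2^13 per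
  step, so the last power before it exceeds y is good enough.\<close>

lemma index_K1_window:
  assumes "index (K1 1) \<le> y"
  shows "\<exists>k>0. index (K1 k) \<le> y \<and> y < 2 ^ 13 * index (K1 k)"
proof -
  let ?P = "\<lambda>j. y < index (K1 (2 ^ j))"
  have "y < 2 ^ Suc y" using less_exp[of y] unfolding power_Suc by linarith
  also have "2 ^ Suc y = nat (2 ^ Suc y)"
    by (simp only: nat_power_eq nat_numeral zero_le_numeral)
  also have "\<dots> \<le> index (K1 (2 ^ Suc y))" by (rule index_K1_ge) simp
  finally have ex: "?P (Suc y)" .
  define j where "j = (LEAST j. ?P j)"
  have j: "?P j" unfolding j_def by (rule LeastI[of ?P, OF ex])
  have "j \<noteq> 0" using j assms by (cases "j = 0") auto
  then obtain i where i: "j = Suc i" by (cases j) auto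
  have "\<not> ?P i" using not_less_Least[of i ?P] i by (simp add: j_def)
  moreover have "y < 2 ^ 13 * index (K1 (2 ^ i))"
    using j index_K1_double[of "2 ^ i"] i by simp
  ultimately show ?thesis by (intro exI[of _ "2 ^ i"]) auto
qed

section \<open>Counting classes of the finite quotients\<close>

text \<open>A class is determined by its class modulo \<open>K1 k\<close>, one parity bit and the
  set of lamps that are on.\<close>

lemma index_K3_upper:
  assumes "k > 0"
  shows "finite (range (normal_words.cls (K3 ev k)))"
    and "index (K3 ev k) \<le> index (K1 k) * (2 * 2 ^ index (K1 k))"
proof -
  interpret K1: normal_words "K1 k" by (rule normal_words_K1)
  interpret K3: normal_words "K3 ev k" by (rule normal_words_K3)
  let ?d = "lamp k"
  define f where "f w = (K1.cls w, even (count_a w), {K1.cls x |x. odd (psi ?d w x)})" for w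
  have fin1: "finite (range K1.cls)" using index_K1_signature[OF assms] by simp
  have sub: "range f \<subseteq> range K1.cls \<times> (UNIV :: bool set) \<times> Pow (range K1.cls)" by (auto simp: f_def)
  have fin: "finite (range K1.cls \<times> (UNIV :: bool set) \<times> Pow (range K1.cls))" using fin1 by simp
  have "K3.cls u = K3.cls v" if uv: "f u = f v" for u v
  proof -
    have c: "K1.cong u v" and ev: "even (count_a u) = even (count_a v)"
      and s: "{K1.cls x |x. odd (psi ?d u x)} = {K1.cls x |x. odd (psi ?d v x)}"
      using uv by (simp_all add: f_def K1.cls_eq_iff)
    have imp: "odd (psi ?d w' x)"
      if "{K1.cls x |x. odd (psi ?d w x)} \<subseteq> {K1.cls x |x. odd (psi ?d w' x)}" "odd (psi ?d w x)" for w w' x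
    proof -
      have "K1.cls x \<in> {K1.cls x |x. odd (psi ?d w' x)}" using that by blast
      then obtain x' where "K1.cls x = K1.cls x'" "odd (psi ?d w' x')" by blast
      then show ?thesis using K1.psi_cong[OF invar_lamp, of x x' w'] by (simp add: K1.cls_eq_iff)
    qed
    have odd_iff: "odd (psi ?d u x) = odd (psi ?d v x)" for x
      using imp[of u v x] imp[of v u x] s by blast
    have "even (psi ?d (u @ winv v) x)" for x
      using odd_iff[of x] by (simp add: K1.psi_diff[OF invar_lamp lamp_la c])
    then have "K3.cong u v"
      using c ev by (simp add: K3.cong_def K3_def K2_def K1.cong_def)
    then show ?thesis by (simp add: K3.cls_eq_iff)
  qed
  note le = card_range_le[OF finite_subset[OF sub fin] this]
  show "finite (range K3.cls)" by (rule le(1))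
  have "index (K3 ev k) \<le> card (range f)" unfolding index_def by (rule le(2))
  also have "\<dots> \<le> card (range K1.cls \<times> (UNIV :: bool set) \<times> Pow (range K1.cls))"
    by (rule card_mono[OF fin sub])
  also have "\<dots> = index (K1 k) * (2 * 2 ^ index (K1 k))"
    by (simp only: card_cartesian_product card_Pow[OF fin1] card_UNIV_bool index_def)
  finally show "index (K3 ev k) \<le> index (K1 k) * (2 * 2 ^ index (K1 k))" .
qed

text \<open>If the translates of \<open>rho_support\<close> by the elements of S are disjoint, then
  the conjugates of \<open>rho\<close> by them switch the lamps at the points of S independently. So
  each subset of S gives its own class.\<close>

lemma index_K3_lower:
  assumes "k > 0"
  shows "\<exists>r. index (K1 k) \<le> r * 156 ^ 2 \<and> 2 ^ r \<le> index (K3 ev k)"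
proof -
  interpret K1: normal_words "K1 k" by (rule normal_words_K1)
  interpret K3: normal_words "K3 ev k" by (rule normal_words_K3)
  let ?d = "lamp k"
  obtain U where U: "inj_on K1.cls U" "range K1.cls = K1.cls ` U"
    using subset_image_inj[of "range K1.cls" K1.cls UNIV] by auto
  have finU: "finite U"
    using index_K1_signature(1)[OF assms] U finite_image_iff by metis
  have cardU: "card U = index (K1 k)" using card_image[OF U(1)] U(2) by (simp add: index_def)
  define conf where "conf g g' \<longleftrightarrow> (\<exists>f\<in>rho_support. \<exists>f'\<in>rho_support. K1.cong (g @ f) (g' @ f'))" for g g'
  have "\<exists>S\<subseteq>U. (\<forall>x\<in>S. \<forall>y\<in>S. x \<noteq> y \<longrightarrow> \<not> conf x y) \<and> card U \<le> card S * 156 ^ 2"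
  proof (rule greedy_independent_set[OF finU])
    show "conf g g" for g using Nil_rho_support K1.cong_refl unfolding conf_def by blast
    show "conf g g' \<Longrightarrow> conf g' g" for g g' using K1.cong_sym unfolding conf_def by blast
    fix g assume "g \<in> U"
    \<comment> \<open>A conflict g f = g' f' determines the class of g' from f and f', so there are
      at most 156^2 of them.\<close>
    let ?h = "\<lambda>(f, f'). inv_into U K1.cls (K1.cls (g @ f @ winv f'))"
    have "{g' \<in> U. conf g g'} \<subseteq> ?h ` (rho_support \<times> rho_support)"
    proof
      fix g' assume g': "g' \<in> {g' \<in> U. conf g g'}"
      then obtain f f' where f: "f \<in> rho_support" "f' \<in> rho_support" "K1.cong (g @ f) (g' @ f')"
        by (auto simp: conf_def)
      have "K1.cong (g @ f @ winv f') (g' @ f' @ winv f')"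
        using K1.cong_ctxt[OF f(3), of "[]" "winv f'"] by simp
      also have "K1.cong \<dots> g'" using K1.cong_cancel(1)[of g' f' "[]"] by simp
      finally have "K1.cls (g @ f @ winv f') = K1.cls g'" by (simp add: K1.cls_eq_iff)
      then have "?h (f, f') = g'" using inv_into_f_f[OF U(1)] g' by simp
      then show "g' \<in> ?h ` (rho_support \<times> rho_support)" using f by blast
    qed
    then have "card {g' \<in> U. conf g g'} \<le> card (rho_support \<times> rho_support)"
      using finite_rho_support by (intro surj_card_le) auto
    also have "\<dots> \<le> 156 * 156"
      unfolding card_cartesian_product by (intro mult_le_mono finite_rho_support(2))
    finally show "card {g' \<in> U. conf g g'} \<le> 156 ^ 2" by (simp add: power2_eq_square)
  qed
  then obtain S where S: "S \<subseteq> U" "\<And>x y. x \<in> S \<Longrightarrow> y \<in> S \<Longrightarrow> x \<noteq> y \<Longrightarrow> \<not> conf x y"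
    "card U \<le> card S * 156 ^ 2" by metis
  have finS: "finite S" using S(1) finU finite_subset by blast
  define z where "z gs = concat (map (\<lambda>g. g @ rho @ winv g) gs)" for gs :: "word list"
  have psi_z: "psi ?d (z gs) x = (\<Sum>g\<leftarrow>gs. psi ?d rho (winv g @ x))" for gs x
  proof (induction gs)
    case (Cons g gs)
    have "K1.cong (winv (g @ rho @ winv g) @ x) x"
      using K1.cong_del[of "winv (g @ rho @ winv g)" "[]" x] K1_rho
      by (simp only: K1.K_winv K1.K_conj append_Nil)
    then have "psi ?d (z gs) (winv (g @ rho @ winv g) @ x) = psi ?d (z gs) x"
      by (rule K1.psi_cong[OF invar_lamp])
    moreover have "z (g # gs) = (g @ rho @ winv g) @ z gs" by (simp add: z_def)
    ultimately have "psi ?d (z (g # gs)) x = psi ?d (g @ rho @ winv g) x + psi ?d (z gs) x"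
      using psi_append[of ?d "g @ rho @ winv g" "z gs" x] by (simp only:)
    then show ?case
      using Cons by (simp only: K1.psi_conj[OF invar_lamp lamp_la K1_rho] list.map sum_list.Cons)
  qed (simp add: z_def)
  have delta: "psi ?d rho (winv g @ x) = of_bool (g = x)" if "g \<in> S" "x \<in> S" for g x
  proof (cases "g = x")
    case True
    have "psi ?d rho (winv x @ x) = psi ?d rho []"
      by (rule K1.psi_cong[OF invar_lamp]) (simp add: K1.cong_Nil)
    then show ?thesis using True psi_rho_Nil by simp
  next
    case False
    have "psi ?d rho (winv g @ x) = 0"
    proof (rule ccontr)
      assume "psi ?d rho (winv g @ x) \<noteq> 0"
      then obtain f where f: "f \<in> rho_support" "K1.cong (winv g @ x) f" using psi_rho_support by blast
      have "K1.cong (g @ winv g @ x) (g @ f)" by (simp only: K1.cong_cancel_left f(2))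
      moreover have "K1.cong (g @ winv g @ x) x" using K1.cong_cancel(1)[of "[]" g x] by simp
      ultimately have "K1.cong (g @ f) x" by (rule K1.cong_trans[OF K1.cong_sym])
      then have "K1.cong (g @ f) (x @ [])" by simp
      then have "conf g x" using f(1) Nil_rho_support unfolding conf_def by blast
      then show False using S(2)[OF that] False by blast
    qed
    then show ?thesis using False by simp
  qed
  define lst where "lst V = (SOME gs. set gs = V \<and> distinct gs)" for V :: "word set"
  have lst: "set (lst V) = V" "distinct (lst V)" if "V \<subseteq> S" for V
    unfolding lst_def using someI_ex[OF finite_distinct_list[OF finite_subset[OF that finS]]] by auto
  have val: "psi ?d (z (lst V)) x = of_bool (x \<in> V)" if V: "V \<subseteq> S" and x: "x \<in> S" for V x
  proof -
    have "psi ?d (z (lst V)) x = (\<Sum>g\<in>V. psi ?d rho (winv g @ x))"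
      using sum_list_distinct_conv_sum_set[OF lst(2)[OF V]] lst(1)[OF V] by (simp add: psi_z)
    also have "\<dots> = (\<Sum>g\<in>V. if g = x then 1 else 0)"
      using V x delta by (intro sum.cong) auto
    finally show ?thesis using finite_subset[OF V finS] by simp
  qed
  have par: "even (psi ?d u x) = even (psi ?d v x)" if "K3.cong u v" for u v x
  proof -
    have c: "K1.cong u v" and e: "even (psi ?d (u @ winv v) x)"
      using that by (simp_all add: K3.cong_def K3_def K2_def K1.cong_def)
    then show ?thesis by (simp add: K1.psi_diff[OF invar_lamp lamp_la c])
  qed
  have "inj_on (\<lambda>V. K3.cls (z (lst V))) (Pow S)"
  proof
    fix V V' assume V: "V \<in> Pow S" "V' \<in> Pow S" "K3.cls (z (lst V)) = K3.cls (z (lst V'))"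
    have "x \<in> V \<longleftrightarrow> x \<in> V'" if "x \<in> S" for x
      using par[of "z (lst V)" "z (lst V')" x] V val[of V x] val[of V' x] that
      by (cases "x \<in> V"; cases "x \<in> V'") (simp_all add: K3.cls_eq_iff)
    then show "V = V'" using V by blast
  qed
  then have "card (Pow S) \<le> index (K3 ev k)"
    unfolding index_def using index_K3_upper(1)[OF assms] by (intro card_inj_on_le) auto
  then have "2 ^ card S \<le> index (K3 ev k)" by (simp add: card_Pow finS)
  then show ?thesis using S(3) cardU by (intro exI[of _ "card S"]) simp
qed

subsection \<open>The permutations of 13 points\<close>

interpretation P: normal_words "KB 1"
  by (rule normal_words_KB)

lemma P_iff: "KB 1 w \<longleftrightarrow> (\<forall>p<13. snd (lw w (0, p)) = p)"
proof -
  have "(\<forall>c. snd (lw w (c, p)) = p) = (snd (lw w (0, p)) = p)" for p using snd_lw by metis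
  moreover have "KB 1 w \<longleftrightarrow> (\<forall>p<13. \<forall>c. snd (lw w (c, p)) = p)"
    by (auto simp: KB_def states_def leq_def)
  ultimately show ?thesis by simp
qed

lemma P_cong_iff: "P.cong u v \<longleftrightarrow> (\<forall>p<13. snd (lw u (0, p)) = snd (lw v (0, p)))"
proof -
  have "(snd (lw (winv u @ v) (0, p)) = p) = (snd (lw u (0, p)) = snd (lw v (0, p)))" if p: "p < 13" for p
  proof -
    let ?m = "snd (lw v (0, p))"
    have 1: "snd (lw (winv u @ v) (0, p)) = snd (lw (winv u) (0, ?m))"
      using snd_lw[of "winv u" "fst (lw v (0, p))" ?m] by simp
    have st: "(0, p) \<in> states" "(0, ?m) \<in> states" using p snd_lw_less by (simp_all add: states_def)
    have 2: "snd (lw (winv u) (0, snd (lw u (0, p)))) = p"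
      using lw_winv(1)[OF st(1), of u] snd_lw[of "winv u" "fst (lw u (0, p))" "snd (lw u (0, p))"] by simp
    have 3: "snd (lw u (0, snd (lw (winv u) (0, ?m)))) = ?m"
      using lw_winv(2)[OF st(2), of u] snd_lw[of u "fst (lw (winv u) (0, ?m))" "snd (lw (winv u) (0, ?m))"] by simp
    show ?thesis using 1 2 3 by metis
  qed
  then show ?thesis by (auto simp: P.cong_iff_left P_iff)
qed

text \<open>The choice of \<open>y0\<close> is justified by \<open>table_check\<close>.\<close>

definition y0 :: word where
  "y0 = [la, lbi, la, lb, la, lbi]"

definition table :: "word \<Rightarrow> nat list" where
  "table w = map (\<lambda>p. snd (lw w (0, p))) [0..<13]"

lemma P_cong_table: "P.cong u v \<longleftrightarrow> table u = table v"
  by (auto simp: P_cong_iff table_def)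

lemma table_nth: "p < 13 \<Longrightarrow> table w ! p = snd (lw w (0, p))"
  by (simp add: table_def)

lemma table_y0:
  "table y0 = [3, 12, 11, 2, 8, 6, 0, 10, 7, 5, 1, 4, 9]"
  "table (winv y0) = [6, 10, 3, 0, 11, 9, 5, 8, 4, 12, 7, 2, 1]"
  "table (la # y0) = [8, 5, 10, 7, 3, 9, 0, 11, 2, 12, 4, 1, 6]"
  "table (y0 @ [la]) = [3, 8, 10, 7, 12, 9, 5, 11, 2, 0, 4, 1, 6]"
  "table (la # y0 @ [la]) = [8, 3, 11, 2, 5, 6, 12, 10, 7, 0, 1, 4, 9]"
  by code_simp+

lemma table_xpow_conj:
  assumes "i < 13"
  shows "table (winv (xpow i) @ u @ xpow j) = map (\<lambda>p. (table u ! ((p + j) mod 13) + (13 - i)) mod 13) [0..<13]"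
proof -
  have "snd (lw (winv (xpow i) @ u @ xpow j) (0, p)) = (table u ! ((p + j) mod 13) + (13 - i)) mod 13"
    if p: "p < 13" for p
  proof -
    let ?m = "snd (lw u (0, (p + j) mod 13))"
    have m: "?m < 13" by (rule snd_lw_less) simp
    let ?n = "(?m + (13 - i)) mod 13"
    have "(?n + i) mod 13 = ?m"
      using m assms by (simp add: mod_add_left_eq)
    then have "snd (lw (xpow i) (0, ?n)) = ?m" by (simp add: lw_xpow)
    then have "snd (lw (winv (xpow i)) (0, ?m)) = ?n"
      using lw_winv(1)[of "(0, ?n)" "xpow i"] snd_lw[of "winv (xpow i)" "fst (lw (xpow i) (0, ?n))" ?m]
      by (simp add: states_def) (metis prod.collapse snd_conv)
    moreover have "snd (lw (winv (xpow i) @ u @ xpow j) (0, p)) = snd (lw (winv (xpow i)) (0, ?m))"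
      using snd_lw[of "winv (xpow i)" "fst (lw u (lw (xpow j) (0, p)))"] snd_lw[of u "fst (lw (xpow j) (0, p))"]
        lw_xpow[OF p, of j 0] by (metis comp_apply foldr_append prod.collapse snd_conv)
    ultimately show ?thesis by (simp add: table_nth)
  qed
  then show ?thesis by (simp add: table_def)
qed

text \<open>The indicator function of \<open>y0\<close>, antisymmetrised under multiplication by a
  on either side, so that both sign conditions hold.\<close>

definition kap1 :: "word \<Rightarrow> int" where
  "kap1 x = of_bool (P.cong x y0) - of_bool (P.cong x (la # y0)) - of_bool (P.cong x (y0 @ [la])) +
     of_bool (P.cong x (la # y0 @ [la]))"

lemma P_cong_right: "P.cong z z' \<Longrightarrow> P.cong x z = P.cong x z'"
  by (simp add: P_cong_table)

lemma P_cong_left: "P.cong x y \<Longrightarrow> P.cong x z = P.cong y z"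
  by (simp add: P_cong_table)

lemma P_cong_la: "P.cong (la # x) z = P.cong x (la # z)" "P.cong (x @ [la]) z = P.cong x (z @ [la])"
proof -
  have "P.cong (la # x) z = P.cong (la # la # x) (la # z)"
    using P.cong_cancel_left[of "[la]" "la # x" z] by simp
  also have "\<dots> = P.cong x (la # z)"
    by (rule P_cong_left[OF P.cong_la_la(1)])
  finally show "P.cong (la # x) z = P.cong x (la # z)" .
  have "P.cong (x @ [la]) z = P.cong (x @ [la, la]) (z @ [la])"
    using P.cong_cancel_right[of "x @ [la]" "[la]" z] by simp
  also have "\<dots> = P.cong x (z @ [la])"
    using P_cong_left[OF P.cong_del[OF P.K_aa, of x "[]"]] by simp
  finally show "P.cong (x @ [la]) z = P.cong x (z @ [la])" .
qed

lemma kap1_la: "kap1 (la # x) = - kap1 x" "kap1 (x @ [la]) = - kap1 x"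
proof -
  have l: "P.cong x (la # la # z) = P.cong x z" "P.cong x (z @ [la, la]) = P.cong x z" for z
    using P_cong_right[OF P.cong_la_la(1)] P_cong_right[OF P.cong_del[OF P.K_aa, of z "[]"]] by simp_all
  show "kap1 (la # x) = - kap1 x" "kap1 (x @ [la]) = - kap1 x"
    using l(2)[of "la # y0"] by (simp_all add: kap1_def P_cong_la l)
qed

lemma kap1_cong:
  assumes "P.cong x y"
  shows "kap1 x = kap1 y"
  unfolding kap1_def P_cong_left[OF assms] ..

lemma kap1_Nil: "kap1 [] = 0"
proof -
  have "table [] = [0..<13]" by (simp add: table_def)
  then show ?thesis
    unfolding kap1_def P_cong_table table_y0 by code_simp
qed

text \<open>\<open>U\<close> and \<open>V\<close> are the tables of \<open>y0\<close> and its
  inverse, and \<open>Z\<close> lists those of the other three elements in \<open>kap1\<close>;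
  \<open>f\<close> computes the table of (ab)^-i u (ab)^j as in \<open>table_xpow_conj\<close>. The
  only hit is \<open>U\<close> itself at i = j = 0.\<close>

lemma table_check:
  "\<forall>i\<in>set [0..<13]. \<forall>j\<in>set [0..<13].
    (let U = [3, 12, 11, 2, 8, 6, 0, 10, 7, 5, 1, 4, 9];
         V = [6, 10, 3, 0, 11, 9, 5, 8, 4, 12, 7, 2, 1];
         Z = [[8, 5, 10, 7, 3, 9, 0, 11, 2, 12, 4, 1, 6], [3, 8, 10, 7, 12, 9, 5, 11, 2, 0, 4, 1, 6],
              [8, 3, 11, 2, 5, 6, 12, 10, 7, 0, 1, 4, 9]];
         f = (\<lambda>W. map (\<lambda>p. (W ! ((p + j) mod 13) + (13 - i)) mod 13) [0..<13 :: nat])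
     in (f U = U) = (i = 0 \<and> j = 0) \<and> f U \<notin> set Z \<and> f V \<notin> set (U # Z))"
  by code_simp

lemma kap1_y0:
  assumes "i < 13" "j < 13"
  shows "kap1 (winv (xpow i) @ y0 @ xpow j) = of_bool (i = 0 \<and> j = 0)"
    and "kap1 (winv (xpow i) @ winv y0 @ xpow j) = 0"
  using bspec[OF bspec[OF table_check, of i], of j] assms
  unfolding kap1_def P_cong_table table_xpow_conj[OF assms(1)] table_y0 Let_def by auto

lemma xpow_mod_13: "P.cong (xpow i) (xpow (i mod 13))"
proof -
  have "xpow i = xpow (13 * (i div 13)) @ xpow (i mod 13)"
    using apow_add[of True "13 * (i div 13)" "i mod 13"] by simp
  then show ?thesis using P.cong_del[OF KB_xpow_mult, of "[]" _ "xpow (i mod 13)"] by simp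
qed

lemma kap1_mod_13:
  assumes "P.cong h y"
  shows "kap1 (winv (xpow i) @ h @ xpow j) = kap1 (winv (xpow (i mod 13)) @ y @ xpow (j mod 13))"
  by (intro kap1_cong P.cong_append P.cong_winv xpow_mod_13 assms)

lemma sum_mod_13: "(\<Sum>i<78. f (i mod 13)) = 6 * (\<Sum>i<13. f i)" for f :: "nat \<Rightarrow> int"
proof -
  have "(\<Sum>i = a * 13..<a * 13 + 13. f (i mod 13)) = (\<Sum>i<13. f i)" for a
    using sum.shift_bounds_nat_ivl[of "\<lambda>i. f (i mod 13)" 0 "a * 13" 13]
    by (simp add: lessThan_atLeast0 add.commute)
  then have "(\<Sum>a<6. \<Sum>i = a * 13..<a * 13 + 13. f (i mod 13)) = 6 * (\<Sum>i<13. f i)" by simp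
  then show ?thesis using sum.nat_group[of "\<lambda>i. f (i mod 13)" 13 6] by simp
qed

text \<open>The summand has period 13 in both indices and 78 = 6 * 13, so the single hit of
  \<open>kap1_y0\<close> is counted 6 * 6 = 36 times, which is 1 modulo 5.\<close>

lemma kap1_sum:
  assumes "P.cong h y0"
  shows "(\<Sum>j<78. \<Sum>i<78. kap1 (winv (xpow i) @ h @ xpow j)) = 36"
    and "kap1 (winv (xpow i) @ winv h @ xpow j) = 0"
proof -
  have "(\<Sum>j<78. \<Sum>i<78. kap1 (winv (xpow i) @ h @ xpow j)) =
      (\<Sum>j<78. 6 * (\<Sum>i<13. kap1 (winv (xpow i) @ y0 @ xpow (j mod 13))))"
    by (simp only: kap1_mod_13[OF assms] sum_mod_13[of "\<lambda>i. kap1 (winv (xpow i) @ y0 @ xpow (_ mod 13))"])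
  also have "\<dots> = 6 * (\<Sum>j<13. 6 * (\<Sum>i<13. kap1 (winv (xpow i) @ y0 @ xpow j)))"
    by (rule sum_mod_13)
  also have "\<dots> = 6 * (\<Sum>j<(13::nat). 6 * (\<Sum>i<(13::nat). of_bool (i = 0 \<and> j = 0)))"
    by (simp add: kap1_y0)
  also have "\<dots> = 36" by (simp add: of_bool_conj flip: sum_distrib_right)
  finally show "(\<Sum>j<78. \<Sum>i<78. kap1 (winv (xpow i) @ h @ xpow j)) = 36" .
  show "kap1 (winv (xpow i) @ winv h @ xpow j) = 0"
    using kap1_y0(2)[of "i mod 13" "j mod 13"] by (simp add: kap1_mod_13[OF P.cong_winv[OF assms]])
qed

lemma K3_imp_P:
  assumes "K3 ev k w"
  shows "KB 1 w"
proof -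
  have "leq k (lw w s) s" if "s \<in> states" for s
    using assms that by (simp add: K3_def K2_def K1_def KB_def)
  then show ?thesis by (simp add: KB_def leq_def)
qed

lemma K3_xpow: "K3 ev k (xpow 78)" "K3 False k (xpow 39)"
proof -
  have "xpow 78 = xpow 39 @ xpow 39" using apow_add[of True 39 39] by simp
  moreover have "count_a (xpow 78) = 78" by (simp add: apow_def)
  ultimately show "K3 ev k (xpow 78)" "K3 False k (xpow 39)"
    using K2_xpow_39 normal_words.K_append[OF normal_words_K2 K2_xpow_39 K2_xpow_39]
    by (simp_all add: K3_def)
qed

lemma K3_letters: "\<not> K3 ev k [la]" "\<not> K3 ev k [lb]"
  using not_KB_letters by (auto simp: K3_def K2_def K1_def)

text \<open>Right translation maps any nonempty fibre of the projection to the permutations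
  injectively into the one over \<open>y0\<close>, and there are at most 13^13 fibres.\<close>

lemma pool:
  assumes T: "finite T" "inj_on (normal_words.cls (K3 ev k)) T" "\<And>w. \<exists>\<tau>\<in>T. normal_words.cong (K3 ev k) w \<tau>"
  shows "card T \<le> 13 ^ 13 * card {\<tau> \<in> T. P.cong \<tau> y0}"
proof -
  interpret K3: normal_words "K3 ev k" by (rule normal_words_K3)
  let ?X = "{\<tau> \<in> T. P.cong \<tau> y0}"
  let ?L = "{xs. set xs \<subseteq> {..<13::nat} \<and> length xs = 13}"
  have finL: "finite ?L" by (rule finite_lists_length_eq) simp
  have cardL: "card ?L = 13 ^ 13" using card_lists_length_eq[of "{..<13::nat}" 13] by simp
  have tL: "table w \<in> ?L" for w using snd_lw_less by (auto simp: table_def)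
  have lift: "P.cong u v" if "K3.cong u v" for u v
    using that K3_imp_P by (simp add: K3.cong_def P.cong_def)
  obtain nxt where nxt: "\<And>w. nxt w \<in> T \<and> K3.cong w (nxt w)" using T(3) by metis
  have fib: "card {\<tau> \<in> T. table \<tau> = \<pi>} \<le> card ?X" for \<pi>
  proof (cases "{\<tau> \<in> T. table \<tau> = \<pi>} = {}")
    case True
    then show ?thesis by (simp only: card.empty)
  next
    case False
    then obtain \<tau>0 where \<tau>0: "\<tau>0 \<in> T" "table \<tau>0 = \<pi>" by blast
    let ?g = "\<lambda>\<tau>. nxt (\<tau> @ winv \<tau>0 @ y0)"
    show ?thesis
    proof (rule card_inj_on_le[of ?g])
      show "inj_on ?g {\<tau> \<in> T. table \<tau> = \<pi>}"
      proof
        fix u v assume uv: "u \<in> {\<tau> \<in> T. table \<tau> = \<pi>}" "v \<in> {\<tau> \<in> T. table \<tau> = \<pi>}" "?g u = ?g v"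
        have "K3.cong (u @ winv \<tau>0 @ y0) (?g v)" using nxt[of "u @ winv \<tau>0 @ y0"] uv(3) by simp
        also have "K3.cong (?g v) (v @ winv \<tau>0 @ y0)" using nxt K3.cong_sym by blast
        finally have "K3.cong u v" by (simp only: K3.cong_cancel_right)
        then show "u = v" using T(2) uv(1,2) by (simp add: inj_on_def K3.cls_eq_iff)
      qed
      show "?g ` {\<tau> \<in> T. table \<tau> = \<pi>} \<subseteq> ?X"
      proof
        fix x assume "x \<in> ?g ` {\<tau> \<in> T. table \<tau> = \<pi>}"
        then obtain u where u: "u \<in> T" "table u = \<pi>" "x = ?g u" by auto
        have "P.cong u \<tau>0" using u(2) \<tau>0(2) by (simp add: P_cong_table)
        then have "P.cong (u @ winv \<tau>0 @ y0) (\<tau>0 @ winv \<tau>0 @ y0)"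
          using P.cong_ctxt[of u \<tau>0 "[]" "winv \<tau>0 @ y0"] by simp
        also have "P.cong \<dots> y0" using P.cong_cancel(1)[of "[]" \<tau>0 y0] by simp
        finally have "P.cong x y0"
          using P.cong_trans[OF P.cong_sym[OF lift]] nxt[of "u @ winv \<tau>0 @ y0"] u(3) by blast
        then show "x \<in> ?X" using nxt u(3) by blast
      qed
    qed (use T(1) in simp)
  qed
  have "T \<subseteq> (\<Union>\<pi>\<in>?L. {\<tau> \<in> T. table \<tau> = \<pi>})" using tL by auto
  then have "card T \<le> card (\<Union>\<pi>\<in>?L. {\<tau> \<in> T. table \<tau> = \<pi>})"
    using T(1) finL by (intro card_mono) auto
  also have "\<dots> \<le> (\<Sum>\<pi>\<in>?L. card {\<tau> \<in> T. table \<tau> = \<pi>})" by (rule card_UN_le[OF finL])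
  also have "\<dots> \<le> (\<Sum>\<pi>\<in>?L. card ?X)" by (rule sum_mono) (rule fib)
  finally show ?thesis by (simp only: sum_constant cardL of_nat_id)
qed

text \<open>Overlapping spreads of h and h' mean c h d = c' h' d' with c, c', d, d' each taken from
  sets of at most 2 * 78 = 156 words. Given h, these four words determine the class of h'.\<close>

lemma separated_family:
  assumes T: "finite T" "inj_on (normal_words.cls (K3 ev k)) T" "V \<subseteq> T"
  shows "\<exists>S\<subseteq>V. (\<forall>h\<in>S. \<forall>h'\<in>S. \<forall>x. normal_words.spread (K3 ev k) 78 h x \<longrightarrow>
       normal_words.spread (K3 ev k) 78 h' x \<longrightarrow> h = h') \<and> card V \<le> card S * 156 ^ 4"
proof -
  interpret K3: normal_words "K3 ev k" by (rule normal_words_K3)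
  define conf where "conf h h' \<longleftrightarrow> (\<exists>x. K3.spread 78 h x \<and> K3.spread 78 h' x)" for h h'
  define C where "C = (\<lambda>(p, i). p @ winv (xpow i)) ` (K3.ends \<times> {..<78})"
  define D where "D = (\<lambda>(i, p). xpow i @ p) ` ({..<78} \<times> K3.ends)"
  have e: "finite K3.ends" "card K3.ends = 2" by (simp_all add: K3.ends_def)
  have finC: "finite C" "finite D" using e by (simp_all add: C_def D_def)
  have "card C \<le> card (K3.ends \<times> {..<78::nat})" "card D \<le> card ({..<78::nat} \<times> K3.ends)"
    unfolding C_def D_def using e by (intro card_image_le, simp)+
  then have cC: "card C \<le> 156" "card D \<le> 156" by (simp_all add: card_cartesian_product e)
  have finV: "finite V" using T(1,3) finite_subset by blast
  have inj: "inj_on K3.cls V" using T(2,3) inj_on_subset by blast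
  have sp: "\<exists>c\<in>C. \<exists>d\<in>D. K3.cong x (c @ h @ d)" if sp: "K3.spread 78 h x" for h x
  proof -
    obtain i j p p' where *: "i < 78" "j < 78" "p \<in> K3.ends" "p' \<in> K3.ends"
      "K3.cong x (p @ winv (xpow i) @ h @ xpow j @ p')"
      using sp unfolding K3.spread_def by blast
    have "p @ winv (xpow i) \<in> C" "xpow j @ p' \<in> D"
      using *(1-4) by (force simp: C_def D_def)+
    moreover have "K3.cong x ((p @ winv (xpow i)) @ h @ xpow j @ p')" using *(5) by simp
    ultimately show ?thesis by blast
  qed
  have "\<exists>S\<subseteq>V. (\<forall>x\<in>S. \<forall>y\<in>S. x \<noteq> y \<longrightarrow> \<not> conf x y) \<and> card V \<le> card S * 156 ^ 4"
  proof (rule greedy_independent_set[OF finV])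
    show "conf h h" for h using K3.spread_mid[of 0 78 0 h] unfolding conf_def by auto
    show "conf h h' \<Longrightarrow> conf h' h" for h h' unfolding conf_def by blast
    fix h assume "h \<in> V"
    let ?g = "\<lambda>((c, c'), (d, d')). inv_into V K3.cls (K3.cls (winv c' @ c @ h @ d @ winv d'))"
    have "{h' \<in> V. conf h h'} \<subseteq> ?g ` ((C \<times> C) \<times> (D \<times> D))"
    proof
      fix h' assume h': "h' \<in> {h' \<in> V. conf h h'}"
      then obtain x where "K3.spread 78 h x" "K3.spread 78 h' x" by (auto simp: conf_def)
      then obtain c d c' d' where c: "c \<in> C" "d \<in> D" "K3.cong x (c @ h @ d)"
        and c': "c' \<in> C" "d' \<in> D" "K3.cong x (c' @ h' @ d')" using sp by blast
      have "K3.cong (c @ h @ d) (c' @ h' @ d')" using c(3) c'(3) K3.cong_sym K3.cong_trans by blast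
      from K3.cong_ctxt[OF this, of "winv c'" "winv d'"]
      have "K3.cong (winv c' @ c @ h @ d @ winv d') (winv c' @ c' @ h' @ d' @ winv d')" by simp
      also have "K3.cong \<dots> (h' @ d' @ winv d')"
        using K3.cong_cancel(2)[of "[]" c' "h' @ d' @ winv d'"] by simp
      also have "K3.cong \<dots> h'" using K3.cong_cancel(1)[of h' d' "[]"] by simp
      finally have "K3.cls (winv c' @ c @ h @ d @ winv d') = K3.cls h'" by (simp add: K3.cls_eq_iff)
      then have "?g ((c, c'), (d, d')) = h'" using inv_into_f_f[OF inj] h' by simp
      then show "h' \<in> ?g ` ((C \<times> C) \<times> (D \<times> D))" using c c' by blast
    qed
    then have "card {h' \<in> V. conf h h'} \<le> card ((C \<times> C) \<times> (D \<times> D))"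
      using finC by (intro surj_card_le) auto
    also have "\<dots> \<le> (156 * 156) * (156 * 156)"
      unfolding card_cartesian_product by (intro mult_le_mono cC)
    finally show "card {h' \<in> V. conf h h'} \<le> 156 ^ 4" by (simp add: power_numeral_reduce)
  qed
  then obtain S where S: "S \<subseteq> V" "\<And>x y. x \<in> S \<Longrightarrow> y \<in> S \<Longrightarrow> x \<noteq> y \<Longrightarrow> \<not> conf x y"
    "card V \<le> card S * 156 ^ 4" by metis
  then show ?thesis unfolding conf_def by (intro exI[of _ S]) blast
qed

text \<open>With transversal words of length at most l = 4 s, where s = \<open>index (K1 k)\<close>,
  the commutators \<open>x i\<close> have length at most 16 s + 624. The requirement 16 (2 l + 1) +
  2 (16 s + 624) + 2 * 390 + 4 \<le> t of \<open>quotient_count\<close> is then 160 s + 2048 \<le>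
  t.\<close>

theorem many_quotients:
  fixes t :: nat and \<epsilon> :: real
  assumes k: "k > 0"
  defines "n \<equiv> index (K3 (even t) k)"
  assumes t: "160 * index (K1 k) + 2048 \<le> t"
    and m: "64 * n ^ 2 + 5 * n + 3 \<le> nat \<lfloor>2 powr (real t * \<epsilon>)\<rfloor>"
  shows "\<exists>q. n \<le> 13 ^ 13 * (156 ^ 4 * (2 * q + 1)) \<and> q ^ q \<le> J \<epsilon> t * (n * 5 ^ (4 * n)) ^ 2"
proof -
  let ?ev = "even t"
  interpret K3: normal_words "K3 ?ev k" by (rule normal_words_K3)
  let ?s = "index (K1 k)"
  have fin3: "finite (range K3.cls)" by (rule index_K3_upper(1)[OF k])
  have short: "\<exists>v. K3.cong w v \<and> length v \<le> 4 * ?s" for w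
    using short_representatives[OF normal_words_K3 normal_words_K1 K1_square index_K1_signature(1)[OF k]]
    by (simp add: index_def)
  obtain T where T: "finite T" "[] \<in> T" "card T = n" "\<And>\<tau>. \<tau> \<in> T \<Longrightarrow> length \<tau> \<le> 4 * ?s"
    "\<And>w. \<exists>\<tau>\<in>T. K3.cong w \<tau>"
    using short_transversal[OF normal_words_K3 fin3 short] unfolding n_def index_def by metis
  have "K3.cls w \<in> K3.cls ` T" for w using T(5)[of w] by (auto simp: K3.cls_eq_iff image_iff)
  then have "K3.cls ` T = range K3.cls" by blast
  then have inj: "inj_on K3.cls T"
    using T(1,3) by (intro eq_card_imp_inj_on) (simp_all add: n_def index_def)
  let ?V = "{\<tau> \<in> T. P.cong \<tau> y0}"
  obtain S where S: "S \<subseteq> ?V" "card ?V \<le> card S * 156 ^ 4"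
    "\<And>h h' x. h \<in> S \<Longrightarrow> h' \<in> S \<Longrightarrow> K3.spread 78 h x \<Longrightarrow> K3.spread 78 h' x \<Longrightarrow> h = h'"
    using separated_family[OF T(1) inj, of ?V] by blast
  have finS: "finite S" using S(1) T(1) finite_subset by fastforce
  have "card S \<le> card T" using S(1) T(1) by (intro card_mono) auto
  then have Sn: "card S \<le> n" by (simp add: T(3))
  \<comment> \<open>The relators need q commutators on either side; at most one element of S is left
    over.\<close>
  define q where "q = card S div 2"
  have q: "2 * q \<le> card S" "card S \<le> 2 * q + 1" by (simp_all add: q_def)
  obtain h where h: "bij_betw h {..<card S} S"
    using ex_bij_betw_nat_finite[OF finS] by (auto simp: atLeast0LessThan)
  have hS: "h i \<in> S" if "i < 2 * q" for i using h q(1) that by (auto simp: bij_betw_def)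
  have hinj: "i = j" if "h i = h j" "i < 2 * q" "j < 2 * q" for i j
    using h q(1) that by (auto simp: bij_betw_def inj_on_def)
  have hT: "h i \<in> T" "P.cong (h i) y0" if "i < 2 * q" for i using hS[OF that] S(1) by auto
  define x where "x i = comm (xpow 78) (h i @ xpow 78 @ winv (h i))" for i
  \<comment> \<open>The padding power must have the parity of t. The exponent 39 is possible for odd
    t, where \<open>K3\<close> imposes no parity; the commutators use 78 in both cases.\<close>
  define N :: nat where "N = (if ?ev then 78 else 39)"
  have invar: "K3.invar kap1"
    unfolding K3.invar_def
  proof (intro allI impI)
    fix u v assume "K3.cong u v"
    then have "P.cong u v" using K3_imp_P by (simp add: K3.cong_def P.cong_def)
    then show "kap1 u = kap1 v" by (rule kap1_cong)
  qed
  have xlen: "length (x i) \<le> 16 * ?s + 624" if "i < 2 * q" for i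
    using T(4)[OF hT(1)[OF that]] by (simp add: x_def)
  have "n \<le> 13 ^ 13 * (156 ^ 4 * (2 * q + 1))"
  proof -
    have "card ?V \<le> 156 ^ 4 * (2 * q + 1)"
      using S(2) mult_le_mono1[OF q(2), of "156 ^ 4"] by (simp only: mult.commute)
    then show ?thesis
      using pool[OF T(1) inj T(5)] T(3) mult_le_mono2[of "card ?V" _ "13 ^ 13"] order_trans by blast
  qed
  moreover have "q ^ q \<le> J \<epsilon> t * (n * 5 ^ (4 * n)) ^ 2"
  proof (rule quotient_count[where x = x and N = "5 * N" and N0 = N and lx = "16 * ?s + 624" and l = "4 * ?s",
        OF normal_words_K3 K3_letters T])
    show "K3 ?ev k (x i)" for i unfolding x_def by (rule K3.K_comm'[OF K3_xpow(1)])
    show "length (x i) \<le> 16 * ?s + 624" if "i < 2 * q" for i using xlen[OF that] .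
    show "N \<ge> 1" by (simp add: N_def)
    show "5 * N = 5 * N" ..
    show "K3 ?ev k (xpow N)" using K3_xpow by (simp add: N_def)
    show "odd (5 * N) \<and> odd t \<or> even (5 * N) \<and> even t \<and> (\<forall>w. K3 ?ev k w \<longrightarrow> even (count_a w))"
      by (auto simp: N_def K3_def)
    show "16 * (2 * (4 * ?s) + 1) + 2 * (16 * ?s + 624) + 2 * (5 * N) + 4 \<le> t" "5 * (5 * N) + 2 \<le> t"
      using t by (auto simp: N_def)
    show "64 * n\<^sup>2 + 4 * n + q + 3 \<le> nat \<lfloor>2 powr (real t * \<epsilon>)\<rfloor>"
      using m Sn q(1) by linarith
    show "\<exists>Q. central_values (K3 ?ev k) (2 * q) x \<mu> Q" for \<mu>
      unfolding x_def
      by (rule K3.independent_commutators[OF K3_xpow(1) invar kap1_la kap1_Nil kap1_sum(1)[OF hT(2)] kap1_sum(2)[OF hT(2)]])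
        (use S(3) hS hinj in auto)
  qed
  ultimately show ?thesis by blast
qed

section \<open>The double exponential bound\<close>

text \<open>The left side is at most e^(35 n), because n + 2 (n + 16 n) = 35 n. As q is at least B =
  n / (3 C), it suffices that 35 n = 105 C B is at most B ln B, which holds once ln B \<ge> 105
  C.\<close>

lemma power_beats_exponential:
  fixes C :: real
  assumes "C \<ge> 1"
  shows "\<exists>n0. \<forall>n q :: nat. n0 \<le> real n \<longrightarrow> real n \<le> C * (2 * real q + 1) \<longrightarrow>
    exp (real n) * (real n * 5 ^ (4 * n)) ^ 2 \<le> real q ^ q"
proof (intro exI allI impI)
  fix n q :: nat
  assume n: "3 * C * exp (105 * C) \<le> real n" and q: "real n \<le> C * (2 * real q + 1)"
  define B where "B = real n / (3 * C)"
  have B: "exp (105 * C) \<le> B" using n assms by (simp add: B_def field_simps)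
  have B1: "B \<ge> 1" using assms by (intro order_trans[OF _ B]) simp
  have "real n / C \<le> 2 * real q + 1" using q assms by (simp add: field_simps)
  moreover have "real n / C = 3 * B" by (simp add: B_def)
  ultimately have qB: "B \<le> real q" using B1 by linarith
  have npos: "real n > 0" using n assms by (intro less_le_trans[OF _ n] mult_pos_pos) auto
  have lnB: "105 * C \<le> ln B" using B B1 by (subst ln_ge_iff) auto
  have "35 * real n = B * (105 * C)" using assms by (simp add: B_def)
  also have "\<dots> \<le> B * ln B" using lnB B1 by (intro mult_left_mono) auto
  also have "\<dots> \<le> real q * ln (real q)"
    using qB B1 by (intro mult_mono) (auto simp: ln_ge_zero)
  finally have main: "35 * real n \<le> real q * ln (real q)" .
  have "real n \<le> exp (real n)" using exp_ge_add_one_self[of "real n"] by linarith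
  moreover have "(5::real) ^ (4 * n) \<le> exp (16 * real n)"
  proof -
    have "(5::real) \<le> exp 4" using exp_ge_add_one_self[of 4] by simp
    then have "(5::real) ^ (4 * n) \<le> exp 4 ^ (4 * n)" by (intro power_mono) auto
    also have "\<dots> = exp (16 * real n)" by (simp flip: exp_of_nat_mult)
    finally show ?thesis .
  qed
  ultimately have "real n * 5 ^ (4 * n) \<le> exp (real n) * exp (16 * real n)"
    by (intro mult_mono) auto
  then have "(real n * 5 ^ (4 * n)) ^ 2 \<le> (exp (real n) * exp (16 * real n)) ^ 2"
    by (intro power_mono) auto
  also have "\<dots> = exp (34 * real n)"
    by (simp add: power2_eq_square flip: exp_add)
  finally have "exp (real n) * (real n * 5 ^ (4 * n)) ^ 2 \<le> exp (real n) * exp (34 * real n)"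
    by (intro mult_left_mono) auto
  also have "\<dots> = exp (35 * real n)" by (simp flip: exp_add)
  also have "\<dots> \<le> exp (real q * ln (real q))" using main by simp
  also have "\<dots> = real q ^ q"
    using qB B1 by (simp add: exp_of_nat_mult)
  finally show "exp (real n) * (real n * 5 ^ (4 * n)) ^ 2 \<le> real q ^ q" .
qed

theorem theorem1p3:
  shows "\<exists>\<epsilon>0 > (0::real). \<forall>\<epsilon>. 0 < \<epsilon> \<and> \<epsilon> \<le> \<epsilon>0 \<longrightarrow>
           (\<exists>\<rho> > (1::real). \<forall>\<^sub>F t in sequentially. real (J \<epsilon> t) \<ge> \<rho> powr (\<rho> ^ t))"
proof (rule exI[of _ 1], intro conjI allI impI)
  fix \<epsilon> :: real assume \<epsilon>: "0 < \<epsilon> \<and> \<epsilon> \<le> 1"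
  define C :: real where "C = 13 ^ 13 * 156 ^ 4"
  \<comment> \<open>The base group gets an order s of at most \<delta> t. The bound 1/320 leaves
    room for the lengths, as 160 s \<le> t/2. The bound \<epsilon>/20 leaves room for the number of
    relators: it is at most 2^(4 s + 9), with 4 s \<le> \<epsilon> t / 5 and 9 \<le> (4/5)
    \<epsilon> t.\<close>
  define \<delta> where "\<delta> = min (1 / 320) (\<epsilon> / 20)"
  \<comment> \<open>The losses between \<delta> t and the exponent r with n \<ge> 2^r: a factor 2
    for rounding, 2^13 from \<open>index_K1_window\<close> and 156^2 from
    \<open>index_K3_lower\<close>.\<close>
  define c where "c = \<delta> / (2 * 2 ^ 13 * 156 ^ 2)"
  define \<rho> where "\<rho> = 2 powr c"
  have \<delta>: "\<delta> > 0" "\<delta> \<le> 1 / 320" "\<delta> \<le> \<epsilon> / 20" using \<epsilon> by (auto simp: \<delta>_def)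
  have c: "c > 0" "c \<le> 1" using \<delta> by (simp_all add: c_def)
  have \<rho>: "1 < \<rho>" "\<rho> \<le> 2"
    using c powr_mono[of c 1 2] by (simp_all add: \<rho>_def)
  obtain n0 where n0: "\<And>n q :: nat. n0 \<le> real n \<Longrightarrow> real n \<le> C * (2 * real q + 1) \<Longrightarrow>
    exp (real n) * (real n * 5 ^ (4 * n)) ^ 2 \<le> real q ^ q"
    using power_beats_exponential[of C] by (auto simp: C_def)
  obtain T1 where T1: "max n0 1 < \<rho> ^ T1" using real_arch_pow[OF \<rho>(1)] by blast
  define T0 where "T0 = real T1 + 4096 + 12 / \<epsilon> + (2 + real (index (K1 1))) / \<delta>"
  have "real (J \<epsilon> t) \<ge> \<rho> powr (\<rho> ^ t)" if t: "nat \<lceil>T0\<rceil> \<le> t" for t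
  proof -
    have pos: "12 / \<epsilon> \<ge> 0" "(2 + real (index (K1 1))) / \<delta> \<ge> 0" using \<epsilon> \<delta> by auto
    have "T0 \<le> real t" using t by linarith
    then have t1: "real T1 \<le> t" "4096 \<le> real t" "12 / \<epsilon> \<le> real t" "(2 + real (index (K1 1))) / \<delta> \<le> real t"
      unfolding T0_def using pos by linarith+
    have t\<epsilon>: "12 \<le> \<epsilon> * real t" using t1(3) \<epsilon> by (simp add: field_simps)
    have t\<delta>: "2 + real (index (K1 1)) \<le> \<delta> * real t" using t1(4) \<delta> by (simp add: field_simps)
    define y where "y = nat \<lfloor>\<delta> * real t\<rfloor>"
    have y: "real y \<le> \<delta> * real t" "\<delta> * real t - 1 \<le> real y"
      using t\<delta> unfolding y_def by linarith+
    have "index (K1 1) \<le> y" using t\<delta> y(2) by linarith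
    then obtain k where k: "k > 0" "index (K1 k) \<le> y" "y < 2 ^ 13 * index (K1 k)"
      using index_K1_window by blast
    define s where "s = index (K1 k)"
    define n where "n = index (K3 (even t) k)"
    have s: "real s \<le> \<delta> * real t" using k(2) y(1) by (simp add: s_def)
    have "real s \<le> 1 / 320 * real t"
      by (rule order_trans[OF s mult_right_mono[OF \<delta>(2)]]) simp
    then have len: "160 * s + 2048 \<le> t" using t1(2) by linarith
    obtain r where r: "s \<le> r * 156 ^ 2" "2 ^ r \<le> n"
      using index_K3_lower[OF k(1)] unfolding s_def n_def by blast
    have n1: "n \<ge> 1" using r(2) by (meson one_le_numeral one_le_power order_trans)
    have "n \<le> s * (2 * 2 ^ s)" using index_K3_upper(2)[OF k(1)] by (simp add: s_def n_def)
    also have "\<dots> \<le> 2 ^ s * (2 * 2 ^ s)" using less_exp[of s] by (intro mult_le_mono1) simp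
    also have "\<dots> = 2 ^ (2 * s + 1)" by (simp add: power_add mult_2 distrib_left)
    finally have "n ^ 2 \<le> (2 ^ (2 * s + 1)) ^ 2" by (intro power_mono) auto
    also have "\<dots> = 2 ^ (4 * s + 2)" by (simp flip: power_mult)
    finally have n2: "n ^ 2 \<le> 2 ^ (4 * s + 2)" .
    have "n \<le> n ^ 2" "1 \<le> n ^ 2" using n1 by (simp_all add: power2_eq_square)
    then have "64 * n ^ 2 + 5 * n + 3 \<le> 128 * n ^ 2" by linarith
    also have "\<dots> \<le> 128 * 2 ^ (4 * s + 2)" using n2 by simp
    also have "\<dots> = 2 ^ (4 * s + 9)" by (simp add: power_add)
    finally have small: "64 * n ^ 2 + 5 * n + 3 \<le> 2 ^ (4 * s + 9)" .
    have "4 * real s \<le> \<epsilon> * real t / 5"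
      using s mult_right_mono[OF \<delta>(3), of "real t"] by simp
    then have "real (4 * s + 9) \<le> real t * \<epsilon>" using t\<epsilon> by (simp add: mult.commute)
    then have "2 powr real (4 * s + 9) \<le> 2 powr (real t * \<epsilon>)" by (intro powr_mono) auto
    then have "real (2 ^ (4 * s + 9)) \<le> 2 powr (real t * \<epsilon>)"
      by (simp only: powr_realpow of_nat_power of_nat_numeral zero_less_numeral)
    then have "2 ^ (4 * s + 9) \<le> nat \<lfloor>2 powr (real t * \<epsilon>)\<rfloor>" by (simp only: le_nat_floor)
    then have m: "64 * n ^ 2 + 5 * n + 3 \<le> nat \<lfloor>2 powr (real t * \<epsilon>)\<rfloor>" using small by linarith
    obtain q where q: "n \<le> 13 ^ 13 * (156 ^ 4 * (2 * q + 1))" "q ^ q \<le> J \<epsilon> t * (n * 5 ^ (4 * n)) ^ 2"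
      using many_quotients[OF k(1), of t \<epsilon>] len m unfolding s_def n_def by blast
    have "\<delta> * real t / 2 \<le> real y" using y(2) t\<delta> by linarith
    also have "real y \<le> 2 ^ 13 * real s"
    proof -
      have "real y \<le> real (2 ^ 13 * s)" using k(3) unfolding s_def of_nat_le_iff by (rule less_imp_le)
      then show ?thesis by simp
    qed
    also have "\<dots> \<le> 2 ^ 13 * (real r * 156 ^ 2)"
    proof -
      have "real s \<le> real (r * 156 ^ 2)" using r(1) unfolding of_nat_le_iff .
      then show ?thesis by simp
    qed
    finally have "c * real t \<le> real r" by (simp add: c_def field_simps)
    then have "2 powr (c * real t) \<le> 2 powr real r" by (intro powr_mono) auto
    also have "\<dots> \<le> real n" 
    proof -
      have "real (2 ^ r) \<le> real n" using r(2) unfolding of_nat_le_iff .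
      then show ?thesis by (simp add: powr_realpow)
    qed
    also have "2 powr (c * real t) = \<rho> ^ t"
      using \<rho>(1) by (simp add: \<rho>_def powr_powr flip: powr_realpow)
    finally have n\<rho>: "\<rho> ^ t \<le> real n" .
    have "\<rho> ^ T1 \<le> \<rho> ^ t" using t1(1) \<rho>(1) by (intro power_increasing) auto
    then have "n0 \<le> real n" using T1 n\<rho> by linarith
    moreover have "real n \<le> C * (2 * real q + 1)"
    proof -
      have "real n \<le> real (13 ^ 13 * (156 ^ 4 * (2 * q + 1)))" using q(1) unfolding of_nat_le_iff .
      then show ?thesis by (simp add: C_def)
    qed
    ultimately have "exp (real n) * (real n * 5 ^ (4 * n)) ^ 2 \<le> real q ^ q" by (rule n0)
    also have "\<dots> = real (q ^ q)" by simp
    also have "\<dots> \<le> real (J \<epsilon> t * (n * 5 ^ (4 * n)) ^ 2)" using q(2) unfolding of_nat_le_iff .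
    also have "\<dots> = real (J \<epsilon> t) * (real n * 5 ^ (4 * n)) ^ 2" by simp
    finally have J: "exp (real n) \<le> real (J \<epsilon> t)" using n1 by simp
    have "\<rho> powr (\<rho> ^ t) \<le> exp 1 powr (\<rho> ^ t)"
      using \<rho> exp_ge_add_one_self[of 1] by (intro powr_mono2) auto
    also have "\<dots> = exp (\<rho> ^ t)" by (simp add: powr_def)
    also have "\<dots> \<le> exp (real n)" using n\<rho> by simp
    finally show ?thesis using J by linarith
  qed
  then have "\<forall>\<^sub>F t in sequentially. real (J \<epsilon> t) \<ge> \<rho> powr (\<rho> ^ t)"
    unfolding eventually_sequentially by blast
  then show "\<exists>\<rho> > (1::real). \<forall>\<^sub>F t in sequentially. real (J \<epsilon> t) \<ge> \<rho> powr (\<rho> ^ t)"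
    using \<rho>(1) by blast
qed simp

end
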